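(* Let $c>0$ and $p>1$ be constants and $a_k=\lfloor ck^p\rfloor$, $k\ge1$. Assume $\mathbb E X_i=0$, $X_i\in\mathcal L^\alpha$ for some $\alpha>4$, and $\sum_{j=0}^\infty\delta_\alpha(j)<\infty$. Then $$\lim_{n\to\infty}\frac{\|V_n-\mathbb EV_n\|_2}{n^{2-3/(2p)}}=\frac{\sigma^2p^2c^{3/(2p)}}{\sqrt{12p-9}}.$$
   Context: Let $(\varepsilon_i)_{i\in\mathbb Z}$ be i.i.d. random variables, $\mathcal F_i$ the $\sigma$-field generated by $(\ldots,\varepsilon_{i-1},\varepsilon_i)$, and $X_i=g(\ldots,\varepsilon_{i-1},\varepsilon_i)$ for a measurable $g$ such that $X_i$ is well defined. $\|\xi\|_p=(\mathbb E|\xi|^p)^{1/p}$ and $\xi\in\mathcal L^p$ means $\|\xi\|_p<\infty$. Projection operator: $\mathcal P_i\xi=\mathbb E(\xi\mid\mathcal F_i)-\mathbb E(\xi\mid\mathcal F_{i-1})$. Physical dependence measure: let $\varepsilon_0'$ have the law of $\varepsilon_0$ and be independent of $(\varepsilon_j)$; for $i\ge0$ set $X_i'=g(\ldots,\varepsilon_{-1},\varepsilon_0',\varepsilon_1,\ldots,\varepsilon_i)$ and $\delta_p(i)=\|X_i-X_i'\|_p$. Under the hypotheses, $D_k=\sum_{i\ge k}\mathcal P_kX_i$ converges in $\mathcal L^2$ and $\sigma=\|D_0\|_2$. Given an integer sequence $(a_k)_{k\ge1}$ with $a_k\to\infty$, define for $i\ge1$: $t_i=\max(\{1\}\cup\{a_k:k\ge1,\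 a_k\le i\})$, $W_i=X_{t_i}+\cdots+X_i$, $V_n=\sum_{i=1}^nW_i^2$. *)

theory Defs
  imports "HOL-Probability.Probability"
begin

text \<open>Innovations: \<open>\<epsilon> :: int \<Rightarrow> 'a \<Rightarrow> 'b\<close> on the probability space \<open>M\<close>, with values in
  the measurable space \<open>N\<close>. The kernel \<open>g\<close> takes the past sequence in reversed order:
  argument \<open>k\<close> is \<open>\<epsilon>\<^sub>(i-k)\<close>.\<close>

definition Xproc :: "(int \<Rightarrow> 'a \<Rightarrow> 'b) \<Rightarrow> ((nat \<Rightarrow> 'b) \<Rightarrow> real) \<Rightarrow> int \<Rightarrow> 'a \<Rightarrow> real" where
  "Xproc \<epsilon> g i = (\<lambda>\<omega>. g (\<lambda>k. \<epsilon> (i - int k) \<omega>))"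

definition filt :: "'a measure \<Rightarrow> 'b measure \<Rightarrow> (int \<Rightarrow> 'a \<Rightarrow> 'b) \<Rightarrow> int \<Rightarrow> 'a measure" where
  "filt M N \<epsilon> i = sigma (space M) {\<epsilon> j -` A \<inter> space M | j A. j \<le> i \<and> A \<in> sets N}"

definition proj :: "'a measure \<Rightarrow> 'b measure \<Rightarrow> (int \<Rightarrow> 'a \<Rightarrow> 'b) \<Rightarrow> int \<Rightarrow> ('a \<Rightarrow> real) \<Rightarrow> 'a \<Rightarrow> real" where
  "proj M N \<epsilon> i \<xi> = (\<lambda>\<omega>. real_cond_exp M (filt M N \<epsilon> i) \<xi> \<omega> - real_cond_exp M (filt M N \<epsilon> (i - 1)) \<xi> \<omega>)"

text \<open>Physical dependence measure \<open>\<delta>\<^sub>p(i) = \<parallel>X\<^sub>i - X\<^sub>i'\<parallel>\<^sub>p\<close>, \<open>i \<ge> 0\<close>, computed on the canonical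
  space: \<open>x\<close> is an i.i.d. sequence with law \<open>\<mu>\<close> of \<open>\<epsilon>\<^sub>0\<close> (playing \<open>(\<epsilon>\<^sub>i, \<epsilon>\<^sub>(i-1), \<dots>)\<close>),
  \<open>y\<close> an independent copy \<open>\<epsilon>\<^sub>0'\<close> which replaces coordinate \<open>i\<close> (i.e. \<open>\<epsilon>\<^sub>0\<close>).\<close>
definition phys_dep :: "'a measure \<Rightarrow> 'b measure \<Rightarrow> (int \<Rightarrow> 'a \<Rightarrow> 'b) \<Rightarrow> ((nat \<Rightarrow> 'b) \<Rightarrow> real)
    \<Rightarrow> real \<Rightarrow> nat \<Rightarrow> real" where
  "phys_dep M N \<epsilon> g p i =
     (let \<mu> = distr M N (\<epsilon> 0) in
      (\<integral>xy. \<bar>g (fst xy) - g ((fst xy)(i := snd xy))\<bar> powr p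
          \<partial>(PiM (UNIV :: nat set) (\<lambda>_. \<mu>) \<Otimes>\<^sub>M \<mu>)) powr (1 / p))"

text \<open>Long-run standard deviation \<open>\<sigma> = \<parallel>D\<^sub>0\<parallel>\<^sub>2\<close>, \<open>D\<^sub>0 = \<Sum>\<^sub>(i\<ge>0) \<P>\<^sub>0 X\<^sub>i\<close> (limit in \<open>\<L>\<^sup>2\<close>);
  \<open>\<parallel>D\<^sub>0\<parallel>\<^sub>2\<close> is the limit of the \<open>\<L>\<^sup>2\<close>-norms of the partial sums.\<close>
definition sigma_lr :: "'a measure \<Rightarrow> 'b measure \<Rightarrow> (int \<Rightarrow> 'a \<Rightarrow> 'b) \<Rightarrow> ((nat \<Rightarrow> 'b) \<Rightarrow> real) \<Rightarrow> real" where
  "sigma_lr M N \<epsilon> g =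
     lim (\<lambda>n. sqrt (\<integral>\<omega>. (\<Sum>i\<le>n. proj M N \<epsilon> 0 (Xproc \<epsilon> g (int i)) \<omega>)\<^sup>2 \<partial>M))"

definition tblk :: "(nat \<Rightarrow> int) \<Rightarrow> nat \<Rightarrow> int" where
  "tblk a i = Max ({1} \<union> {a k | k. k \<ge> 1 \<and> a k \<le> int i})"

definition Wblk :: "(int \<Rightarrow> 'a \<Rightarrow> real) \<Rightarrow> (nat \<Rightarrow> int) \<Rightarrow> nat \<Rightarrow> 'a \<Rightarrow> real" where
  "Wblk X a i = (\<lambda>\<omega>. \<Sum>j\<in>{tblk a i..int i}. X j \<omega>)"

definition Vn :: "(int \<Rightarrow> 'a \<Rightarrow> real) \<Rightarrow> (nat \<Rightarrow> int) \<Rightarrow> nat \<Rightarrow> 'a \<Rightarrow> real" where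
  "Vn X a n = (\<lambda>\<omega>. \<Sum>i=1..n. (Wblk X a i \<omega>)\<^sup>2)"

end

theory Submission
  imports Defs "HOL-Real_Asymp.Real_Asymp"
begin

text \<open>
Both sides are computed on the product space of two-sided innovation sequences. Replacing one innovation
(or averaging over it) changes a partial sum by at most a sum of dependence coefficients, so
Efron--Stein inequalities in \<open>L\<^sup>2\<close> and \<open>L\<^sup>4\<close> bound the centered quadratic forms
\<open>\<Sum>\<^sub>i W\<^sub>i(u) W\<^sub>i(v)\<close> by \<open>C \<Delta>(u) \<Delta>(v) n\<^bsup>2-3/(2p)\<^esup>\<close>, where \<open>\<Delta>\<close> is the total dependence of a kernel.
Since \<open>W(u)\<^sup>2 - W(v)\<^sup>2 = W(u-v) W(u+v)\<close>, it suffices to treat bounded centered kernels of finite range \<open>m\<close>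
that approximate \<open>g\<close> in the sense of \<open>\<Delta>\<close>.
For such a kernel, dropping the first \<open>m\<close> terms of every block makes the blocks independent at negligible cost.
The variance of \<open>\<Sum>\<^sub>i\<^sub>\<le>\<^sub>l S\<^sub>i\<^sup>2\<close> over a block of length \<open>l\<close> is \<open>\<sigma>\<^sup>4 l\<^sup>4 / 3 (1 + o(1))\<close>: the relation
\<open>E S\<^sub>2\<^sub>s\<^sup>4 = 2 E S\<^sub>s\<^sup>4 + 6 \<sigma>\<^sup>4 s\<^sup>2 + O(s\<^bsup>3/2\<^esup>)\<close> forces \<open>E S\<^sub>s\<^sup>4 = 3 \<sigma>\<^sup>4 s\<^sup>2 + O(s\<^bsup>3/2\<^esup>)\<close>,
whence \<open>Cov(S\<^sub>s\<^sup>2, S\<^sub>t\<^sup>2) = 2 \<sigma>\<^sup>4 min(s,t)\<^sup>2 + O(t\<^bsup>3/2\<^esup>)\<close>. Summing over blocks of length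
\<open>\<sim> c p k\<^bsup>p-1\<^esup>\<close> gives the constant.
\<close>

subsection \<open>Norms of even order\<close>

text \<open>The normalisation comes from about n^(1/p) blocks of length about n^(1 - 1/p), each with
  variance of order length^4, in total n^(4 - 3/p). Summing (c p k^(p-1))^4 over k up to (n/c)^(1/p)
  gives c^(3/p) p^4 / (4p - 3), and the factor 1/3 turns 4p - 3 into 12p - 9. The obstacle is
  uniformity in n: L4 closeness of kernels alone gives errors growing faster than the normalisation.
  Uniform bounds come from summed dependence coefficients, with constants that involve neither the
  range nor the bound of a kernel. They are proved for bounded kernels, where every Fubini step is
  free, and reach \<open>g\<close> by letting a second kernel tend to \<open>g\<close> while n is
  fixed. The summed coefficients of \<open>g\<close> minus its approximations vanish by dominated
  convergence for series, without any rate: neither truncation nor conditioning on finitely many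
  coordinates increases a coefficient. The same two-step limit identifies \<sigma>, because for
  finite range the squared norm of D_0 is a telescoping sum of products of conditional expectations
  and equals the sum of all autocovariances.\<close>

text \<open>Only even \<open>q > 0\<close> are meaningful below: no absolute value is taken.\<close>

definition Lq :: "nat \<Rightarrow> 'a measure \<Rightarrow> ('a \<Rightarrow> real) set" where
  "Lq q M = {f \<in> borel_measurable M. integrable M (\<lambda>x. f x ^ q)}"

definition nrm :: "nat \<Rightarrow> 'a measure \<Rightarrow> ('a \<Rightarrow> real) \<Rightarrow> real" where
  "nrm q M f = root q (\<integral>x. f x ^ q \<partial>M)"

lemma LqD:
  assumes "f \<in> Lq q M"
  shows "f \<in> borel_measurable M" "integrable M (\<lambda>x. f x ^ q)"
  using assms by (auto simp: Lq_def)

lemma nrm_nonneg: "even q \<Longrightarrow> 0 \<le> nrm q M f"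
  by (cases "q = 0") (auto simp: nrm_def intro!: real_root_ge_zero integral_nonneg_AE)

lemma nrm_power: "even q \<Longrightarrow> 0 < q \<Longrightarrow> nrm q M f ^ q = (\<integral>x. f x ^ q \<partial>M)"
  unfolding nrm_def by (rule real_root_pow_pos2) (auto intro!: integral_nonneg_AE)

lemma nrm_le_iff:
  assumes "even q" "0 < q" "0 \<le> a"
  shows "nrm q M f \<le> a \<longleftrightarrow> (\<integral>x. f x ^ q \<partial>M) \<le> a ^ q"
  using power_mono_iff[OF nrm_nonneg[OF assms(1)] assms(3,2), of M f] nrm_power[OF assms(1,2), of M f]
  by simp

lemma nrm_cong: "(\<And>x. x \<in> space M \<Longrightarrow> f x = g x) \<Longrightarrow> nrm q M f = nrm q M g"
  unfolding nrm_def by (simp cong: Bochner_Integration.integral_cong)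

lemma Lq_mono:
  assumes "even q" "g \<in> Lq q M" "f \<in> borel_measurable M"
    and "\<And>x. x \<in> space M \<Longrightarrow> \<bar>f x\<bar> \<le> \<bar>g x\<bar>"
  shows "f \<in> Lq q M" "nrm q M f \<le> nrm q M g"
proof -
  have le: "f x ^ q \<le> g x ^ q" if "x \<in> space M" for x
    using power_mono[OF assms(4)[OF that], of q] assms(1) by (simp add: power_even_abs)
  have g: "integrable M (\<lambda>x. g x ^ q)" using assms by (auto simp: Lq_def)
  have f: "integrable M (\<lambda>x. f x ^ q)"
    using assms(1,3) le by (intro Bochner_Integration.integrable_bound[OF g]) (auto intro!: AE_I2 simp: zero_le_even_power)
  then show "f \<in> Lq q M" using assms by (auto simp: Lq_def)
  show "nrm q M f \<le> nrm q M g"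
    by (cases "q = 0") (auto simp: nrm_def intro!: real_root_le_mono integral_mono f g le)
qed

text \<open>Convexity of the even power, applied with weights a/(a+b) and b/(a+b) to the normalised
  functions f/a and g/b. Positive upper bounds a and b stand for the norms, so that a vanishing norm
  is no special case.\<close>

lemma Lq_add_aux:
  assumes q: "even q" "0 < q" and f: "f \<in> Lq q M" and g: "g \<in> Lq q M"
    and a: "0 < a" "(\<integral>x. f x ^ q \<partial>M) \<le> a ^ q" and b: "0 < b" "(\<integral>x. g x ^ q \<partial>M) \<le> b ^ q"
  shows "integrable M (\<lambda>x. (f x + g x) ^ q)" "(\<integral>x. (f x + g x) ^ q \<partial>M) \<le> (a + b) ^ q"
proof -
  define t where "t = a / (a + b)"
  have t: "0 < t" "t < 1" "1 - t = b / (a + b)" using a b by (auto simp: t_def field_simps)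
  define B where "B = (\<lambda>x. (a + b) ^ q * (t * (f x / a) ^ q + (1 - t) * (g x / b) ^ q))"
  have le: "(f x + g x) ^ q \<le> B x" for x
  proof -
    have "(t * (f x / a) + (1 - t) * (g x / b)) ^ q \<le> t * (f x / a) ^ q + (1 - t) * (g x / b) ^ q"
      using convex_onD[OF convex_power_even[OF q(1)], of "1 - t" "f x / a" "g x / b"] t(1,2) by simp
    moreover have "t * (f x / a) + (1 - t) * (g x / b) = (f x + g x) / (a + b)"
      unfolding t(3) using a b by (simp add: t_def add_divide_distrib)
    ultimately have "(f x + g x) ^ q / (a + b) ^ q \<le> t * (f x / a) ^ q + (1 - t) * (g x / b) ^ q"
      by (simp add: power_divide)
    then show ?thesis unfolding B_def using a b by (simp add: divide_simps mult.commute)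
  qed
  have fi: "integrable M (\<lambda>x. f x ^ q)" "integrable M (\<lambda>x. g x ^ q)"
    and fm: "f \<in> borel_measurable M" "g \<in> borel_measurable M" using f g by (auto simp: Lq_def)
  have Bi: "integrable M B"
    unfolding B_def by (simp add: power_divide fi)
  show i: "integrable M (\<lambda>x. (f x + g x) ^ q)"
    using q fm le by (intro Bochner_Integration.integrable_bound[OF Bi])
      (auto intro!: AE_I2 order_trans[OF le abs_ge_self] simp: zero_le_even_power)
  have "(\<integral>x. (f x + g x) ^ q \<partial>M) \<le> integral\<^sup>L M B"
    by (intro integral_mono i Bi le)
  also have "\<dots> = (a + b) ^ q * (t * ((\<integral>x. f x ^ q \<partial>M) / a ^ q) + (1 - t) * ((\<integral>x. g x ^ q \<partial>M) / b ^ q))"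
    unfolding B_def by (simp add: power_divide fi)
  also have "\<dots> \<le> (a + b) ^ q * (t * 1 + (1 - t) * 1)"
    using a b t by (intro mult_left_mono add_mono) (auto simp: divide_simps)
  finally show "(\<integral>x. (f x + g x) ^ q \<partial>M) \<le> (a + b) ^ q" by simp
qed

text \<open>The norms enlarged by e > 0 are admissible bounds in \<open>Lq_add_aux\<close>; then e
  tends to 0. This is Minkowski's inequality for even exponents.\<close>

lemma Lq_add:
  assumes q: "even q" "0 < q" and f: "f \<in> Lq q M" and g: "g \<in> Lq q M"
  shows "(\<lambda>x. f x + g x) \<in> Lq q M"
    and "nrm q M (\<lambda>x. f x + g x) \<le> nrm q M f + nrm q M g"
proof -
  have aux: "integrable M (\<lambda>x. (f x + g x) ^ q) \<and>
      (\<integral>x. (f x + g x) ^ q \<partial>M) \<le> ((nrm q M f + e) + (nrm q M g + e)) ^ q" if "e > 0" for e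
    using Lq_add_aux[OF q f g, of "nrm q M f + e" "nrm q M g + e"] nrm_nonneg[OF q(1), of M f]
      nrm_nonneg[OF q(1), of M g] that nrm_le_iff[OF q, of "nrm q M f + e" M f] nrm_le_iff[OF q, of "nrm q M g + e" M g]
    by auto
  show "(\<lambda>x. f x + g x) \<in> Lq q M"
    using aux[of 1] f g by (auto simp: Lq_def)
  show "nrm q M (\<lambda>x. f x + g x) \<le> nrm q M f + nrm q M g"
  proof (rule field_le_epsilon)
    fix e :: real assume "e > 0"
    then show "nrm q M (\<lambda>x. f x + g x) \<le> nrm q M f + nrm q M g + e"
      using aux[of "e/2"] nrm_le_iff[OF q, of "nrm q M f + nrm q M g + e" M "\<lambda>x. f x + g x"]
        nrm_nonneg[OF q(1), of M f] nrm_nonneg[OF q(1), of M g] by (auto simp: algebra_simps)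
  qed
qed

lemma Lq_uminus:
  assumes q: "even q" and f: "f \<in> Lq q M"
  shows "(\<lambda>x. - f x) \<in> Lq q M" "nrm q M (\<lambda>x. - f x) = nrm q M f"
  using assms by (auto simp: Lq_def nrm_def)

lemma Lq_diff:
  assumes q: "even q" "0 < q" and f: "f \<in> Lq q M" and g: "g \<in> Lq q M"
  shows "(\<lambda>x. f x - g x) \<in> Lq q M"
    and "nrm q M (\<lambda>x. f x - g x) \<le> nrm q M f + nrm q M g"
  using Lq_add[OF q f Lq_uminus(1)[OF q(1) g]] Lq_uminus(2)[OF q(1) g] by auto

lemma nrm_triangle_rev:
  assumes q: "even q" "0 < q" and f: "f \<in> Lq q M" and g: "g \<in> Lq q M"
  shows "\<bar>nrm q M f - nrm q M g\<bar> \<le> nrm q M (\<lambda>x. f x - g x)"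
  using Lq_add(2)[OF q Lq_diff(1)[OF q f g] g] Lq_diff(2)[OF q f Lq_diff(1)[OF q f g]] by auto

lemma nrm_zero: "0 < q \<Longrightarrow> nrm q M (\<lambda>x. 0) = 0"
  by (simp add: nrm_def)

lemma Lq_zero: "(\<lambda>x. 0) \<in> Lq q M" if "0 < q"
  using that by (simp add: Lq_def power_0_left)

lemma Lq_sum:
  assumes q: "even q" "0 < q" and f: "\<And>i. i \<in> I \<Longrightarrow> f i \<in> Lq q M"
  shows "(\<lambda>x. \<Sum>i\<in>I. f i x) \<in> Lq q M" "nrm q M (\<lambda>x. \<Sum>i\<in>I. f i x) \<le> (\<Sum>i\<in>I. nrm q M (f i))"
  using f
proof (induction I rule: infinite_finite_induct)
  case (insert i I)
  { case 1
    then show ?case using insert.hyps insert.IH(1) Lq_add(1)[OF q, of "f i" M "\<lambda>x. \<Sum>i\<in>I. f i x"] by simp }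
  { case 2
    have f: "f i \<in> Lq q M" "(\<lambda>x. \<Sum>i\<in>I. f i x) \<in> Lq q M"
      "nrm q M (\<lambda>x. \<Sum>i\<in>I. f i x) \<le> (\<Sum>i\<in>I. nrm q M (f i))"
      using 2 insert.IH by auto
    then show ?case using insert.hyps Lq_add(2)[OF q f(1,2)] by simp }
qed (auto simp: Lq_zero nrm_zero q)

text \<open>From 2xy \<le> x^2 + y^2 with x = f^2/a^2 and y = g^2/b^2, where a and b are the norms
  up to an arbitrarily small enlargement. This is why fourth-order norms are used throughout:
  products of two partial sums land in L2.\<close>

lemma Lq_mult:
  assumes f: "f \<in> Lq 4 M" and g: "g \<in> Lq 4 M"
  shows "(\<lambda>x. f x * g x) \<in> Lq 2 M"
    and "nrm 2 M (\<lambda>x. f x * g x) \<le> nrm 4 M f * nrm 4 M g"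
proof -
  have fi: "integrable M (\<lambda>x. f x ^ 4)" "integrable M (\<lambda>x. g x ^ 4)"
    and [measurable]: "f \<in> borel_measurable M" "g \<in> borel_measurable M" using f g by (auto simp: Lq_def)
  have aux: "integrable M (\<lambda>x. (f x * g x)\<^sup>2) \<and> (\<integral>x. (f x * g x)\<^sup>2 \<partial>M) \<le> (a * b)\<^sup>2"
    if a: "0 < a" "(\<integral>x. f x ^ 4 \<partial>M) \<le> a ^ 4" and b: "0 < b" "(\<integral>x. g x ^ 4 \<partial>M) \<le> b ^ 4" for a b
  proof
    define B where "B = (\<lambda>x. (a * b)\<^sup>2 / 2 * (f x ^ 4 / a ^ 4 + g x ^ 4 / b ^ 4))"
    have le: "(f x * g x)\<^sup>2 \<le> B x" for x
    proof -
      have "0 \<le> (a * b)\<^sup>2 / 2 * ((f x)\<^sup>2 / a\<^sup>2 - (g x)\<^sup>2 / b\<^sup>2)\<^sup>2" by simp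
      also have "\<dots> = B x - (f x * g x)\<^sup>2"
        unfolding B_def using a b by (simp add: field_simps power2_eq_square power4_eq_xxxx)
      finally show ?thesis by simp
    qed
    have Bi: "integrable M B" unfolding B_def by (simp add: fi)
    show i: "integrable M (\<lambda>x. (f x * g x)\<^sup>2)"
      by (intro Bochner_Integration.integrable_bound[OF Bi]) (auto intro!: AE_I2 order_trans[OF le abs_ge_self])
    have "(\<integral>x. (f x * g x)\<^sup>2 \<partial>M) \<le> integral\<^sup>L M B" by (intro integral_mono i Bi le)
    also have "\<dots> = (a * b)\<^sup>2 / 2 * ((\<integral>x. f x ^ 4 \<partial>M) / a ^ 4 + (\<integral>x. g x ^ 4 \<partial>M) / b ^ 4)"
      unfolding B_def by (simp add: fi)
    also have "\<dots> \<le> (a * b)\<^sup>2 / 2 * (1 + 1)"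
      using a b by (intro mult_left_mono add_mono) (auto simp: divide_simps)
    finally show "(\<integral>x. (f x * g x)\<^sup>2 \<partial>M) \<le> (a * b)\<^sup>2" by simp
  qed
  have aux2: "integrable M (\<lambda>x. (f x * g x)\<^sup>2) \<and> nrm 2 M (\<lambda>x. f x * g x) \<le> (nrm 4 M f + e) * (nrm 4 M g + e)"
    if "e > 0" for e
    using aux[of "nrm 4 M f + e" "nrm 4 M g + e"] nrm_nonneg[of 4 M f] nrm_nonneg[of 4 M g] that
      nrm_le_iff[of 4 "nrm 4 M f + e" M f] nrm_le_iff[of 4 "nrm 4 M g + e" M g]
      nrm_le_iff[of 2 "(nrm 4 M f + e) * (nrm 4 M g + e)" M "\<lambda>x. f x * g x"]
    by auto
  show "(\<lambda>x. f x * g x) \<in> Lq 2 M" using aux2[of 1] by (simp add: Lq_def)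
  have "((\<lambda>e. (nrm 4 M f + e) * (nrm 4 M g + e)) \<longlongrightarrow> (nrm 4 M f + 0) * (nrm 4 M g + 0)) (at_right 0)"
    by (intro tendsto_intros)
  then show "nrm 2 M (\<lambda>x. f x * g x) \<le> nrm 4 M f * nrm 4 M g"
    using aux2 by (intro tendsto_lowerbound[of _ "nrm 4 M f * nrm 4 M g" "at_right 0"])
      (auto simp: eventually_at_right_less intro: eventually_mono[OF eventually_at_right_less])
qed

lemma Lq_Cauchy_Schwarz:
  assumes f: "f \<in> Lq 2 M" and g: "g \<in> Lq 2 M"
  shows "integrable M (\<lambda>x. f x * g x)"
    and "\<bar>\<integral>x. f x * g x \<partial>M\<bar> \<le> nrm 2 M f * nrm 2 M g"
proof -
  have fi: "integrable M (\<lambda>x. (f x)\<^sup>2)" "integrable M (\<lambda>x. (g x)\<^sup>2)"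
    and [measurable]: "f \<in> borel_measurable M" "g \<in> borel_measurable M" using f g by (auto simp: Lq_def)
  have aux: "integrable M (\<lambda>x. f x * g x) \<and> \<bar>\<integral>x. f x * g x \<partial>M\<bar> \<le> a * b"
    if a: "0 < a" "(\<integral>x. (f x)\<^sup>2 \<partial>M) \<le> a\<^sup>2" and b: "0 < b" "(\<integral>x. (g x)\<^sup>2 \<partial>M) \<le> b\<^sup>2" for a b
  proof
    define B where "B = (\<lambda>x. (a * b) / 2 * ((f x)\<^sup>2 / a\<^sup>2 + (g x)\<^sup>2 / b\<^sup>2))"
    have le: "\<bar>f x * g x\<bar> \<le> B x" for x
    proof -
      have "0 \<le> (a * b) / 2 * (\<bar>f x\<bar> / a - \<bar>g x\<bar> / b)\<^sup>2" using a b by simp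
      also have "\<dots> = (a * b) / 2 * (\<bar>f x\<bar>\<^sup>2 / a\<^sup>2 + \<bar>g x\<bar>\<^sup>2 / b\<^sup>2) - \<bar>f x\<bar> * \<bar>g x\<bar>"
        using a b by (simp add: field_simps power2_eq_square)
      also have "\<dots> = B x - \<bar>f x * g x\<bar>" by (simp add: B_def abs_mult)
      finally show ?thesis by simp
    qed
    have Bi: "integrable M B" unfolding B_def by (simp add: fi)
    show i: "integrable M (\<lambda>x. f x * g x)"
      by (intro Bochner_Integration.integrable_bound[OF Bi]) (auto intro!: AE_I2 order_trans[OF le abs_ge_self])
    have "\<bar>\<integral>x. f x * g x \<partial>M\<bar> \<le> (\<integral>x. \<bar>f x * g x\<bar> \<partial>M)" by (rule integral_abs_bound)
    also have "\<dots> \<le> integral\<^sup>L M B" using i by (intro integral_mono Bi le) auto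
    also have "\<dots> = (a * b) / 2 * ((\<integral>x. (f x)\<^sup>2 \<partial>M) / a\<^sup>2 + (\<integral>x. (g x)\<^sup>2 \<partial>M) / b\<^sup>2)"
      unfolding B_def by (simp add: fi)
    also have "\<dots> \<le> (a * b) / 2 * (1 + 1)"
      using a b by (intro mult_left_mono add_mono) (auto simp: divide_simps)
    finally show "\<bar>\<integral>x. f x * g x \<partial>M\<bar> \<le> a * b" by simp
  qed
  have aux2: "integrable M (\<lambda>x. f x * g x) \<and> \<bar>\<integral>x. f x * g x \<partial>M\<bar> \<le> (nrm 2 M f + e) * (nrm 2 M g + e)"
    if "e > 0" for e
    using aux[of "nrm 2 M f + e" "nrm 2 M g + e"] nrm_nonneg[of 2 M f] nrm_nonneg[of 2 M g] that
      nrm_le_iff[of 2 "nrm 2 M f + e" M f] nrm_le_iff[of 2 "nrm 2 M g + e" M g]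
    by auto
  show "integrable M (\<lambda>x. f x * g x)" using aux2[of 1] by simp
  have "((\<lambda>e. (nrm 2 M f + e) * (nrm 2 M g + e)) \<longlongrightarrow> (nrm 2 M f + 0) * (nrm 2 M g + 0)) (at_right 0)"
    by (intro tendsto_intros)
  then show "\<bar>\<integral>x. f x * g x \<partial>M\<bar> \<le> nrm 2 M f * nrm 2 M g"
    using aux2 by (intro tendsto_lowerbound[of _ "nrm 2 M f * nrm 2 M g" "at_right 0"])
      (auto intro: eventually_mono[OF eventually_at_right_less])
qed

lemma nrm_distr:
  assumes [measurable]: "T \<in> measurable M N" "f \<in> borel_measurable N"
  shows "nrm q (distr M N T) f = nrm q M (\<lambda>x. f (T x))"
  unfolding nrm_def by (subst integral_distr) auto

lemma Lq_distr:
  assumes [measurable]: "T \<in> measurable M N" "f \<in> borel_measurable N"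
  shows "f \<in> Lq q (distr M N T) \<longleftrightarrow> (\<lambda>x. f (T x)) \<in> Lq q M"
  unfolding Lq_def by (auto simp: integrable_distr_eq)

context prob_space
begin

lemma Lq_bounded:
  assumes [measurable]: "f \<in> borel_measurable M" and "\<And>x. x \<in> space M \<Longrightarrow> \<bar>f x\<bar> \<le> C"
  shows "f \<in> Lq q M"
proof -
  have "integrable M (\<lambda>x. f x ^ q)"
    using assms(2) by (intro integrable_const_bound[of _ "C ^ q"]) (auto simp: power_abs intro!: AE_I2 power_mono)
  then show ?thesis by (simp add: Lq_def)
qed

lemma nrm_const: "even q \<Longrightarrow> 0 < q \<Longrightarrow> nrm q M (\<lambda>x. c) = \<bar>c\<bar>"
  using real_root_power_cancel[of q "\<bar>c\<bar>"] by (simp add: nrm_def prob_space power_even_abs)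

lemma Lq_const: "(\<lambda>x. c) \<in> Lq q M"
  by (simp add: Lq_def)

lemma Lq_2_integrable:
  assumes "f \<in> Lq 2 M"
  shows "integrable M f" "\<bar>expectation f\<bar> \<le> nrm 2 M f"
  using Lq_Cauchy_Schwarz[OF assms Lq_const[of 1]] by (auto simp: nrm_const)

lemma Lq_4_2:
  assumes "f \<in> Lq 4 M"
  shows "f \<in> Lq 2 M" "nrm 2 M f \<le> nrm 4 M f"
  using Lq_mult[OF assms Lq_const[of 1]] by (auto simp: nrm_const)

lemma nrm_centered:
  assumes "f \<in> Lq 2 M"
  shows "(\<lambda>x. f x - expectation f) \<in> Lq 2 M" "nrm 2 M (\<lambda>x. f x - expectation f) \<le> nrm 2 M f"
proof -
  show "(\<lambda>x. f x - expectation f) \<in> Lq 2 M" using assms by (intro Lq_diff Lq_const) auto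
  have "(\<integral>x. (f x - expectation f)\<^sup>2 \<partial>M) \<le> (\<integral>x. (f x)\<^sup>2 \<partial>M)"
    using variance_eq[of f] Lq_2_integrable[OF assms] assms by (auto simp: Lq_def)
  then show "nrm 2 M (\<lambda>x. f x - expectation f) \<le> nrm 2 M f"
    by (simp add: nrm_def)
qed

lemma power_expectation_le:
  fixes f :: "'a \<Rightarrow> real"
  assumes "even q" "integrable M f" "integrable M (\<lambda>x. f x ^ q)"
  shows "(expectation f) ^ q \<le> expectation (\<lambda>x. f x ^ q)"
  using assms convex_power_even[OF assms(1)]
  by (intro jensens_inequality[where I=UNIV and q="\<lambda>x. x ^ q"]) auto

end

subsection \<open>Averaging over one coordinate of an i.i.d. sequence\<close>

locale iid_seq = prob_space \<mu> for \<mu> :: "'b measure"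
begin

abbreviation P :: "(int \<Rightarrow> 'b) measure" where "P \<equiv> PiM UNIV (\<lambda>_. \<mu>)"
abbreviation S :: "(nat \<Rightarrow> 'b) measure" where "S \<equiv> PiM UNIV (\<lambda>_. \<mu>)"

sublocale PP: product_prob_space "\<lambda>_. \<mu>" "UNIV :: int set"
  by unfold_locales

sublocale SS: sequence_space \<mu>
  by unfold_locales



text \<open>The conditional expectation given all coordinates except j, as an explicit integral. Its
  algebraic identities then hold at every point of the space instead of almost everywhere.\<close>

definition avg :: "int \<Rightarrow> ((int \<Rightarrow> 'b) \<Rightarrow> real) \<Rightarrow> (int \<Rightarrow> 'b) \<Rightarrow> real" where
  "avg j f x = (\<integral>y. f (x(j := y)) \<partial>\<mu>)"

text \<open>Boundedness makes every function integrable, jointly and along each coordinate section,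
  so Fubini applies without side conditions.\<close>

definition bm :: "((int \<Rightarrow> 'b) \<Rightarrow> real) \<Rightarrow> bool" where
  "bm f \<longleftrightarrow> f \<in> borel_measurable P \<and> (\<exists>C. \<forall>x\<in>space P. \<bar>f x\<bar> \<le> C)"

text \<open>A pointwise substitute for measurability with respect to the innovations in J;
  \<open>free\<close> plays the same part for a single innovation that does not enter.\<close>

definition dep :: "int set \<Rightarrow> ((int \<Rightarrow> 'b) \<Rightarrow> real) \<Rightarrow> bool" where
  "dep J f \<longleftrightarrow> (\<forall>x\<in>space P. \<forall>x'\<in>space P. (\<forall>i\<in>J. x i = x' i) \<longrightarrow> f x = f x')"

definition free :: "int \<Rightarrow> ((int \<Rightarrow> 'b) \<Rightarrow> real) \<Rightarrow> bool" where
  "free j f \<longleftrightarrow> (\<forall>x\<in>space P. \<forall>y\<in>space \<mu>. f (x(j := y)) = f x)"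

abbreviation cnrm :: "((int \<Rightarrow> 'b) \<Rightarrow> real) \<Rightarrow> real" where
  "cnrm f \<equiv> nrm 2 P (\<lambda>x. f x - (\<integral>x. f x \<partial>P))"

lemma upd_in_space: "x \<in> space P \<Longrightarrow> y \<in> space \<mu> \<Longrightarrow> x(j := y) \<in> space P"
  by (auto simp: space_PiM PiE_iff)

lemma measurable_upd [measurable]:
  "(\<lambda>(y, x). x(j := y)) \<in> \<mu> \<Otimes>\<^sub>M P \<rightarrow>\<^sub>M P"
  using measurable_add_dim[of j UNIV "\<lambda>_. \<mu>"] measurable_compose[OF measurable_pair_swap', of "\<lambda>(f, y). f(j := y)"]
  by (simp add: split_beta)

lemma measurable_upd' [measurable (raw)]:
  assumes "f \<in> M \<rightarrow>\<^sub>M \<mu>" "g \<in> M \<rightarrow>\<^sub>M P"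
  shows "(\<lambda>w. (g w)(j := f w)) \<in> M \<rightarrow>\<^sub>M P"
  using measurable_compose[OF measurable_Pair[OF assms] measurable_upd] by simp

lemma bmD:
  assumes "bm f"
  shows "f \<in> borel_measurable P"
  using assms by (auto simp: bm_def)

lemma bm_bound:
  assumes "bm f"
  obtains C where "0 \<le> C" "\<And>x. x \<in> space P \<Longrightarrow> \<bar>f x\<bar> \<le> C"
proof -
  obtain C where C: "\<And>x. x \<in> space P \<Longrightarrow> \<bar>f x\<bar> \<le> C" using assms by (auto simp: bm_def)
  show ?thesis by (rule that[of "\<bar>C\<bar>"]) (use C in force)+
qed

lemma bm_Lq: "bm f \<Longrightarrow> f \<in> Lq q P"
  using PP.P.Lq_bounded by (auto simp: bm_def)

lemma bm_integrable: "bm f \<Longrightarrow> integrable P f"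
  using bm_Lq[of f 1] by (simp add: Lq_def)

lemma bm_const: "bm (\<lambda>x. c)"
  by (auto simp: bm_def)

lemma bm_add:
  assumes "bm f" "bm g" shows "bm (\<lambda>x. f x + g x)"
proof -
  obtain C D where "\<forall>x\<in>space P. \<bar>f x\<bar> \<le> C" "\<forall>x\<in>space P. \<bar>g x\<bar> \<le> D" using assms by (auto simp: bm_def)
  then have "\<forall>x\<in>space P. \<bar>f x + g x\<bar> \<le> C + D" by force
  then show ?thesis using assms by (auto simp: bm_def)
qed

lemma bm_mult:
  assumes "bm f" "bm g" shows "bm (\<lambda>x. f x * g x)"
proof -
  obtain C D where C: "0 \<le> C" "\<And>x. x\<in>space P \<Longrightarrow> \<bar>f x\<bar> \<le> C" and D: "\<And>x. x\<in>space P \<Longrightarrow> \<bar>g x\<bar> \<le> D"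
    using bm_bound[OF assms(1)] bm_bound[OF assms(2)] by metis
  then have "\<forall>x\<in>space P. \<bar>f x * g x\<bar> \<le> C * D" by (auto simp: abs_mult intro!: mult_mono)
  then show ?thesis using assms by (auto simp: bm_def)
qed

lemma bm_diff: "bm f \<Longrightarrow> bm g \<Longrightarrow> bm (\<lambda>x. f x - g x)"
  using bm_add[of f "\<lambda>x. (-1) * g x"] bm_mult[OF bm_const[of "-1"], of g] by simp

lemma bm_power: "bm f \<Longrightarrow> bm (\<lambda>x. f x ^ n)"
  by (induction n) (auto intro: bm_const bm_mult)

lemma bm_sum: "(\<And>i. i \<in> I \<Longrightarrow> bm (f i)) \<Longrightarrow> bm (\<lambda>x. \<Sum>i\<in>I. f i x)"
  by (induction I rule: infinite_finite_induct) (auto intro: bm_const bm_add)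

lemma bm_section:
  assumes "bm f" "x \<in> space P"
  shows "integrable \<mu> (\<lambda>y. f (x(j := y)))"
proof -
  have [measurable]: "f \<in> borel_measurable P" using assms bmD by auto
  have [measurable]: "(\<lambda>y. x) \<in> \<mu> \<rightarrow>\<^sub>M P" using assms by simp
  obtain C where "\<And>x. x \<in> space P \<Longrightarrow> \<bar>f x\<bar> \<le> C" using bm_bound[OF assms(1)] by blast
  then show ?thesis using assms
    by (intro integrable_const_bound[of _ C]) (auto simp: upd_in_space)
qed

lemma bm_avg:
  assumes "bm f" shows "bm (avg j f)"
proof -
  have [measurable]: "f \<in> borel_measurable P" using assms bmD by auto
  obtain C where C: "\<And>x. x \<in> space P \<Longrightarrow> \<bar>f x\<bar> \<le> C" using bm_bound[OF assms(1)] by blast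
  have "\<bar>avg j f x\<bar> \<le> C" if "x \<in> space P" for x
  proof -
    have "\<bar>avg j f x\<bar> \<le> (\<integral>y. \<bar>f (x(j := y))\<bar> \<partial>\<mu>)" unfolding avg_def by (rule integral_abs_bound)
    also have "\<dots> \<le> (\<integral>y. C \<partial>\<mu>)"
      using bm_section[OF assms that] C that by (intro integral_mono) (auto simp: upd_in_space)
    finally show ?thesis by (simp add: prob_space)
  qed
  moreover have "avg j f \<in> borel_measurable P"
    unfolding avg_def by measurable
  ultimately show ?thesis by (auto simp: bm_def)
qed

lemma bm_indicator: "B \<in> sets P \<Longrightarrow> bm (indicator B)"
  by (auto simp: bm_def indicator_def)

lemmas bm_intros = bm_const bm_add bm_mult bm_diff bm_power bm_sum bm_avg

lemma avg_diff: "bm f \<Longrightarrow> bm g \<Longrightarrow> x \<in> space P \<Longrightarrow> avg j (\<lambda>x. f x - g x) x = avg j f x - avg j g x"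
  unfolding avg_def by (intro Bochner_Integration.integral_diff bm_section)

lemma avg_sum:
  "(\<And>i. i \<in> I \<Longrightarrow> bm (f i)) \<Longrightarrow> x \<in> space P \<Longrightarrow> avg j (\<lambda>x. \<Sum>i\<in>I. f i x) x = (\<Sum>i\<in>I. avg j (f i) x)"
  unfolding avg_def by (intro Bochner_Integration.integral_sum bm_section)

lemma avg_free_mult:
  assumes "free j g" "x \<in> space P"
  shows "avg j (\<lambda>x. g x * f x) x = g x * avg j f x"
proof -
  have "avg j (\<lambda>x. g x * f x) x = (\<integral>y. g x * f (x(j := y)) \<partial>\<mu>)"
    unfolding avg_def using assms by (intro Bochner_Integration.integral_cong) (auto simp: free_def)
  then show ?thesis by (simp add: avg_def)
qed

lemma avg_free: "free j f \<Longrightarrow> x \<in> space P \<Longrightarrow> avg j f x = f x"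
  using avg_free_mult[of j f x "\<lambda>_. 1"] by (simp add: avg_def prob_space)

lemma avg_const: "avg j (\<lambda>x. c) x = c"
  by (simp add: avg_def prob_space)

lemma avg_cong: "(\<And>x. x \<in> space P \<Longrightarrow> f x = g x) \<Longrightarrow> x \<in> space P \<Longrightarrow> avg j f x = avg j g x"
  unfolding avg_def by (intro Bochner_Integration.integral_cong) (auto simp: upd_in_space)

lemma free_avg: "free j (avg j f)"
  by (simp add: free_def avg_def)

lemma distr_upd: "distr (\<mu> \<Otimes>\<^sub>M P) P (\<lambda>(y, x). x(j := y)) = P"
  using distr_pair_PiM_eq_PiM[of UNIV "\<lambda>_. \<mu>" j] prob_space_axioms by simp

lemma integral_avg:
  assumes "bm f" shows "(\<integral>x. avg j f x \<partial>P) = (\<integral>x. f x \<partial>P)"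
proof -
  have [measurable]: "f \<in> borel_measurable P" using assms bmD by auto
  interpret pair_prob_space \<mu> P by unfold_locales
  obtain C where C: "\<And>x. x \<in> space P \<Longrightarrow> \<bar>f x\<bar> \<le> C" using bm_bound[OF assms(1)] by blast
  have "integrable (\<mu> \<Otimes>\<^sub>M P) (\<lambda>(y, x). f (x(j := y)))"
    using C by (intro integrable_const_bound[of _ C]) (auto simp: space_pair_measure upd_in_space)
  then have "(\<integral>x. avg j f x \<partial>P) = (\<integral>(y, x). f (x(j := y)) \<partial>(\<mu> \<Otimes>\<^sub>M P))"
    unfolding avg_def by (rule integral_snd)
  also have "\<dots> = (\<integral>x. f x \<partial>distr (\<mu> \<Otimes>\<^sub>M P) P (\<lambda>(y, x). x(j := y)))"
    by (subst integral_distr) (auto simp: case_prod_beta')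
  finally show ?thesis by (simp add: distr_upd)
qed

lemma integral_free_avg:
  assumes "bm f" "bm g" "free j g"
  shows "(\<integral>x. g x * avg j f x \<partial>P) = (\<integral>x. g x * f x \<partial>P)"
proof -
  have "(\<integral>x. g x * avg j f x \<partial>P) = (\<integral>x. avg j (\<lambda>x. g x * f x) x \<partial>P)"
    using assms by (intro Bochner_Integration.integral_cong) (auto simp: avg_free_mult)
  then show ?thesis using assms by (simp add: integral_avg bm_intros)
qed

lemma free_power: "free j f \<Longrightarrow> free j (\<lambda>x. f x ^ n)"
  by (simp add: free_def)

lemma dep_free: "dep J f \<Longrightarrow> j \<notin> J \<Longrightarrow> free j f"
  unfolding dep_def free_def by (metis fun_upd_other upd_in_space)

lemma depD: "dep J f \<Longrightarrow> x \<in> space P \<Longrightarrow> x' \<in> space P \<Longrightarrow> (\<And>i. i \<in> J \<Longrightarrow> x i = x' i) \<Longrightarrow> f x = f x'"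
  unfolding dep_def by blast

lemma dep_mono: "dep J f \<Longrightarrow> J \<subseteq> K \<Longrightarrow> dep K f"
  unfolding dep_def by blast

lemma dep_avg:
  assumes "dep (insert j J) f" shows "dep J (avg j f)"
  unfolding dep_def avg_def
proof (intro ballI impI Bochner_Integration.integral_cong refl)
  fix x x' y assume *: "x \<in> space P" "x' \<in> space P" "\<forall>i\<in>J. x i = x' i" "y \<in> space \<mu>"
  have "x(j := y) \<in> space P" "x'(j := y) \<in> space P" using * by (auto intro: upd_in_space)
  moreover have "\<forall>i\<in>insert j J. (x(j := y)) i = (x'(j := y)) i" using * by simp
  ultimately show "f (x(j := y)) = f (x'(j := y))"
    using assms unfolding dep_def by blast
qed

lemma dep_sum: "(\<And>i. i \<in> I \<Longrightarrow> dep J (f i)) \<Longrightarrow> dep J (\<lambda>x. \<Sum>i\<in>I. f i x)"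
  unfolding dep_def by (intro ballI impI sum.cong refl) (metis (full_types))

lemma dep_mult: "dep J f \<Longrightarrow> dep J g \<Longrightarrow> dep J (\<lambda>x. f x * g x)"
  and dep_diff: "dep J f \<Longrightarrow> dep J g \<Longrightarrow> dep J (\<lambda>x. f x - g x)"

  and dep_power: "dep J f \<Longrightarrow> dep J (\<lambda>x. f x ^ n)"
  and dep_const: "dep J (\<lambda>x. c)"
  unfolding dep_def by metis+

lemma dep_empty:
  assumes "dep {} f" "x \<in> space P" shows "f x = (\<integral>x. f x \<partial>P)"
proof -
  have "(\<integral>x'. f x' \<partial>P) = (\<integral>x'. f x \<partial>P)"
  proof (intro Bochner_Integration.integral_cong refl)
    fix y assume "y \<in> space P"
    then show "f y = f x" using assms unfolding dep_def by blast
  qed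
  then show ?thesis by (simp add: PP.P.prob_space)
qed

text \<open>The coordinates in I are averaged out one after the other. Each step leaves the integral
  against g unchanged, because g does not see the coordinate, and removes one coordinate from f,
  until f is constant and equal to its mean.\<close>

lemma independent:
  assumes "finite I" "bm f" "bm g" "dep I f" "\<And>i. i \<in> I \<Longrightarrow> free i g"
  shows "(\<integral>x. f x * g x \<partial>P) = (\<integral>x. f x \<partial>P) * (\<integral>x. g x \<partial>P)"
  using assms
proof (induction I arbitrary: f rule: finite_induct)
  case empty
  have "(\<integral>x. f x * g x \<partial>P) = (\<integral>x. (\<integral>x. f x \<partial>P) * g x \<partial>P)"
    using empty by (intro Bochner_Integration.integral_cong) (auto simp flip: dep_empty)
  then show ?case by simp
next
  case (insert i I)
  have "(\<integral>x. f x * g x \<partial>P) = (\<integral>x. avg i f x * g x \<partial>P)"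
    using integral_free_avg[of f g i] insert.prems by (simp add: mult.commute)
  also have "\<dots> = (\<integral>x. f x \<partial>P) * (\<integral>x. g x \<partial>P)"
    using insert.prems insert.IH[of "avg i f"] by (simp add: bm_avg dep_avg integral_avg)
  finally show ?case .
qed

lemma avg_commute:
  assumes "bm f" "x \<in> space P"
  shows "avg i (avg j f) x = avg j (avg i f) x"
proof (cases "i = j")
  case False
  have [measurable]: "f \<in> borel_measurable P" using assms bmD by auto
  have [measurable]: "(\<lambda>y. x) \<in> \<mu> \<Otimes>\<^sub>M \<mu> \<rightarrow>\<^sub>M P" using assms by simp
  interpret pair_prob_space \<mu> \<mu> by unfold_locales
  obtain C where C: "\<And>x. x \<in> space P \<Longrightarrow> \<bar>f x\<bar> \<le> C" using bm_bound[OF assms(1)] by blast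
  have "integrable (\<mu> \<Otimes>\<^sub>M \<mu>) (\<lambda>(z, y). f (x(i := y, j := z)))"
    using C assms by (intro integrable_const_bound[of _ C]) (auto simp: space_pair_measure upd_in_space)
  from Fubini_integral[OF this] show ?thesis
    using False by (simp add: avg_def fun_upd_twist)
qed simp

lemma nrm_avg_le:
  assumes "bm f" "even q" "0 < q" shows "nrm q P (avg j f) \<le> nrm q P f"
proof -
  have "(\<integral>x. avg j f x ^ q \<partial>P) \<le> (\<integral>x. avg j (\<lambda>x. f x ^ q) x \<partial>P)"
  proof (intro integral_mono)
    fix x assume "x \<in> space P"
    then show "avg j f x ^ q \<le> avg j (\<lambda>x. f x ^ q) x"
      using assms bm_section[of "\<lambda>x. f x ^ q"] bm_section[of f]
      unfolding avg_def by (intro power_expectation_le) (auto intro: bm_power)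
  qed (auto intro!: bm_integrable bm_intros assms)
  also have "\<dots> = nrm q P f ^ q"
    using assms by (simp add: integral_avg bm_intros nrm_power)
  finally show ?thesis using assms by (simp add: nrm_le_iff nrm_nonneg)
qed

text \<open>The influence of innovation j, measured against the conditional expectation rather than
  against a resampled copy, so that everything stays on one probability space;
  \<open>infl_le_Dn\<close> compares the two.\<close>

definition infl :: "nat \<Rightarrow> int \<Rightarrow> ((int \<Rightarrow> 'b) \<Rightarrow> real) \<Rightarrow> real" where
  "infl q j f = nrm q P (\<lambda>x. f x - avg j f x)"

lemma infl_nonneg: "even q \<Longrightarrow> 0 \<le> infl q j f"
  by (simp add: infl_def nrm_nonneg)

lemma infl_free: "free j f \<Longrightarrow> 0 < q \<Longrightarrow> infl q j f = 0"
  unfolding infl_def by (subst nrm_cong[of _ _ "\<lambda>x. 0"]) (auto simp: avg_free nrm_zero)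

text \<open>Averages commute, so the increment of \<open>avg j f\<close> is the average of the
  increment of f, and averaging contracts norms.\<close>

lemma infl_avg_le:
  assumes "bm f" "even q" "0 < q"
  shows "infl q i (avg j f) \<le> infl q i f"
proof -
  have "infl q i (avg j f) = nrm q P (avg j (\<lambda>x. f x - avg i f x))"
    unfolding infl_def using assms by (intro nrm_cong) (auto simp: avg_diff avg_commute bm_intros)
  also have "\<dots> \<le> infl q i f"
    unfolding infl_def using assms by (intro nrm_avg_le bm_intros) auto
  finally show ?thesis .
qed

lemma infl_sum_le:
  assumes "\<And>i. i \<in> I \<Longrightarrow> bm (f i)" "even q" "0 < q"
  shows "infl q j (\<lambda>x. \<Sum>i\<in>I. f i x) \<le> (\<Sum>i\<in>I. infl q j (f i))"
proof -
  have "infl q j (\<lambda>x. \<Sum>i\<in>I. f i x) = nrm q P (\<lambda>x. \<Sum>i\<in>I. f i x - avg j (f i) x)"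
    unfolding infl_def using assms by (intro nrm_cong) (auto simp: avg_sum sum_subtractf)
  also have "\<dots> \<le> (\<Sum>i\<in>I. infl q j (f i))"
    unfolding infl_def using assms by (intro Lq_sum bm_Lq bm_intros) auto
  finally show ?thesis .
qed

text \<open>A discrete product rule: uv minus its average is \<open>du * v + avg j u * dv\<close>
  minus the average of \<open>du * dv\<close>. In the last term the norm of \<open>dv\<close> is at
  most twice that of \<open>v\<close>, whence the coefficient 1 + 2 = 3.\<close>

lemma infl_mult_le:
  assumes u: "bm u" and v: "bm v"
  shows "infl 2 j (\<lambda>x. u x * v x) \<le> 3 * infl 4 j u * nrm 4 P v + nrm 4 P u * infl 4 j v"
proof -
  define du dv where d: "du = (\<lambda>x. u x - avg j u x)" "dv = (\<lambda>x. v x - avg j v x)"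
  have bm: "bm du" "bm dv" "bm (avg j u)" using u v by (auto simp: d intro: bm_intros)
  have "u x * v x - avg j (\<lambda>x. u x * v x) x = (du x * v x + avg j u x * dv x) - avg j (\<lambda>x. du x * dv x) x"
    if x: "x \<in> space P" for x
  proof -
    have "avg j (\<lambda>x. du x * dv x) x = avg j (\<lambda>x. (u x * v x - avg j u x * v x) - (avg j v x * u x - avg j u x * avg j v x)) x"
      using x by (intro avg_cong) (auto simp: d algebra_simps)
    also have "\<dots> = avg j (\<lambda>x. u x * v x) x - avg j u x * avg j v x"
      using x u v by (simp add: avg_diff bm_intros avg_free_mult free_avg avg_free)
    finally show ?thesis by (simp add: d algebra_simps)
  qed
  then have "infl 2 j (\<lambda>x. u x * v x) = nrm 2 P (\<lambda>x. (du x * v x + avg j u x * dv x) - avg j (\<lambda>x. du x * dv x) x)"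
    unfolding infl_def by (rule nrm_cong)
  also have "\<dots> \<le> nrm 2 P (\<lambda>x. du x * v x + avg j u x * dv x) + nrm 2 P (avg j (\<lambda>x. du x * dv x))"
    using bm u v by (intro Lq_diff bm_Lq bm_intros) auto
  also have "\<dots> \<le> (nrm 2 P (\<lambda>x. du x * v x) + nrm 2 P (\<lambda>x. avg j u x * dv x)) + nrm 2 P (\<lambda>x. du x * dv x)"
    using bm u v by (intro add_mono Lq_add nrm_avg_le bm_Lq bm_intros) auto
  also have "\<dots> \<le> (nrm 4 P du * nrm 4 P v + nrm 4 P (avg j u) * nrm 4 P dv) + nrm 4 P du * nrm 4 P dv"
    using bm u v by (intro add_mono Lq_mult bm_Lq bm_intros) auto
  also have "\<dots> \<le> (nrm 4 P du * nrm 4 P v + nrm 4 P u * nrm 4 P dv) + nrm 4 P du * (nrm 4 P v + nrm 4 P v)"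
  proof -
    have "nrm 4 P dv \<le> nrm 4 P v + nrm 4 P (avg j v)"
      unfolding d using v by (intro Lq_diff bm_Lq bm_intros) auto
    also have "\<dots> \<le> nrm 4 P v + nrm 4 P v" using v by (intro add_left_mono nrm_avg_le) auto
    finally show ?thesis using u by (intro add_mono mult_left_mono mult_right_mono nrm_avg_le) (auto simp: nrm_nonneg)
  qed
  finally show ?thesis by (simp add: infl_def d algebra_simps)
qed

subsection \<open>Efron--Stein inequalities\<close>

text \<open>Pythagoras: \<open>f - avg j f\<close> is orthogonal to every function free of
  coordinate j, in particular to \<open>avg j f\<close>.\<close>

lemma nrm_avg_step2:
  assumes "bm f"
  shows "(nrm 2 P f)\<^sup>2 = (nrm 2 P (avg j f))\<^sup>2 + (infl 2 j f)\<^sup>2"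
proof -
  define a d where ad: "a = avg j f" "d = (\<lambda>x. f x - avg j f x)"
  have bm: "bm a" "bm d" using assms by (auto simp: ad intro: bm_intros)
  have z: "(\<integral>x. a x * d x \<partial>P) = 0"
  proof -
    have "(\<integral>x. a x * d x \<partial>P) = (\<integral>x. a x * f x \<partial>P) - (\<integral>x. a x * avg j f x \<partial>P)"
      unfolding ad using assms
      by (subst Bochner_Integration.integral_diff[symmetric]) (auto intro!: bm_integrable bm_intros simp: algebra_simps)
    then show ?thesis using integral_free_avg[of f a j] assms by (simp add: ad free_avg bm_intros)
  qed
  have "(\<integral>x. (f x)\<^sup>2 \<partial>P) = (\<integral>x. (a x)\<^sup>2 + 2 * (a x * d x) + (d x)\<^sup>2 \<partial>P)"
    by (intro Bochner_Integration.integral_cong) (auto simp: ad power2_eq_square algebra_simps)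
  also have "\<dots> = (\<integral>x. (a x)\<^sup>2 \<partial>P) + 2 * (\<integral>x. a x * d x \<partial>P) + (\<integral>x. (d x)\<^sup>2 \<partial>P)"
    using bm by (simp add: bm_integrable bm_intros)
  also have "\<dots> = (nrm 2 P a)\<^sup>2 + (nrm 2 P d)\<^sup>2" by (simp add: nrm_power z)
  finally show ?thesis by (simp add: infl_def nrm_power ad)
qed

text \<open>A fourth-order substitute for Pythagoras. In the expansion of (a + d)^4 the term linear
  in d has mean zero, since a^3 is free of coordinate j; the others are controlled so that squared
  L4 norms add up as variances do, up to the factor 4.\<close>

lemma nrm_avg_step4:
  assumes "bm f"
  shows "(nrm 4 P f)\<^sup>2 \<le> (nrm 4 P (avg j f))\<^sup>2 + 4 * (infl 4 j f)\<^sup>2"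
proof -
  define a d where ad: "a = avg j f" "d = (\<lambda>x. f x - avg j f x)"
  have bm: "bm a" "bm d" using assms by (auto simp: ad intro: bm_intros)
  have z: "(\<integral>x. a x ^ 3 * d x \<partial>P) = 0"
  proof -
    have "(\<integral>x. a x ^ 3 * d x \<partial>P) = (\<integral>x. a x ^ 3 * f x \<partial>P) - (\<integral>x. a x ^ 3 * avg j f x \<partial>P)"
      unfolding ad using assms
      by (subst Bochner_Integration.integral_diff[symmetric]) (auto intro!: bm_integrable bm_intros simp: algebra_simps)
    then show ?thesis using integral_free_avg[of f "\<lambda>x. a x ^ 3" j] assms
      by (simp add: ad free_avg free_power bm_intros)
  qed
  have ad2: "(\<integral>x. (a x * d x)\<^sup>2 \<partial>P) \<le> (nrm 4 P a)\<^sup>2 * (nrm 4 P d)\<^sup>2"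
  proof -
    have "nrm 2 P (\<lambda>x. a x * d x) \<le> nrm 4 P a * nrm 4 P d" using bm by (intro Lq_mult bm_Lq)
    from power_mono[OF this, of 2] show ?thesis by (simp add: nrm_nonneg nrm_power power_mult_distrib)
  qed
  \<comment> \<open>The odd term is removed by 4 a d^3 \<le> 2 a^2 d^2 + 2 d^4, so that 6 + 2 = 8
    and 1 + 2 = 3 are the resulting coefficients.\<close>
  have "f x ^ 4 \<le> a x ^ 4 + 4 * (a x ^ 3 * d x) + 8 * (a x * d x)\<^sup>2 + 3 * d x ^ 4" for x
  proof -
    have "0 \<le> 2 * (d x)\<^sup>2 * (a x - d x)\<^sup>2" by simp
    also have "\<dots> = a x ^ 4 + 4 * (a x ^ 3 * d x) + 8 * (a x * d x)\<^sup>2 + 3 * d x ^ 4 - (a x + d x) ^ 4"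
      by (simp add: power2_eq_square power4_eq_xxxx power3_eq_cube algebra_simps)
    also have "a x + d x = f x" by (simp add: ad)
    finally show ?thesis by simp
  qed
  then have "(\<integral>x. f x ^ 4 \<partial>P) \<le> (\<integral>x. a x ^ 4 + 4 * (a x ^ 3 * d x) + 8 * (a x * d x)\<^sup>2 + 3 * d x ^ 4 \<partial>P)"
    using bm assms by (intro integral_mono bm_integrable bm_intros)
  also have "\<dots> = (\<integral>x. a x ^ 4 \<partial>P) + 4 * (\<integral>x. a x ^ 3 * d x \<partial>P) + 8 * (\<integral>x. (a x * d x)\<^sup>2 \<partial>P) + 3 * (\<integral>x. d x ^ 4 \<partial>P)"
    using bm by (simp add: bm_integrable bm_intros)
  also have "\<dots> \<le> nrm 4 P a ^ 4 + 8 * ((nrm 4 P a)\<^sup>2 * (nrm 4 P d)\<^sup>2) + 3 * nrm 4 P d ^ 4"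
    using ad2 z by (simp add: nrm_power)
  also have "\<dots> \<le> ((nrm 4 P a)\<^sup>2 + 4 * (nrm 4 P d)\<^sup>2)\<^sup>2"
  proof -
    have *: "(A\<^sup>2 + 4 * D\<^sup>2)\<^sup>2 = A ^ 4 + 8 * (A\<^sup>2 * D\<^sup>2) + 3 * D ^ 4 + 13 * D ^ 4" for A D :: real
      by algebra
    have "0 \<le> 13 * nrm 4 P d ^ 4" by simp
    then show ?thesis unfolding * by linarith
  qed
  finally have "((nrm 4 P f)\<^sup>2)\<^sup>2 \<le> ((nrm 4 P a)\<^sup>2 + 4 * (nrm 4 P d)\<^sup>2)\<^sup>2"
    by (simp add: nrm_power)
  then show ?thesis
    unfolding infl_def ad by (rule power2_le_imp_le) simp
qed

text \<open>The coordinates in J are averaged out one at a time, each at the cost of the one-step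
  inequality; by \<open>infl_avg_le\<close> earlier averages do not increase later influences. At
  the end f is constant, hence 0 by centering. The factor 4 covers both orders.\<close>

lemma efron_stein_aux:
  assumes q: "q = 2 \<or> q = 4" and "finite J" "bm f" "dep J f" "(\<integral>x. f x \<partial>P) = 0"
  shows "(nrm q P f)\<^sup>2 \<le> 4 * (\<Sum>j\<in>J. (infl q j f)\<^sup>2)"
  using assms(2-)
proof (induction J arbitrary: f rule: finite_induct)
  case empty
  then have "nrm q P f = nrm q P (\<lambda>x. 0)" by (intro nrm_cong) (simp add: dep_empty)
  then show ?case using q by (auto simp: nrm_zero)
next
  case (insert j J)
  have "(nrm q P f)\<^sup>2 \<le> (nrm q P (avg j f))\<^sup>2 + 4 * (infl q j f)\<^sup>2"
    using q nrm_avg_step2[OF \<open>bm f\<close>, of j] nrm_avg_step4[OF \<open>bm f\<close>, of j] by auto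
  also have "(nrm q P (avg j f))\<^sup>2 \<le> 4 * (\<Sum>i\<in>J. (infl q i (avg j f))\<^sup>2)"
    using insert.prems by (intro insert.IH) (auto simp: integral_avg intro: bm_intros dep_avg)
  also have "\<dots> \<le> 4 * (\<Sum>i\<in>J. (infl q i f)\<^sup>2)"
    using q insert.prems by (intro mult_left_mono sum_mono power_mono infl_avg_le) (auto simp: infl_nonneg)
  finally show ?case using insert.hyps by simp
qed

lemma integral_centered: "bm f \<Longrightarrow> (\<integral>x. f x - (\<integral>x. f x \<partial>P) \<partial>P) = 0"
  by (simp add: bm_integrable PP.P.prob_space)

lemma efron_stein:
  assumes q: "q = 2 \<or> q = 4" and J: "finite J" and f: "bm f" "dep J f"
  shows "(nrm q P (\<lambda>x. f x - (\<integral>x. f x \<partial>P)))\<^sup>2 \<le> 4 * (\<Sum>j\<in>J. (infl q j f)\<^sup>2)"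
proof -
  define E where "E = (\<integral>x. f x \<partial>P)"
  have "(nrm q P (\<lambda>x. f x - E))\<^sup>2 \<le> 4 * (\<Sum>j\<in>J. (infl q j (\<lambda>x. f x - E))\<^sup>2)"
    using integral_centered[OF f(1)] unfolding E_def[symmetric]
    by (rule efron_stein_aux[OF q J bm_diff[OF f(1) bm_const] dep_diff[OF f(2) dep_const]])
  moreover have "infl q j (\<lambda>x. f x - E) = infl q j f" for j
    unfolding infl_def by (rule nrm_cong) (simp add: avg_diff[OF f(1) bm_const] avg_const)
  ultimately show ?thesis by (simp add: E_def)
qed

end

subsection \<open>Centered finite-range kernels\<close>

context iid_seq
begin

definition Xp :: "((nat \<Rightarrow> 'b) \<Rightarrow> real) \<Rightarrow> int \<Rightarrow> (int \<Rightarrow> 'b) \<Rightarrow> real" where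
  "Xp h t x = h (\<lambda>k. x (t - int k))"

text \<open>Range m means that X_t involves the innovations t-m+1, ..., t only, so sums over index
  sets at distance m are independent.\<close>

definition kern :: "nat \<Rightarrow> ((nat \<Rightarrow> 'b) \<Rightarrow> real) \<Rightarrow> bool" where
  "kern m h \<longleftrightarrow> h \<in> borel_measurable S \<and> (\<exists>C. \<forall>x\<in>space S. \<bar>h x\<bar> \<le> C) \<and>
     (\<forall>x\<in>space S. \<forall>x'\<in>space S. (\<forall>k<m. x k = x' k) \<longrightarrow> h x = h x') \<and> (\<integral>x. h x \<partial>S) = 0"

text \<open>A majorant for the influence of innovation j on X_t as a function of the lag t - j. The
  bound \<Delta> on all finite sums takes the place of summability over the integers; it is the
  number in which the uniform estimates are expressed.\<close>

definition profile :: "((nat \<Rightarrow> 'b) \<Rightarrow> real) \<Rightarrow> (int \<Rightarrow> real) \<Rightarrow> real \<Rightarrow> bool" where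
  "profile h d \<Delta> \<longleftrightarrow> (\<forall>i. 0 \<le> d i) \<and> (\<forall>t j. infl 4 j (Xp h t) \<le> d (t - j)) \<and>
     (\<forall>F. finite F \<longrightarrow> sum d F \<le> \<Delta>)"

definition Wsum :: "((nat \<Rightarrow> 'b) \<Rightarrow> real) \<Rightarrow> int set \<Rightarrow> (int \<Rightarrow> 'b) \<Rightarrow> real" where
  "Wsum h A x = (\<Sum>t\<in>A. Xp h t x)"

lemma measurable_shift: "(\<lambda>x i. x (i + s)) \<in> P \<rightarrow>\<^sub>M P"
  by (rule measurable_PiM_single') (auto simp: space_PiM PiE_iff)

lemma distr_shift: "distr P P (\<lambda>x i. x (i + s)) = P"
  using distr_PiM_reindex[of UNIV "\<lambda>_. \<mu>" "\<lambda>i::int. i + s" UNIV] prob_space_axioms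
  by (simp add: inj_on_def restrict_def)

lemma measurable_past: "(\<lambda>x k. x (t - int k)) \<in> P \<rightarrow>\<^sub>M S"
  by (rule measurable_PiM_single') (auto simp: space_PiM PiE_iff)

lemma past_in_space: "x \<in> space P \<Longrightarrow> (\<lambda>k. x (t - int k)) \<in> space S"
  by (simp add: space_PiM PiE_iff)

lemma distr_past: "distr P S (\<lambda>x k. x (t - int k)) = S"
  using distr_PiM_reindex[of UNIV "\<lambda>_. \<mu>" "\<lambda>k. t - int k" UNIV] prob_space_axioms
  by (simp add: inj_on_def restrict_def)

lemma integral_shift:
  fixes f :: "_ \<Rightarrow> real"
  shows "f \<in> borel_measurable P \<Longrightarrow> (\<integral>x. f (\<lambda>i. x (i + s)) \<partial>P) = (\<integral>x. f x \<partial>P)"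
  using integral_distr[OF measurable_shift[of s], of f] by (simp add: distr_shift)

lemma integral_Xp:
  "h \<in> borel_measurable S \<Longrightarrow> (\<integral>x. Xp h t x \<partial>P) = (\<integral>x. h x \<partial>S)"
  using integral_distr[OF measurable_past[of t], of h] by (simp add: distr_past Xp_def[abs_def])

lemma nrm_Xp: "h \<in> borel_measurable S \<Longrightarrow> nrm q P (Xp h t) = nrm q S h"
  using nrm_distr[OF measurable_past[of t], of h q] by (simp add: distr_past Xp_def[abs_def])

lemma measurable_Xp: "h \<in> borel_measurable S \<Longrightarrow> Xp h t \<in> borel_measurable P"
  using measurable_compose[OF measurable_past[of t], of h borel] by (simp add: Xp_def[abs_def])

lemma Lq_Xp: "h \<in> Lq q S \<Longrightarrow> Xp h t \<in> Lq q P"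
  using Lq_distr[OF measurable_past[of t], of h q] LqD(1)[of h q S] by (simp add: distr_past Xp_def[abs_def])

lemma Xp_shift: "Xp h t (\<lambda>i. x (i + s)) = Xp h (t + s) x"
  by (simp add: Xp_def algebra_simps)

lemma Wsum_shift: "Wsum h A (\<lambda>i. x (i + s)) = Wsum h ((\<lambda>t. t + s) ` A) x"
  by (simp add: Wsum_def Xp_shift sum.reindex)

lemma Xp_add: "Xp (\<lambda>x. u x + v x) t x = Xp u t x + Xp v t x"
  and Xp_diff: "Xp (\<lambda>x. u x - v x) t x = Xp u t x - Xp v t x"
  by (simp_all add: Xp_def)

lemma Wsum_add: "Wsum (\<lambda>x. u x + v x) A x = Wsum u A x + Wsum v A x"
  and Wsum_diff: "Wsum (\<lambda>x. u x - v x) A x = Wsum u A x - Wsum v A x"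
  by (simp_all add: Wsum_def Xp_add Xp_diff sum.distrib sum_subtractf)

lemma Wsum_union: "finite A \<Longrightarrow> finite B \<Longrightarrow> A \<inter> B = {} \<Longrightarrow> Wsum h (A \<union> B) x = Wsum h A x + Wsum h B x"
  unfolding Wsum_def by (rule sum.union_disjoint)

lemma kern_measurable: "kern m h \<Longrightarrow> h \<in> borel_measurable S"
  and kern_bounded: "kern m h \<Longrightarrow> \<exists>C. \<forall>x\<in>space S. \<bar>h x\<bar> \<le> C"
  and kern_range: "kern m h \<Longrightarrow> x \<in> space S \<Longrightarrow> x' \<in> space S \<Longrightarrow> (\<And>k. k < m \<Longrightarrow> x k = x' k) \<Longrightarrow> h x = h x'"
  and kern_mean: "kern m h \<Longrightarrow> (\<integral>x. h x \<partial>S) = 0"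
  unfolding kern_def by blast+

lemma kern_mono: "kern m h \<Longrightarrow> m \<le> n \<Longrightarrow> kern n h"
  unfolding kern_def by (meson order_less_le_trans)

lemma kern_Lq: "kern m h \<Longrightarrow> h \<in> Lq q S"
  using SS.P.Lq_bounded[of h _ q] kern_measurable[of m h] kern_bounded[of m h] by blast

lemma kern_add_diff:
  assumes u: "kern m u" and v: "kern m v"
  shows "kern m (\<lambda>x. u x + v x)" "kern m (\<lambda>x. u x - v x)"
proof -
  obtain C D where CD: "\<forall>x\<in>space S. \<bar>u x\<bar> \<le> C" "\<forall>x\<in>space S. \<bar>v x\<bar> \<le> D"
    using kern_bounded[OF u] kern_bounded[OF v] by blast
  have "\<forall>x\<in>space S. \<bar>u x + v x\<bar> \<le> C + D" "\<forall>x\<in>space S. \<bar>u x - v x\<bar> \<le> C + D"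
    using CD abs_triangle_ineq abs_triangle_ineq4 by (meson add_mono order_trans)+
  then have bdd: "\<exists>C. \<forall>x\<in>space S. \<bar>u x + v x\<bar> \<le> C" "\<exists>C. \<forall>x\<in>space S. \<bar>u x - v x\<bar> \<le> C" by blast+
  have i: "integrable S u" "integrable S v" using kern_Lq[OF u, of 1] kern_Lq[OF v, of 1] by (auto simp: Lq_def)
  have r: "u x = u x'" "v x = v x'" if "x \<in> space S" "x' \<in> space S" "\<forall>k<m. x k = x' k" for x x'
    using kern_range[OF u] kern_range[OF v] that by blast+
  have m: "u \<in> borel_measurable S" "v \<in> borel_measurable S" using kern_measurable u v by auto
  show "kern m (\<lambda>x. u x + v x)" unfolding kern_def
    using bdd(1) i m kern_mean[OF u] kern_mean[OF v] by (intro conjI ballI impI arg_cong2[where f="(+)"] r) auto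
  show "kern m (\<lambda>x. u x - v x)" unfolding kern_def
    using bdd(2) i m kern_mean[OF u] kern_mean[OF v] by (intro conjI ballI impI arg_cong2[where f="(-)"] r) auto
qed

lemma bm_Xp:
  assumes "kern m h" shows "bm (Xp h t)"
proof -
  obtain C where "\<forall>x\<in>space S. \<bar>h x\<bar> \<le> C" using kern_bounded[OF assms] by blast
  then have "\<forall>x\<in>space P. \<bar>Xp h t x\<bar> \<le> C" by (simp add: Xp_def past_in_space)
  then show ?thesis using measurable_Xp assms kern_measurable by (auto simp: bm_def)
qed

lemma dep_Xp:
  assumes "kern m h" shows "dep {t - int m<..t} (Xp h t)"
  unfolding dep_def
proof (intro ballI impI)
  fix x x' assume *: "x \<in> space P" "x' \<in> space P" "\<forall>i\<in>{t - int m<..t}. x i = x' i"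
  then have "\<forall>k<m. x (t - int k) = x' (t - int k)" by auto
  then show "Xp h t x = Xp h t x'"
    unfolding Xp_def using * by (intro kern_range[OF assms] past_in_space) auto
qed

lemma bm_Wsum: "kern m h \<Longrightarrow> bm (Wsum h A)"
  unfolding Wsum_def by (intro bm_sum bm_Xp)

lemma dep_Wsum: "kern m h \<Longrightarrow> dep (\<Union>t\<in>A. {t - int m<..t}) (Wsum h A)"
  unfolding Wsum_def by (intro dep_sum) (auto intro: dep_mono dep_Xp)

lemma integral_Wsum:
  assumes "kern m h" shows "(\<integral>x. Wsum h A x \<partial>P) = 0"
  unfolding Wsum_def using assms
  by (subst Bochner_Integration.integral_sum) (auto intro: bm_integrable bm_Xp simp: integral_Xp[OF kern_measurable] kern_mean)

lemma profile_nonneg: "profile h d \<Delta> \<Longrightarrow> 0 \<le> d i"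
  and profile_infl: "profile h d \<Delta> \<Longrightarrow> infl 4 j (Xp h t) \<le> d (t - j)"
  and profile_sum: "profile h d \<Delta> \<Longrightarrow> finite F \<Longrightarrow> sum d F \<le> \<Delta>"
  by (auto simp: profile_def)

lemma profile_bound_nonneg: "profile h d \<Delta> \<Longrightarrow> 0 \<le> \<Delta>"
  using profile_sum[of h d \<Delta> "{}"] by simp

lemma infl_Wsum_le:
  assumes "kern m h" "profile h d \<Delta>"
  shows "infl 4 j (Wsum h A) \<le> (\<Sum>t\<in>A. d (t - j))"
proof -
  have "infl 4 j (Wsum h A) \<le> (\<Sum>t\<in>A. infl 4 j (Xp h t))"
    unfolding Wsum_def[abs_def] using bm_Xp[OF assms(1)] by (intro infl_sum_le) auto
  also have "\<dots> \<le> (\<Sum>t\<in>A. d (t - j))" by (intro sum_mono profile_infl[OF assms(2)])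
  finally show ?thesis .
qed

lemma profile_shift_sums:
  assumes "profile h d \<Delta>" "finite A"
  shows "(\<Sum>t\<in>A. d (t - j)) \<le> \<Delta>" "(\<Sum>j\<in>A. d (t - j)) \<le> \<Delta>"
proof -
  have "(\<Sum>t\<in>A. d (t - j)) = sum d ((\<lambda>t. t - j) ` A)" by (subst sum.reindex) (auto simp: inj_on_def)
  then show "(\<Sum>t\<in>A. d (t - j)) \<le> \<Delta>" using profile_sum[OF assms(1)] assms(2) by simp
  have "(\<Sum>j\<in>A. d (t - j)) = sum d ((\<lambda>j. t - j) ` A)" by (subst sum.reindex) (auto simp: inj_on_def)
  then show "(\<Sum>j\<in>A. d (t - j)) \<le> \<Delta>" using profile_sum[OF assms(1)] assms(2) by simp
qed

text \<open>A Schur test: in the matrix d(t - j) all row sums and column sums are at most \<Delta>.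
  One factor of the square is bounded by \<Delta>, the other is summed over j for each t in
  A.\<close>

lemma profile_square_sum:
  assumes "profile h d \<Delta>" "finite A" "finite J"
  shows "(\<Sum>j\<in>J. (\<Sum>t\<in>A. d (t - j))\<^sup>2) \<le> \<Delta>\<^sup>2 * card A"
proof -
  have "(\<Sum>j\<in>J. (\<Sum>t\<in>A. d (t - j))\<^sup>2) \<le> (\<Sum>j\<in>J. \<Delta> * (\<Sum>t\<in>A. d (t - j)))"
    unfolding power2_eq_square using profile_shift_sums(1)[OF assms(1,2)] profile_nonneg[OF assms(1)]
    by (intro sum_mono mult_right_mono sum_nonneg) auto
  also have "\<dots> = \<Delta> * (\<Sum>t\<in>A. \<Sum>j\<in>J. d (t - j))"
    by (subst sum.swap) (simp add: sum_distrib_left)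
  also have "\<dots> \<le> \<Delta> * (\<Sum>t\<in>A. \<Delta>)"
    using profile_shift_sums(2)[OF assms(1,3)] profile_bound_nonneg[OF assms(1)]
    by (intro mult_left_mono sum_mono) auto
  finally show ?thesis by (simp add: power2_eq_square algebra_simps)
qed

text \<open>The Efron-Stein inequality of order 4 followed by the Schur test. Neither m nor the
  supremum of the kernel enters the bound, so it is uniform along a sequence of approximating
  kernels.\<close>

lemma nrm_Wsum_le:
  assumes k: "kern m h" and p: "profile h d \<Delta>" and "finite A"
  shows "nrm 4 P (Wsum h A) \<le> 2 * \<Delta> * sqrt (card A)"
proof -
  let ?J = "\<Union>t\<in>A. {t - int m<..t}"
  have "(nrm 4 P (Wsum h A))\<^sup>2 \<le> 4 * (\<Sum>j\<in>?J. (infl 4 j (Wsum h A))\<^sup>2)"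
    using assms by (intro efron_stein_aux bm_Wsum[OF k] dep_Wsum[OF k] integral_Wsum[OF k]) auto
  also have "\<dots> \<le> 4 * (\<Sum>j\<in>?J. (\<Sum>t\<in>A. d (t - j))\<^sup>2)"
    by (intro mult_left_mono sum_mono power_mono infl_Wsum_le[OF k p]) (auto simp: infl_nonneg)
  also have "\<dots> \<le> 4 * (\<Delta>\<^sup>2 * card A)"
    using assms by (intro mult_left_mono profile_square_sum[OF p]) auto
  also have "\<dots> = (2 * \<Delta> * sqrt (card A))\<^sup>2" by (simp add: power_mult_distrib)
  finally show ?thesis
    by (rule power2_le_imp_le) (simp add: profile_bound_nonneg[OF p])
qed

lemma nrm_Wsum_le':
  assumes k: "kern m h" and p: "profile h d \<Delta>" and "finite A" "card A \<le> a"
  shows "nrm 4 P (Wsum h A) \<le> 2 * \<Delta> * sqrt a"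
  using nrm_Wsum_le[OF assms(1-3)] assms(4) profile_bound_nonneg[OF p]
  by (smt (verit, best) mult_left_mono of_nat_le_iff real_sqrt_le_mono mult_nonneg_nonneg)

text \<open>After exchanging the sums, each t is counted once for every i with t in
  \<open>A i\<close>.\<close>

lemma overlap_sum_le:
  fixes d :: "int \<Rightarrow> real"
  assumes "finite I" "\<And>i. i \<in> I \<Longrightarrow> finite (A i)" "\<And>t. card {i\<in>I. t \<in> A i} \<le> L" "\<And>t. 0 \<le> d t"
  shows "(\<Sum>i\<in>I. \<Sum>t\<in>A i. d t) \<le> real L * (\<Sum>t\<in>(\<Union>i\<in>I. A i). d t)"
proof -
  let ?U = "\<Union>i\<in>I. A i"
  have fin: "finite ?U" using assms by auto
  have "(\<Sum>i\<in>I. \<Sum>t\<in>A i. d t) = (\<Sum>i\<in>I. \<Sum>t\<in>?U. if t \<in> A i then d t else 0)"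
  proof (rule sum.cong[OF refl])
    fix i assume "i \<in> I"
    then have "?U \<inter> A i = A i" by auto
    then show "(\<Sum>t\<in>A i. d t) = (\<Sum>t\<in>?U. if t \<in> A i then d t else 0)"
      using fin sum.inter_restrict[of ?U d "A i"] by simp
  qed
  also have "\<dots> = (\<Sum>t\<in>?U. \<Sum>i\<in>I. if t \<in> A i then d t else 0)" by (rule sum.swap)
  also have "\<dots> = (\<Sum>t\<in>?U. real (card {i\<in>I. t \<in> A i}) * d t)"
    using assms(1) by (intro sum.cong refl) (simp add: sum.If_cases Int_def)
  also have "\<dots> \<le> (\<Sum>t\<in>?U. real L * d t)"
    using assms by (intro sum_mono mult_right_mono) auto
  finally show ?thesis by (simp add: sum_distrib_left)
qed

text \<open>Bilinear rather than quadratic, because a difference of squares, whether the kernel or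
  the index sets change, is a product of two different sums.\<close>

definition Qsum :: "((nat \<Rightarrow> 'b) \<Rightarrow> real) \<Rightarrow> ((nat \<Rightarrow> 'b) \<Rightarrow> real) \<Rightarrow> nat set \<Rightarrow>
    (nat \<Rightarrow> int set) \<Rightarrow> (nat \<Rightarrow> int set) \<Rightarrow> (int \<Rightarrow> 'b) \<Rightarrow> real" where
  "Qsum u v I A B x = (\<Sum>i\<in>I. Wsum u (A i) x * Wsum v (B i) x)"

lemma bm_Qsum: "kern m u \<Longrightarrow> kern m v \<Longrightarrow> bm (Qsum u v I A B)"
  unfolding Qsum_def[abs_def] by (intro bm_sum bm_mult bm_Wsum)

text \<open>The product rule bounds the influence of innovation j, and L enters because a time
  occurs in at most L of the index sets. Each union of index sets is weighted by the length of the
  other family, so the bound becomes small as soon as the sets \<open>A i\<close> are short heads of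
  blocks.\<close>

lemma Qsum_variance_le:
  assumes u: "kern m u" "profile u du \<Delta>u" and v: "kern m v" "profile v dv \<Delta>v"
    and I: "finite I" "\<And>i. i \<in> I \<Longrightarrow> finite (A i)" "\<And>i. i \<in> I \<Longrightarrow> finite (B i)"
    and a: "\<And>i. i \<in> I \<Longrightarrow> card (A i) \<le> a" and b: "\<And>i. i \<in> I \<Longrightarrow> card (B i) \<le> b"
    and L: "\<And>t. card {i\<in>I. t \<in> A i} \<le> L" "\<And>t. card {i\<in>I. t \<in> B i} \<le> L"
  shows "(cnrm (Qsum u v I A B))\<^sup>2
    \<le> 288 * (L * \<Delta>u * \<Delta>v)\<^sup>2 * (real b * card (\<Union>i\<in>I. A i) + real a * card (\<Union>i\<in>I. B i))"
proof -
  define UA UB where U: "UA = (\<Union>i\<in>I. A i)" "UB = (\<Union>i\<in>I. B i)"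
  have fin: "finite UA" "finite UB" using I by (auto simp: U)
  define J where "J = (\<Union>t\<in>UA\<union>UB. {t - int m<..t})"
  have J: "finite J" using fin by (auto simp: J_def)
  define p q where pq: "p = (\<lambda>j. \<Sum>t\<in>UA. du (t - j))" "q = (\<lambda>j. \<Sum>t\<in>UB. dv (t - j))"
  have \<Delta>: "0 \<le> \<Delta>u" "0 \<le> \<Delta>v" using profile_bound_nonneg u v by auto
  have dep: "dep J (Qsum u v I A B)"
    unfolding Qsum_def[abs_def]
    by (intro dep_sum dep_mult; rule dep_mono[OF dep_Wsum[OF u(1)]] dep_mono[OF dep_Wsum[OF v(1)]])
       (auto simp: J_def U)
  have infl: "infl 2 j (Qsum u v I A B) \<le> 6 * \<Delta>v * sqrt b * (L * p j) + 2 * \<Delta>u * sqrt a * (L * q j)" for j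
  proof -
    have "infl 2 j (Qsum u v I A B) \<le> (\<Sum>i\<in>I. infl 2 j (\<lambda>x. Wsum u (A i) x * Wsum v (B i) x))"
      unfolding Qsum_def[abs_def] by (intro infl_sum_le bm_mult bm_Wsum[OF u(1)] bm_Wsum[OF v(1)]) auto
    also have "\<dots> \<le> (\<Sum>i\<in>I. 3 * infl 4 j (Wsum u (A i)) * nrm 4 P (Wsum v (B i)) +
        nrm 4 P (Wsum u (A i)) * infl 4 j (Wsum v (B i)))"
      by (intro sum_mono infl_mult_le bm_Wsum[OF u(1)] bm_Wsum[OF v(1)])
    also have "\<dots> \<le> (\<Sum>i\<in>I. 3 * (\<Sum>t\<in>A i. du (t - j)) * (2 * \<Delta>v * sqrt b) +
        (2 * \<Delta>u * sqrt a) * (\<Sum>t\<in>B i. dv (t - j)))"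
      using I a b \<Delta> profile_nonneg[OF u(2)]
      by (intro sum_mono add_mono mult_mono infl_Wsum_le[OF u] infl_Wsum_le[OF v] nrm_Wsum_le'[OF u] nrm_Wsum_le'[OF v])
         (auto simp: infl_nonneg nrm_nonneg intro!: sum_nonneg mult_nonneg_nonneg)
    also have "\<dots> = 6 * \<Delta>v * sqrt b * (\<Sum>i\<in>I. \<Sum>t\<in>A i. du (t - j)) + 2 * \<Delta>u * sqrt a * (\<Sum>i\<in>I. \<Sum>t\<in>B i. dv (t - j))"
      by (simp add: sum.distrib sum_distrib_left mult.commute mult.left_commute)
    also have "\<dots> \<le> 6 * \<Delta>v * sqrt b * (L * p j) + 2 * \<Delta>u * sqrt a * (L * q j)"
      using I L \<Delta> profile_nonneg[OF u(2)] profile_nonneg[OF v(2)] unfolding pq U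
      by (intro add_mono mult_left_mono overlap_sum_le) auto
    finally show ?thesis .
  qed
  have sq: "(infl 2 j (Qsum u v I A B))\<^sup>2 \<le> 72 * L\<^sup>2 * \<Delta>v\<^sup>2 * b * (p j)\<^sup>2 + 72 * L\<^sup>2 * \<Delta>u\<^sup>2 * a * (q j)\<^sup>2" for j
  proof -
    define r s where rs: "r = \<Delta>v * sqrt b * (L * p j)" "s = \<Delta>u * sqrt a * (L * q j)"
    have "infl 2 j (Qsum u v I A B) \<le> 6 * r + 2 * s" using infl[of j] by (simp add: rs mult.assoc)
    then have "(infl 2 j (Qsum u v I A B))\<^sup>2 \<le> (6 * r + 2 * s)\<^sup>2"
      by (intro power_mono) (auto simp: infl_nonneg)
    \<comment> \<open>72 = 2 * 36 comes from the larger coefficient and is used for both squares to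
      keep the bound symmetric; the Efron-Stein factor 4 makes it 288.\<close>
    also have "\<dots> \<le> 72 * r\<^sup>2 + 72 * s\<^sup>2"
      using sum_squares_ge_zero[of "6 * r - 2 * s" "8 * s"] by (simp add: power2_eq_square algebra_simps)
    also have "r\<^sup>2 = L\<^sup>2 * \<Delta>v\<^sup>2 * b * (p j)\<^sup>2" by (simp add: rs power_mult_distrib)
    also have "s\<^sup>2 = L\<^sup>2 * \<Delta>u\<^sup>2 * a * (q j)\<^sup>2" by (simp add: rs power_mult_distrib)
    finally show ?thesis by (simp add: mult.assoc)
  qed
  have "(cnrm (Qsum u v I A B))\<^sup>2
      \<le> 4 * (\<Sum>j\<in>J. (infl 2 j (Qsum u v I A B))\<^sup>2)"
    by (intro efron_stein J dep bm_Qsum[OF u(1) v(1)]) auto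
  also have "\<dots> \<le> 4 * (\<Sum>j\<in>J. 72 * L\<^sup>2 * \<Delta>v\<^sup>2 * b * (p j)\<^sup>2 + 72 * L\<^sup>2 * \<Delta>u\<^sup>2 * a * (q j)\<^sup>2)"
    by (intro mult_left_mono sum_mono sq) auto
  also have "\<dots> = 288 * L\<^sup>2 * (\<Delta>v\<^sup>2 * b * (\<Sum>j\<in>J. (p j)\<^sup>2) + \<Delta>u\<^sup>2 * a * (\<Sum>j\<in>J. (q j)\<^sup>2))"
    by (simp add: sum.distrib sum_distrib_left algebra_simps)
  also have "\<dots> \<le> 288 * L\<^sup>2 * (\<Delta>v\<^sup>2 * b * (\<Delta>u\<^sup>2 * card UA) + \<Delta>u\<^sup>2 * a * (\<Delta>v\<^sup>2 * card UB))"
    unfolding pq by (intro mult_left_mono add_mono profile_square_sum[OF u(2)] profile_square_sum[OF v(2)] fin J) auto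
  also have "\<dots> = 288 * (L * \<Delta>u * \<Delta>v)\<^sup>2 * (real b * card UA + real a * card UB)"
    by (simp add: power_mult_distrib algebra_simps)
  finally show ?thesis by (simp add: U)
qed

end

subsection \<open>Moments of partial sums of a finite-range process\<close>

text \<open>Doubling s multiplies s^(3/2) by 2^(3/2) > 2, while the recursion only doubles the
  error. With 2C in the induction hypothesis one step yields 5C s^(3/2), and s \<le> n/2 together
  with 2^(3/2) \<ge> 5/2 brings this back to 2C n^(3/2).\<close>

lemma halving_recursion_bound:
  fixes e :: "nat \<Rightarrow> real"
  assumes e0: "e 0 = 0" and C: "0 \<le> C" "\<bar>e 1\<bar> \<le> C"
    and even: "\<And>s. 1 \<le> s \<Longrightarrow> \<bar>e (2 * s) - 2 * e s\<bar> \<le> C * (s * sqrt s)"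
    and odd: "\<And>s. 1 \<le> s \<Longrightarrow> \<bar>e (2 * s + 1) - 2 * e s\<bar> \<le> C * (s * sqrt s)"
  shows "\<bar>e n\<bar> \<le> 2 * C * (n * sqrt n)"
proof (induction n rule: less_induct)
  case (less n)
  consider "n = 0" | "n = 1" | "2 \<le> n" by linarith
  then show ?case
  proof cases
    case 3
    define s where "s = n div 2"
    have s: "1 \<le> s" "s < n" "2 * s \<le> n" using 3 by (auto simp: s_def)
    have "\<bar>e n - 2 * e s\<bar> \<le> C * (s * sqrt s)"
      using even[OF s(1)] odd[OF s(1)] by (cases "even n") (auto simp: s_def elim!: evenE oddE)
    then have "\<bar>e n\<bar> \<le> 5 * C * (s * sqrt s)" using less[OF s(2)] by (simp add: algebra_simps)
    moreover have "s * sqrt s \<le> (n * sqrt n) * (2 / 5)"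
    proof -
      have "s * sqrt s \<le> n / 2 * sqrt (n / 2)"
        using s by (intro mult_mono) auto
      also have "n / 2 * sqrt (n / 2) = (n * sqrt n) / (2 * sqrt 2)" by (simp add: real_sqrt_divide)
      also have "\<dots> \<le> (n * sqrt n) * (2 / 5)"
      proof -
        have "sqrt 2 \<ge> 5 / 4" by (rule real_le_rsqrt) (simp add: power2_eq_square)
        then have "1 / (2 * sqrt 2) \<le> 2 / 5" by (simp add: field_simps)
        from mult_left_mono[OF this, of "n * sqrt n"] show ?thesis by simp
      qed
      finally show ?thesis .
    qed
    ultimately show ?thesis
      using C(1) mult_left_mono[of "s * sqrt s" "(n * sqrt n) * (2 / 5)" "5 * C"] by (simp add: algebra_simps)
  qed (use e0 C in auto)
qed

text \<open>The sum to which the covariances 2 \<sigma>^4 min(s,t)^2 lead; its leading term r^4 / 6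
  is the source of the 1/3 in the block variance.\<close>

lemma sum_min_squares:
  "(\<Sum>s=1..r. \<Sum>t=1..r. real (min s t) ^ 2) = real r * (real r + 1) * ((real r)\<^sup>2 + real r + 1) / 6"
proof (induction r)
  case (Suc r)
  have sq: "(\<Sum>s=1..r. real s ^ 2) = real r * (real r + 1) * (2 * real r + 1) / 6"
    by (induction r) (auto simp: power2_eq_square field_simps)
  have "(\<Sum>s=1..Suc r. \<Sum>t=1..Suc r. real (min s t) ^ 2)
      = (\<Sum>s=1..r. (\<Sum>t=1..r. real (min s t) ^ 2) + real s ^ 2) + ((\<Sum>t=1..r. real t ^ 2) + real (Suc r) ^ 2)"
    by (auto simp: min_def intro!: sum.cong arg_cong2[where f="(+)"])
  also have "\<dots> = (\<Sum>s=1..r. \<Sum>t=1..r. real (min s t) ^ 2) + 2 * (\<Sum>s=1..r. real s ^ 2) + real (Suc r) ^ 2"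
    by (simp add: sum.distrib)
  finally show ?case unfolding Suc.IH sq by (simp add: power2_eq_square field_simps)
qed simp

context iid_seq
begin

lemma variance_sum:
  assumes "\<And>i. i \<in> I \<Longrightarrow> bm (f i)"
  shows "PP.P.variance (\<lambda>x. \<Sum>i\<in>I. f i x) =
    (\<Sum>i\<in>I. \<Sum>j\<in>I. (\<integral>x. f i x * f j x \<partial>P) - (\<integral>x. f i x \<partial>P) * (\<integral>x. f j x \<partial>P))"
proof -
  have b: "bm (\<lambda>x. \<Sum>i\<in>I. f i x)" using assms by (intro bm_sum)
  have "PP.P.variance (\<lambda>x. \<Sum>i\<in>I. f i x) = (\<integral>x. (\<Sum>i\<in>I. f i x)\<^sup>2 \<partial>P) - (\<integral>x. (\<Sum>i\<in>I. f i x) \<partial>P)\<^sup>2"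
    by (intro PP.P.variance_eq bm_integrable bm_power b)
  also have "(\<integral>x. (\<Sum>i\<in>I. f i x)\<^sup>2 \<partial>P) = (\<Sum>i\<in>I. \<Sum>j\<in>I. (\<integral>x. f i x * f j x \<partial>P))"
    unfolding power2_eq_square sum_product using assms
    by (simp add: bm_integrable bm_mult bm_sum Bochner_Integration.integral_sum)
  also have "(\<integral>x. (\<Sum>i\<in>I. f i x) \<partial>P)\<^sup>2 = (\<Sum>i\<in>I. \<integral>x. f i x \<partial>P)\<^sup>2"
    using assms by (intro arg_cong[where f="\<lambda>c. c\<^sup>2"] Bochner_Integration.integral_sum bm_integrable)
  also have "\<dots> = (\<Sum>i\<in>I. \<Sum>j\<in>I. (\<integral>x. f i x \<partial>P) * (\<integral>x. f j x \<partial>P))"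
    by (simp add: power2_eq_square sum_product)
  finally show ?thesis by (simp only: sum_subtractf)
qed

lemma variance_sum_uncorrelated:
  assumes "finite I" "\<And>i. i \<in> I \<Longrightarrow> bm (f i)"
    and "\<And>i j. i \<in> I \<Longrightarrow> j \<in> I \<Longrightarrow> i \<noteq> j \<Longrightarrow> (\<integral>x. f i x * f j x \<partial>P) = (\<integral>x. f i x \<partial>P) * (\<integral>x. f j x \<partial>P)"
  shows "PP.P.variance (\<lambda>x. \<Sum>i\<in>I. f i x) = (\<Sum>i\<in>I. PP.P.variance (f i))"
proof -
  have "PP.P.variance (\<lambda>x. \<Sum>i\<in>I. f i x) =
      (\<Sum>i\<in>I. \<Sum>j\<in>I. (\<integral>x. f i x * f j x \<partial>P) - (\<integral>x. f i x \<partial>P) * (\<integral>x. f j x \<partial>P))"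
    by (rule variance_sum[OF assms(2)])
  also have "\<dots> = (\<Sum>i\<in>I. \<Sum>j\<in>I. if j = i then PP.P.variance (f i) else 0)"
  proof (intro sum.cong refl)
    fix i j assume ij: "i \<in> I" "j \<in> I"
    have "PP.P.variance (f i) = (\<integral>x. f i x * f i x \<partial>P) - (\<integral>x. f i x \<partial>P) * (\<integral>x. f i x \<partial>P)"
      unfolding power2_eq_square[symmetric] using assms(2)[OF ij(1)]
      by (intro PP.P.variance_eq bm_integrable bm_power)
    then show "(\<integral>x. f i x * f j x \<partial>P) - (\<integral>x. f i x \<partial>P) * (\<integral>x. f j x \<partial>P) = (if j = i then PP.P.variance (f i) else 0)"
      using assms(3)[OF ij] by auto
  qed
  also have "\<dots> = (\<Sum>i\<in>I. PP.P.variance (f i))" using assms(1) by (simp add: sum.delta)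
  finally show ?thesis .
qed

lemma integral_mult4_le:
  assumes "bm f" "bm g" "bm u" "bm v"
  shows "\<bar>\<integral>x. (f x * g x) * (u x * v x) \<partial>P\<bar> \<le> (nrm 4 P f * nrm 4 P g) * (nrm 4 P u * nrm 4 P v)"
proof -
  have "\<bar>\<integral>x. (f x * g x) * (u x * v x) \<partial>P\<bar> \<le> nrm 2 P (\<lambda>x. f x * g x) * nrm 2 P (\<lambda>x. u x * v x)"
    using assms by (intro Lq_Cauchy_Schwarz bm_Lq bm_mult)
  also have "\<dots> \<le> (nrm 4 P f * nrm 4 P g) * (nrm 4 P u * nrm 4 P v)"
    using assms by (intro mult_mono Lq_mult bm_Lq) (auto simp: nrm_nonneg)
  finally show ?thesis .
qed

section \<open>Autocovariances and sums over intervals\<close>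

definition acov :: "((nat \<Rightarrow> 'b) \<Rightarrow> real) \<Rightarrow> nat \<Rightarrow> real" where
  "acov h k = (\<integral>x. Xp h 0 x * Xp h (int k) x \<partial>P)"

text \<open>Open on the left, so that the second interval of a concatenation starts at the right
  endpoint of the first and no index is shared.\<close>

definition Iv :: "int \<Rightarrow> nat \<Rightarrow> int set" where
  "Iv a l = {a<..a + int l}"

lemma finite_Iv: "finite (Iv a l)" and card_Iv: "card (Iv a l) = l"
  by (auto simp: Iv_def)

lemma Iv_shift: "(\<lambda>t. t + s) ` Iv a l = Iv (a + s) l"
proof -
  have "(\<lambda>t. t + s) ` Iv a l \<supseteq> Iv (a + s) l"
  proof
    fix t assume "t \<in> Iv (a + s) l"
    then show "t \<in> (\<lambda>t. t + s) ` Iv a l" by (intro image_eqI[of _ _ "t - s"]) (auto simp: Iv_def)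
  qed
  then show ?thesis by (auto simp: Iv_def)
qed

lemma Iv_add: "Iv a (k + l) = Iv a k \<union> Iv (a + int k) l" "Iv a k \<inter> Iv (a + int k) l = {}"
  by (auto simp: Iv_def)

lemma Wsum_Iv_add: "Wsum h (Iv a (k + l)) x = Wsum h (Iv a k) x + Wsum h (Iv (a + int k) l) x"
  unfolding Iv_add(1) by (intro Wsum_union finite_Iv Iv_add(2))

end

locale iid_kernel = iid_seq \<mu> for \<mu> :: "'b measure" +
  fixes h :: "(nat \<Rightarrow> 'b) \<Rightarrow> real" and m :: nat and d :: "int \<Rightarrow> real" and \<Delta> :: real
  assumes kern: "kern m h" and profile: "profile h d \<Delta>"
begin

lemma W_indep:
  assumes f: "bm f" "dep (\<Union>t\<in>A. {t - int m<..t}) f" and g: "bm g" "dep (\<Union>t\<in>B. {t - int m<..t}) g"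
    and fin: "finite A" and sep: "\<And>a b. a \<in> A \<Longrightarrow> b \<in> B \<Longrightarrow> a + int m \<le> b"
  shows "(\<integral>x. f x * g x \<partial>P) = (\<integral>x. f x \<partial>P) * (\<integral>x. g x \<partial>P)"
proof (rule independent[OF _ f(1) g(1) f(2)])
  show "finite (\<Union>t\<in>A. {t - int m<..t})" using fin by auto
  fix i assume "i \<in> (\<Union>t\<in>A. {t - int m<..t})"
  then show "free i g" using sep by (intro dep_free[OF g(2)]) force
qed

lemma W_power_indep:
  assumes "finite A" "\<And>a b. a \<in> A \<Longrightarrow> b \<in> B \<Longrightarrow> a + int m \<le> b"
  shows "(\<integral>x. Wsum h A x ^ p * Wsum h B x ^ q \<partial>P) = (\<integral>x. Wsum h A x ^ p \<partial>P) * (\<integral>x. Wsum h B x ^ q \<partial>P)"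
  using assms by (intro W_indep[where A=A and B=B] bm_power dep_power bm_Wsum[OF kern] dep_Wsum[OF kern])

lemma acov_eq:
  assumes "a \<le> b" shows "(\<integral>x. Xp h a x * Xp h b x \<partial>P) = acov h (nat (b - a))"
  using assms integral_shift[of "\<lambda>x. Xp h 0 x * Xp h (b - a) x" a] bmD[OF bm_mult[OF bm_Xp[OF kern] bm_Xp[OF kern]]]
  by (simp add: acov_def Xp_shift)

lemma acov_zero: "m \<le> k \<Longrightarrow> acov h k = 0"
  using W_power_indep[of "{0}" "{int k}" 1 1] integral_Wsum[OF kern, of "{0}"]
  by (simp add: acov_def Wsum_def[abs_def])

text \<open>Autocovariances vanish from lag m on, so this is the full two-sided sum.
  \<open>sproj_eq\<close> identifies it with the squared norm of D_0.\<close>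

definition lrv :: real where "lrv = acov h 0 + 2 * (\<Sum>k=1..m. acov h k)"

lemma lrv_eq: "m \<le> n \<Longrightarrow> lrv = acov h 0 + 2 * (\<Sum>k=1..n. acov h k)"
  unfolding lrv_def using acov_zero by (auto intro!: sum.mono_neutral_left)

definition mom :: "nat \<Rightarrow> nat \<Rightarrow> real" where
  "mom q l = (\<integral>x. Wsum h (Iv 0 l) x ^ q \<partial>P)"

lemma mom_shift: "(\<integral>x. Wsum h (Iv a l) x ^ q \<partial>P) = mom q l"
  using integral_shift[of "\<lambda>x. Wsum h (Iv 0 l) x ^ q" a] bmD[OF bm_power[OF bm_Wsum[OF kern]]]
  by (simp add: mom_def Wsum_shift Iv_shift)

definition K :: real where "K = 2 * \<Delta>"

lemma K_nonneg: "0 \<le> K"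
  using profile_bound_nonneg[OF profile] by (simp add: K_def)

lemma nrm_W_le: "card A \<le> a \<Longrightarrow> finite A \<Longrightarrow> nrm 4 P (Wsum h A) \<le> K * sqrt a"
  using nrm_Wsum_le'[OF kern profile] by (simp add: K_def)

lemma mom2_bounds: "0 \<le> mom 2 l" "mom 2 l \<le> K\<^sup>2 * l"
proof -
  show "0 \<le> mom 2 l" unfolding mom_def by (intro integral_nonneg_AE) auto
  have "nrm 2 P (Wsum h (Iv 0 l)) \<le> K * sqrt l"
    using PP.P.Lq_4_2(2)[OF bm_Lq[OF bm_Wsum[OF kern, of "Iv 0 l"]]] nrm_W_le[of "Iv 0 l" l]
    by (simp add: card_Iv finite_Iv)
  from power_mono[OF this, of 2] show "mom 2 l \<le> K\<^sup>2 * l"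
    by (simp add: nrm_nonneg nrm_power mom_def power_mult_distrib)
qed

lemma mom4_bounds: "0 \<le> mom 4 l" "mom 4 l \<le> K ^ 4 * (real l)\<^sup>2"
proof -
  show "0 \<le> mom 4 l" unfolding mom_def by (intro integral_nonneg_AE) auto
  have "nrm 4 P (Wsum h (Iv 0 l)) \<le> K * sqrt l"
    using nrm_W_le[of "Iv 0 l" l] by (simp add: card_Iv finite_Iv)
  from power_mono[OF this, of 4] have "mom 4 l \<le> K ^ 4 * (sqrt l) ^ 4"
    by (simp add: nrm_nonneg nrm_power mom_def power_mult_distrib)
  also have "(sqrt l) ^ 4 = ((sqrt l)\<^sup>2)\<^sup>2" by (simp flip: power_mult del: real_sqrt_pow2)
  finally show "mom 4 l \<le> K ^ 4 * (real l)\<^sup>2" by simp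
qed

lemma mom2_Suc: "mom 2 (Suc l) = mom 2 l + acov h 0 + 2 * (\<Sum>k=1..l. acov h k)"
proof -
  have bX: "bm (Xp h t)" for t by (rule bm_Xp[OF kern])
  have W: "Wsum h (Iv 0 (Suc l)) x = Wsum h (Iv 0 l) x + Xp h (int l + 1) x" for x
  proof -
    have "Iv (int l) 1 = {int l + 1}" by (auto simp: Iv_def)
    then show ?thesis using Wsum_Iv_add[of h 0 l 1 x] by (simp add: Wsum_def)
  qed
  have "mom 2 (Suc l) = (\<integral>x. (Wsum h (Iv 0 l) x)\<^sup>2 + 2 * (Wsum h (Iv 0 l) x * Xp h (int l + 1) x)
      + Xp h (int l + 1) x * Xp h (int l + 1) x \<partial>P)"
    unfolding mom_def W by (simp add: power2_eq_square algebra_simps)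
  also have "\<dots> = mom 2 l + 2 * (\<integral>x. Wsum h (Iv 0 l) x * Xp h (int l + 1) x \<partial>P)
      + (\<integral>x. Xp h (int l + 1) x * Xp h (int l + 1) x \<partial>P)"
    using bX bm_Wsum[OF kern] by (simp add: mom_def bm_integrable bm_intros)
  also have "(\<integral>x. Xp h (int l + 1) x * Xp h (int l + 1) x \<partial>P) = acov h 0"
    using acov_eq[of "int l + 1" "int l + 1"] by simp
  also have "(\<integral>x. Wsum h (Iv 0 l) x * Xp h (int l + 1) x \<partial>P) = (\<Sum>t\<in>Iv 0 l. acov h (nat (int l + 1 - t)))"
  proof -
    have "(\<integral>x. Wsum h (Iv 0 l) x * Xp h (int l + 1) x \<partial>P) = (\<Sum>t\<in>Iv 0 l. \<integral>x. Xp h t x * Xp h (int l + 1) x \<partial>P)"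
      unfolding Wsum_def sum_distrib_right using bX
      by (intro Bochner_Integration.integral_sum bm_integrable bm_mult)
    also have "\<dots> = (\<Sum>t\<in>Iv 0 l. acov h (nat (int l + 1 - t)))"
      by (intro sum.cong refl acov_eq) (auto simp: Iv_def)
    finally show ?thesis .
  qed
  also have "\<dots> = (\<Sum>k=1..l. acov h k)"
    by (rule sum.reindex_bij_witness[of _ "\<lambda>k. int l + 1 - int k" "\<lambda>t. nat (int l + 1 - t)"]) (auto simp: Iv_def)
  finally show ?thesis by simp
qed

text \<open>From l = m on each further term adds exactly \<open>lrv\<close>, so the difference is
  constant there and only finitely many values have to be bounded.\<close>

lemma mom2_asymp: "\<exists>C. \<forall>l. \<bar>mom 2 l - lrv * l\<bar> \<le> C"
proof -
  have eq: "mom 2 (m + l) - lrv * (m + l) = mom 2 m - lrv * m" for l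
  proof (induction l)
    case (Suc l)
    then show ?case using mom2_Suc[of "m + l"] lrv_eq[of "m + l"] by (simp add: algebra_simps)
  qed simp
  define C where "C = (\<Sum>l\<le>m. \<bar>mom 2 l - lrv * l\<bar>)"
  have le: "\<bar>mom 2 l - lrv * l\<bar> \<le> C" if "l \<le> m" for l
    unfolding C_def using member_le_sum[of l "{..m}" "\<lambda>l. \<bar>mom 2 l - lrv * l\<bar>"] that by auto
  have "\<bar>mom 2 l - lrv * l\<bar> \<le> C" for l
  proof (cases "l \<le> m")
    case False
    then show ?thesis using eq[of "l - m"] le[of m] by simp
  qed (rule le)
  then show ?thesis by blast
qed

text \<open>Otherwise the second moments, which follow \<open>lrv * l\<close> up to a bounded error,
  would become negative.\<close>

lemma lrv_nonneg: "0 \<le> lrv"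
proof (rule ccontr)
  assume neg: "\<not> 0 \<le> lrv"
  obtain C where C: "\<And>l. \<bar>mom 2 l - lrv * l\<bar> \<le> C" using mom2_asymp by blast
  obtain l :: nat where "C < (- lrv) * l" using neg reals_Archimedean3[of "- lrv"] by (auto simp: mult.commute)
  then show False using C[of l] mom2_bounds(1)[of l] by simp
qed

section \<open>Two adjacent sums, decoupled by a gap of length m\<close>

context
  fixes s n :: nat
begin

text \<open>Removing the first m terms of the tail leaves \<open>far_sum\<close>, independent of the
  head, at the price of \<open>gap_sum\<close>, whose norm is at most \<open>K * sqrt m\<close>. The
  minimum covers tails of length below m, for which \<open>far_sum\<close> is an empty sum.\<close>

definition "gap_len = min m n"
definition "hd_sum = Wsum h (Iv 0 s)"
definition "tl_sum = Wsum h (Iv (int s) n)"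
definition "gap_sum = Wsum h (Iv (int s) gap_len)"
definition "far_sum = Wsum h (Iv (int s + int gap_len) (n - gap_len))"

lemma tl_sum_eq: "tl_sum x = gap_sum x + far_sum x"
  using Wsum_Iv_add[of h "int s" gap_len "n - gap_len" x] by (simp add: tl_sum_def gap_sum_def far_sum_def gap_len_def)

lemma bm_split: "bm hd_sum" "bm tl_sum" "bm gap_sum" "bm far_sum"
  unfolding hd_sum_def tl_sum_def gap_sum_def far_sum_def by (rule bm_Wsum[OF kern])+

lemma nrm_split:
  "nrm 4 P hd_sum \<le> K * sqrt s" "nrm 4 P tl_sum \<le> K * sqrt n" "nrm 4 P gap_sum \<le> K * sqrt m" "nrm 4 P far_sum \<le> K * sqrt n"
  unfolding hd_sum_def tl_sum_def gap_sum_def far_sum_def by (intro nrm_W_le; simp add: card_Iv finite_Iv gap_len_def)+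

lemma nrm_split_nonneg: "0 \<le> nrm 4 P hd_sum" "0 \<le> nrm 4 P tl_sum" "0 \<le> nrm 4 P gap_sum" "0 \<le> nrm 4 P far_sum"
  by (simp_all add: nrm_nonneg)

lemma split_indep: "(\<integral>x. hd_sum x ^ p * far_sum x ^ q \<partial>P) = (\<integral>x. hd_sum x ^ p \<partial>P) * (\<integral>x. far_sum x ^ q \<partial>P)"
proof (cases "n \<le> m")
  case True
  then have "far_sum = (\<lambda>x. 0)" by (auto simp: far_sum_def gap_len_def Iv_def Wsum_def)
  then show ?thesis by (simp add: PP.P.prob_space)
next
  case False
  then show ?thesis unfolding hd_sum_def far_sum_def
    by (intro W_power_indep) (auto simp: Iv_def gap_len_def)
qed

text \<open>With \<open>far_sum\<close> in place of the tail the integral factorises and vanishes,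
  since \<open>far_sum\<close> is centered. What remains contains one factor \<open>gap_sum\<close>
  of bounded norm.\<close>

lemma integral_hd3_tl_le: "\<bar>\<integral>x. hd_sum x ^ 3 * tl_sum x \<partial>P\<bar> \<le> K ^ 4 * sqrt m * (s * sqrt s)"
proof -
  have "(\<integral>x. hd_sum x ^ 3 * far_sum x \<partial>P) = 0"
    using split_indep[of 3 1] integral_Wsum[OF kern] by (simp add: far_sum_def)
  moreover have "(\<integral>x. hd_sum x ^ 3 * tl_sum x \<partial>P) = (\<integral>x. (hd_sum x * hd_sum x) * (hd_sum x * gap_sum x) + hd_sum x ^ 3 * far_sum x \<partial>P)"
    by (intro Bochner_Integration.integral_cong) (auto simp: tl_sum_eq power3_eq_cube algebra_simps)
  ultimately have "(\<integral>x. hd_sum x ^ 3 * tl_sum x \<partial>P) = (\<integral>x. (hd_sum x * hd_sum x) * (hd_sum x * gap_sum x) \<partial>P)"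
    by (subst (asm) Bochner_Integration.integral_add) (auto intro!: bm_integrable bm_mult bm_power bm_split)
  then have "\<bar>\<integral>x. hd_sum x ^ 3 * tl_sum x \<partial>P\<bar> \<le> (nrm 4 P hd_sum * nrm 4 P hd_sum) * (nrm 4 P hd_sum * nrm 4 P gap_sum)"
    using integral_mult4_le[OF bm_split(1) bm_split(1) bm_split(1) bm_split(3)] by simp
  also have "\<dots> \<le> ((K * sqrt s) * (K * sqrt s)) * ((K * sqrt s) * (K * sqrt m))"
    using K_nonneg by (intro mult_mono nrm_split mult_nonneg_nonneg nrm_split_nonneg) auto
  also have "\<dots> = K ^ 4 * sqrt m * (s * sqrt s)"
    by (simp add: power4_eq_xxxx mult.commute mult.left_commute)
  finally show ?thesis .
qed

text \<open>The squares of \<open>tl_sum\<close> and \<open>far_sum\<close> differ by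
  \<open>gap_sum * (tl_sum + far_sum)\<close>. This replacement is made in the mixed moment and, in
  reverse, in \<open>mom 2 n\<close>; each costs half of the error.\<close>

lemma integral_hd2_tl2_le: "\<bar>(\<integral>x. (hd_sum x)\<^sup>2 * (tl_sum x)\<^sup>2 \<partial>P) - mom 2 s * mom 2 n\<bar> \<le> 4 * (K ^ 4 * sqrt m * (s * sqrt n))"
proof -
  define D where "D = (\<lambda>x. tl_sum x + far_sum x)"
  have D: "bm D" unfolding D_def by (intro bm_add bm_split)
  have "nrm 4 P D \<le> nrm 4 P tl_sum + nrm 4 P far_sum"
    unfolding D_def by (intro Lq_add bm_Lq bm_split) auto
  also have "\<dots> \<le> 2 * (K * sqrt n)" using nrm_split by linarith
  finally have nD: "nrm 4 P D \<le> 2 * (K * sqrt n)" .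
  have sq: "(tl_sum x)\<^sup>2 = (far_sum x)\<^sup>2 + gap_sum x * D x" for x
    by (simp add: D_def tl_sum_eq power2_eq_square algebra_simps)
  have a: "(\<integral>x. (hd_sum x)\<^sup>2 * (tl_sum x)\<^sup>2 \<partial>P) = mom 2 s * (\<integral>x. (far_sum x)\<^sup>2 \<partial>P) + (\<integral>x. (hd_sum x * hd_sum x) * (gap_sum x * D x) \<partial>P)"
  proof -
    have "(\<integral>x. (hd_sum x)\<^sup>2 * (tl_sum x)\<^sup>2 \<partial>P) = (\<integral>x. (hd_sum x)\<^sup>2 * (far_sum x)\<^sup>2 + (hd_sum x * hd_sum x) * (gap_sum x * D x) \<partial>P)"
      unfolding sq by (simp add: power2_eq_square algebra_simps)
    also have "\<dots> = (\<integral>x. (hd_sum x)\<^sup>2 * (far_sum x)\<^sup>2 \<partial>P) + (\<integral>x. (hd_sum x * hd_sum x) * (gap_sum x * D x) \<partial>P)"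
      by (intro Bochner_Integration.integral_add bm_integrable bm_mult bm_power bm_split D)
    finally show ?thesis using split_indep[of 2 2] mom_shift[of 0 s 2] by (simp add: hd_sum_def)
  qed
  have b: "mom 2 n = (\<integral>x. (far_sum x)\<^sup>2 \<partial>P) + (\<integral>x. gap_sum x * D x \<partial>P)"
    unfolding mom_shift[of "int s" n 2, symmetric] tl_sum_def[symmetric] sq
    by (intro Bochner_Integration.integral_add bm_integrable bm_mult bm_power bm_split D)
  have e1: "\<bar>\<integral>x. (hd_sum x * hd_sum x) * (gap_sum x * D x) \<partial>P\<bar> \<le> 2 * (K ^ 4 * sqrt m * (s * sqrt n))"
  proof -
    have "\<bar>\<integral>x. (hd_sum x * hd_sum x) * (gap_sum x * D x) \<partial>P\<bar> \<le> (nrm 4 P hd_sum * nrm 4 P hd_sum) * (nrm 4 P gap_sum * nrm 4 P D)"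
      by (intro integral_mult4_le bm_split D)
    also have "\<dots> \<le> ((K * sqrt s) * (K * sqrt s)) * ((K * sqrt m) * (2 * (K * sqrt n)))"
      using K_nonneg by (intro mult_mono nrm_split nD mult_nonneg_nonneg nrm_split_nonneg) (auto simp: nrm_nonneg)
    also have "\<dots> = 2 * (K ^ 4 * sqrt m * (s * sqrt n))"
      by (simp add: power4_eq_xxxx mult.commute mult.left_commute)
    finally show ?thesis .
  qed
  have e2: "\<bar>mom 2 s * (\<integral>x. gap_sum x * D x \<partial>P)\<bar> \<le> 2 * (K ^ 4 * sqrt m * (s * sqrt n))"
  proof -
    have "\<bar>\<integral>x. gap_sum x * D x \<partial>P\<bar> \<le> nrm 2 P gap_sum * nrm 2 P D" by (intro Lq_Cauchy_Schwarz bm_Lq bm_split D)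
    also have "\<dots> \<le> nrm 4 P gap_sum * nrm 4 P D"
      by (intro mult_mono PP.P.Lq_4_2 bm_Lq bm_split D) (auto simp: nrm_nonneg)
    also have "\<dots> \<le> (K * sqrt m) * (2 * (K * sqrt n))"
      using K_nonneg by (intro mult_mono nrm_split nD) (auto simp: nrm_nonneg)
    finally have "mom 2 s * \<bar>\<integral>x. gap_sum x * D x \<partial>P\<bar> \<le> (K\<^sup>2 * s) * ((K * sqrt m) * (2 * (K * sqrt n)))"
      using mom2_bounds by (intro mult_mono) auto
    also have "\<dots> = 2 * (K ^ 4 * sqrt m * (s * sqrt n))"
      by (simp add: power4_eq_xxxx power2_eq_square mult.commute mult.left_commute)
    finally show ?thesis using mom2_bounds[of s] by (simp add: abs_mult)
  qed
  show ?thesis using a b e1 e2 by (simp add: algebra_simps)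
qed

text \<open>The cubes of \<open>tl_sum\<close> and \<open>far_sum\<close> differ by
  \<open>gap_sum\<close> times three quadratic terms with equal bounds; against the cube of
  \<open>far_sum\<close> the head factorises and has mean zero.\<close>

lemma integral_hd_tl3_le: "\<bar>\<integral>x. hd_sum x * tl_sum x ^ 3 \<partial>P\<bar> \<le> 3 * (K ^ 4 * sqrt m * (sqrt s * n))"
proof -
  have z: "(\<integral>x. hd_sum x * far_sum x ^ 3 \<partial>P) = 0"
    using split_indep[of 1 3] integral_Wsum[OF kern] by (simp add: hd_sum_def)
  have e: "\<bar>\<integral>x. (hd_sum x * gap_sum x) * (U x * V x) \<partial>P\<bar> \<le> K ^ 4 * sqrt m * (sqrt s * n)"
    if "U = tl_sum \<or> U = far_sum" "V = tl_sum \<or> V = far_sum" for U V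
  proof -
    have UV: "bm U" "bm V" "nrm 4 P U \<le> K * sqrt n" "nrm 4 P V \<le> K * sqrt n"
      using that bm_split nrm_split by auto
    have "\<bar>\<integral>x. (hd_sum x * gap_sum x) * (U x * V x) \<partial>P\<bar> \<le> (nrm 4 P hd_sum * nrm 4 P gap_sum) * (nrm 4 P U * nrm 4 P V)"
      by (intro integral_mult4_le bm_split UV)
    also have "\<dots> \<le> ((K * sqrt s) * (K * sqrt m)) * ((K * sqrt n) * (K * sqrt n))"
      using K_nonneg by (intro mult_mono nrm_split UV mult_nonneg_nonneg nrm_split_nonneg) (auto simp: nrm_nonneg)
    also have "\<dots> = K ^ 4 * sqrt m * (sqrt s * n)"
      by (simp add: power4_eq_xxxx mult.commute mult.left_commute)
    finally show ?thesis .
  qed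
  have "(\<integral>x. hd_sum x * tl_sum x ^ 3 \<partial>P) = (\<integral>x. hd_sum x * far_sum x ^ 3 + (hd_sum x * gap_sum x) * (tl_sum x * tl_sum x)
      + (hd_sum x * gap_sum x) * (tl_sum x * far_sum x) + (hd_sum x * gap_sum x) * (far_sum x * far_sum x) \<partial>P)"
    by (intro Bochner_Integration.integral_cong) (auto simp: tl_sum_eq power3_eq_cube algebra_simps)
  also have "\<dots> = (\<integral>x. hd_sum x * far_sum x ^ 3 \<partial>P) + (\<integral>x. (hd_sum x * gap_sum x) * (tl_sum x * tl_sum x) \<partial>P)
      + (\<integral>x. (hd_sum x * gap_sum x) * (tl_sum x * far_sum x) \<partial>P) + (\<integral>x. (hd_sum x * gap_sum x) * (far_sum x * far_sum x) \<partial>P)"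
    by (simp add: bm_integrable bm_mult bm_power bm_split bm_add)
  finally show ?thesis using e[of tl_sum tl_sum] e[of tl_sum far_sum] e[of far_sum far_sum] z by simp
qed

text \<open>Binomial expansion: the coefficients 4, 6, 4 of the mixed terms, multiplied with the
  factors 1, 4, 3 of the three preceding bounds, give 4, 24 and 12.\<close>

lemma mom4_add_le:
  "\<bar>mom 4 (s + n) - mom 4 s - mom 4 n - 6 * (mom 2 s * mom 2 n)\<bar>
    \<le> K ^ 4 * sqrt m * (4 * (s * sqrt s) + 24 * (s * sqrt n) + 12 * (sqrt s * n))"
proof -
  have "Wsum h (Iv 0 (s + n)) x = hd_sum x + tl_sum x" for x
    using Wsum_Iv_add[of h 0 s n x] by (simp add: hd_sum_def tl_sum_def)
  then have "mom 4 (s + n) = (\<integral>x. hd_sum x ^ 4 + 4 * (hd_sum x ^ 3 * tl_sum x) + 6 * ((hd_sum x)\<^sup>2 * (tl_sum x)\<^sup>2) + 4 * (hd_sum x * tl_sum x ^ 3) + tl_sum x ^ 4 \<partial>P)"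
    unfolding mom_def
    by (intro Bochner_Integration.integral_cong)
       (auto simp: power2_eq_square power3_eq_cube power4_eq_xxxx algebra_simps)
  also have "\<dots> = (\<integral>x. hd_sum x ^ 4 \<partial>P) + 4 * (\<integral>x. hd_sum x ^ 3 * tl_sum x \<partial>P) + 6 * (\<integral>x. (hd_sum x)\<^sup>2 * (tl_sum x)\<^sup>2 \<partial>P)
      + 4 * (\<integral>x. hd_sum x * tl_sum x ^ 3 \<partial>P) + (\<integral>x. tl_sum x ^ 4 \<partial>P)"
    by (simp add: bm_integrable bm_mult bm_power bm_split bm_add bm_const)
  also have "(\<integral>x. hd_sum x ^ 4 \<partial>P) = mom 4 s" by (simp add: hd_sum_def mom_def)
  also have "(\<integral>x. tl_sum x ^ 4 \<partial>P) = mom 4 n" by (simp add: tl_sum_def mom_shift)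
  finally show ?thesis using integral_hd3_tl_le integral_hd2_tl2_le integral_hd_tl3_le by (simp add: algebra_simps)
qed

lemma square_product_le:
  "\<bar>(\<integral>x. (Wsum h (Iv 0 s) x)\<^sup>2 * (Wsum h (Iv 0 (s + n)) x)\<^sup>2 \<partial>P) - mom 4 s - mom 2 s * mom 2 n\<bar>
    \<le> K ^ 4 * sqrt m * (2 * (s * sqrt s) + 4 * (s * sqrt n))"
proof -
  have "Wsum h (Iv 0 (s + n)) x = hd_sum x + tl_sum x" for x
    using Wsum_Iv_add[of h 0 s n x] by (simp add: hd_sum_def tl_sum_def)
  then have "(\<integral>x. (Wsum h (Iv 0 s) x)\<^sup>2 * (Wsum h (Iv 0 (s + n)) x)\<^sup>2 \<partial>P)
      = (\<integral>x. hd_sum x ^ 4 + 2 * (hd_sum x ^ 3 * tl_sum x) + (hd_sum x)\<^sup>2 * (tl_sum x)\<^sup>2 \<partial>P)"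
    unfolding hd_sum_def[symmetric]
    by (intro Bochner_Integration.integral_cong)
       (auto simp: power2_eq_square power3_eq_cube power4_eq_xxxx algebra_simps)
  also have "\<dots> = (\<integral>x. hd_sum x ^ 4 \<partial>P) + 2 * (\<integral>x. hd_sum x ^ 3 * tl_sum x \<partial>P) + (\<integral>x. (hd_sum x)\<^sup>2 * (tl_sum x)\<^sup>2 \<partial>P)"
    by (simp add: bm_integrable bm_mult bm_power bm_split bm_add bm_const)
  also have "(\<integral>x. hd_sum x ^ 4 \<partial>P) = mom 4 s" by (simp add: hd_sum_def mom_def)
  finally show ?thesis using integral_hd3_tl_le integral_hd2_tl2_le by (simp add: algebra_simps)
qed

end

end

context iid_kernel
begin

text \<open>For two equal halves a leading term \<kappa> lrv^2 s^2 of the fourth moment has to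
  satisfy 4\<kappa> = 2\<kappa> + 6, that is \<kappa> = 3: the Gaussian value appears without a
  central limit theorem. Subtracting it leaves an error that obeys the recursion of
  \<open>halving_recursion_bound\<close>.\<close>

lemma mom4_asymp: "\<exists>C\<ge>0. \<forall>n. \<bar>mom 4 n - 3 * lrv\<^sup>2 * (real n)\<^sup>2\<bar> \<le> C * (n * sqrt n)"
proof -
  obtain C2 where C2: "\<And>l. \<bar>mom 2 l - lrv * l\<bar> \<le> C2" using mom2_asymp by blast
  have C2_nonneg: "0 \<le> C2" using C2[of 0] by linarith
  define R where "R = K ^ 4 * sqrt m"
  \<comment> \<open>40 = 4 + 24 + 12 is the coefficient of \<open>mom4_add_le\<close> for equal
    halves; the second part pays for replacing \<open>mom 2 s\<close> by \<open>lrv * s\<close>. The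
    further terms of C serve the odd step: 88 = 16 + 48 + 24 from the lengths 2s and 1, 13 = 1 + 6 *
    2 and 15 = 3 * 5.\<close>
  define A where "A = 40 * R + 6 * C2 * (K\<^sup>2 + lrv)"
  define C where "C = A + 88 * R + 13 * K ^ 4 + 15 * lrv\<^sup>2"
  have nn: "0 \<le> R" "0 \<le> A" "0 \<le> K ^ 4" "0 \<le> lrv\<^sup>2" using K_nonneg lrv_nonneg C2_nonneg by (auto simp: A_def R_def)
  have AC: "A \<le> C" "0 \<le> C" using nn by (auto simp: C_def)
  define e where "e n = mom 4 n - 3 * lrv\<^sup>2 * (real n)\<^sup>2" for n
  have e0: "e 0 = 0" by (simp add: e_def mom_def Iv_def Wsum_def)
  have e1: "\<bar>e 1\<bar> \<le> C"
  proof -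
    have "e 1 = mom 4 1 - 3 * lrv\<^sup>2" "mom 4 1 \<le> K ^ 4" using mom4_bounds(2)[of 1] by (auto simp: e_def)
    then show ?thesis using mom4_bounds(1)[of 1] nn unfolding C_def by linarith
  qed
  have big: "1 \<le> real s * sqrt s" "real s \<le> real s * sqrt s" "sqrt s \<le> real s * sqrt s" if "1 \<le> s" for s :: nat
  proof -
    have s: "1 \<le> real s" "1 \<le> sqrt s" using that by auto
    show "1 \<le> real s * sqrt s" using mult_mono[OF s] s by simp
    show "real s \<le> real s * sqrt s" using mult_left_mono[OF s(2), of "real s"] by simp
    show "sqrt s \<le> real s * sqrt s" using mult_right_mono[OF s(1), of "sqrt s"] by simp
  qed
  have even: "\<bar>e (2 * s) - 2 * e s\<bar> \<le> A * (s * sqrt s)" if s: "1 \<le> s" for s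
  proof -
    have eq: "4 * (s * sqrt s) + 24 * (s * sqrt s) + 12 * (sqrt s * s) = 40 * (s * sqrt s)" by simp
    have a: "\<bar>mom 4 (s + s) - mom 4 s - mom 4 s - 6 * (mom 2 s * mom 2 s)\<bar> \<le> R * (40 * (s * sqrt s))"
      using mom4_add_le[of s s] by (simp only: eq R_def)
    have "(mom 2 s)\<^sup>2 - (lrv * s)\<^sup>2 = (mom 2 s - lrv * s) * (mom 2 s + lrv * s)" by algebra
    then have "\<bar>(mom 2 s)\<^sup>2 - (lrv * s)\<^sup>2\<bar> = \<bar>mom 2 s - lrv * s\<bar> * (mom 2 s + lrv * s)"
      using mom2_bounds(1)[of s] lrv_nonneg by (simp only: abs_mult) simp
    also have "\<dots> \<le> C2 * (K\<^sup>2 * s + lrv * s)"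
      using C2[of s] mom2_bounds[of s] lrv_nonneg by (intro mult_mono) auto
    also have "\<dots> \<le> C2 * (K\<^sup>2 + lrv) * (s * sqrt s)"
      using mult_left_mono[OF big(2)[OF s], of "C2 * (K\<^sup>2 + lrv)"] C2_nonneg lrv_nonneg by (simp add: algebra_simps)
    finally have b: "\<bar>(mom 2 s)\<^sup>2 - (lrv * s)\<^sup>2\<bar> \<le> C2 * (K\<^sup>2 + lrv) * (s * sqrt s)" .
    have aux: "\<bar>x\<bar> \<le> B" if "x = u + 6 * v" "B = p + 6 * q" "\<bar>u\<bar> \<le> p" "\<bar>v\<bar> \<le> q" for x u v B p q :: real
      using that by linarith
    have "e (2 * s) - 2 * e s = (mom 4 (s + s) - mom 4 s - mom 4 s - 6 * (mom 2 s * mom 2 s))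
        + 6 * ((mom 2 s)\<^sup>2 - (lrv * s)\<^sup>2)"
      unfolding e_def mult_2 power2_eq_square of_nat_add by algebra
    moreover have "A * (s * sqrt s) = R * (40 * (s * sqrt s)) + 6 * (C2 * (K\<^sup>2 + lrv) * (s * sqrt s))"
      unfolding A_def by algebra
    ultimately show ?thesis using a b by (rule aux)
  qed
  \<comment> \<open>One extra variable changes the fourth moment by O(s^(3/2)) only, so the odd case
    reduces to the even one.\<close>
  have odd: "\<bar>e (2 * s + 1) - 2 * e s\<bar> \<le> C * (s * sqrt s)" if s: "1 \<le> s" for s
  proof -
    have "\<bar>mom 4 (2 * s + 1) - mom 4 (2 * s) - mom 4 1 - 6 * (mom 2 (2 * s) * mom 2 1)\<bar>
        \<le> R * (4 * (2 * s * sqrt (2 * s)) + 24 * (2 * s) + 12 * sqrt (2 * s))"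
      using mom4_add_le[of "2 * s" 1] by (simp add: R_def)
    also have "\<dots> \<le> R * (4 * (2 * s * (2 * sqrt s)) + 24 * (2 * (s * sqrt s)) + 12 * (2 * (s * sqrt s)))"
    proof -
      have "sqrt 2 \<le> 2" by (rule real_le_lsqrt) auto
      then have le: "sqrt (2 * s) \<le> 2 * sqrt s" by (simp add: real_sqrt_mult mult_right_mono)
      show ?thesis using nn le big[OF s] by (intro mult_left_mono add_mono mult_left_mono) auto
    qed
    also have "\<dots> = 88 * R * (s * sqrt s)" unfolding of_nat_mult of_nat_numeral by algebra
    finally have a: "\<bar>mom 4 (2 * s + 1) - mom 4 (2 * s) - mom 4 1 - 6 * (mom 2 (2 * s) * mom 2 1)\<bar> \<le> 88 * R * (s * sqrt s)" .
    have b: "0 \<le> mom 4 1" "mom 4 1 \<le> K ^ 4 * (s * sqrt s)"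
      using mom4_bounds[of 1] mult_left_mono[OF big(1)[OF s], of "K ^ 4"] nn by auto
    have "mom 2 (2 * s) * mom 2 1 \<le> (K\<^sup>2 * (2 * s)) * K\<^sup>2"
      using mom2_bounds[of "2 * s"] mom2_bounds[of 1] by (intro mult_mono) auto
    also have "\<dots> = 2 * K ^ 4 * s" by (simp add: power2_eq_square power4_eq_xxxx)
    also have "\<dots> \<le> 2 * K ^ 4 * (s * sqrt s)" using big(2)[OF s] nn by (intro mult_left_mono) auto
    finally have c: "0 \<le> mom 2 (2 * s) * mom 2 1" "mom 2 (2 * s) * mom 2 1 \<le> 2 * K ^ 4 * (s * sqrt s)"
      using mom2_bounds by auto
    have "lrv\<^sup>2 * (4 * s + 1) \<le> lrv\<^sup>2 * (5 * (s * sqrt s))"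
      using nn big[OF s] by (intro mult_left_mono) linarith+
    moreover have "0 \<le> lrv\<^sup>2 * (4 * s + 1)" using nn by simp
    moreover have "e (2 * s + 1) - e (2 * s) = mom 4 (2 * s + 1) - mom 4 (2 * s) - 3 * (lrv\<^sup>2 * (4 * s + 1))"
      unfolding e_def power2_eq_square of_nat_add of_nat_mult of_nat_1 of_nat_numeral by algebra
    moreover have "C * (s * sqrt s) = A * (s * sqrt s) + 88 * R * (s * sqrt s) + K ^ 4 * (s * sqrt s)
        + 6 * (2 * K ^ 4 * (s * sqrt s)) + 3 * (lrv\<^sup>2 * (5 * (s * sqrt s)))"
      unfolding C_def by algebra
    ultimately show ?thesis using a b c even[OF s] by linarith
  qed
  have "\<bar>e n\<bar> \<le> 2 * C * (n * sqrt n)" for n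
  proof (rule halving_recursion_bound[OF e0 AC(2) e1 _ odd])
    fix s :: nat assume "1 \<le> s"
    then show "\<bar>e (2 * s) - 2 * e s\<bar> \<le> C * (s * sqrt s)"
      by (intro order_trans[OF even mult_right_mono[OF AC(1)]]) auto
  qed
  then show ?thesis using AC by (intro exI[of _ "2 * C"]) (auto simp: e_def)
qed

text \<open>By \<open>square_product_le\<close> the mixed moment is close to mom4(s) + mom2(s)
  mom2(n). The first term contributes 3 lrv^2 s^2, and passing from mom2(n) to mom2(s + n) in the
  product takes away lrv^2 s^2, which leaves the coefficient 2.\<close>

lemma square_cov_asymp:
  "\<exists>C\<ge>0. \<forall>s n. \<bar>(\<integral>x. (Wsum h (Iv 0 s) x)\<^sup>2 * (Wsum h (Iv 0 (s + n)) x)\<^sup>2 \<partial>P) - mom 2 s * mom 2 (s + n) - 2 * lrv\<^sup>2 * (real s)\<^sup>2\<bar>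
     \<le> C * ((s + n) * sqrt (s + n))"
proof -
  obtain C2 where C2: "\<And>l. \<bar>mom 2 l - lrv * l\<bar> \<le> C2" using mom2_asymp by blast
  have C2_nonneg: "0 \<le> C2" using C2[of 0] by linarith
  obtain C4 where C4: "0 \<le> C4" "\<And>n. \<bar>mom 4 n - 3 * lrv\<^sup>2 * (real n)\<^sup>2\<bar> \<le> C4 * (n * sqrt n)" using mom4_asymp by blast
  define R where "R = K ^ 4 * sqrt m"
  have R: "0 \<le> R" using K_nonneg by (simp add: R_def)
  define B where "B = C2 * (2 * K\<^sup>2 + lrv)"
  have B: "0 \<le> B" using C2_nonneg lrv_nonneg by (simp add: B_def)
  define C where "C = 6 * R + C4 + B"
  have "\<bar>(\<integral>x. (Wsum h (Iv 0 s) x)\<^sup>2 * (Wsum h (Iv 0 (s + n)) x)\<^sup>2 \<partial>P) - mom 2 s * mom 2 (s + n) - 2 * lrv\<^sup>2 * (real s)\<^sup>2\<bar>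
     \<le> C * ((s + n) * sqrt (s + n))" (is "\<bar>?I - _ - _\<bar> \<le> _") for s n
  proof -
    define q where "q = real (s + n) * sqrt (s + n)"
    have q: "s * sqrt s \<le> q" "s * sqrt n \<le> q" by (auto simp: q_def intro!: mult_mono)
    have sq: "real s \<le> q"
    proof (cases "s = 0")
      case False
      then have "1 \<le> sqrt (s + n)" by simp
      then have "real (s + n) * 1 \<le> q" unfolding q_def by (intro mult_left_mono) auto
      then show ?thesis by simp
    qed (simp add: q_def)
    have "R * (2 * (s * sqrt s) + 4 * (s * sqrt n)) \<le> R * (6 * q)"
      using q R by (intro mult_left_mono) auto
    then have 1: "\<bar>?I - mom 4 s - mom 2 s * mom 2 n\<bar> \<le> 6 * R * q"
      using square_product_le[of s n] unfolding R_def[symmetric] by linarith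
    have 2: "\<bar>mom 4 s - 3 * lrv\<^sup>2 * (real s)\<^sup>2\<bar> \<le> C4 * q"
      using C4(2)[of s] mult_left_mono[OF q(1) C4(1)] by linarith
    \<comment> \<open>The second moments grow, but mom2(n) and mom2(s + n) differ by
      \<open>lrv * s\<close> up to 2 C2, so \<open>dl\<close> is bounded.\<close>
    have 3: "\<bar>mom 2 s * (mom 2 n - mom 2 (s + n)) + lrv\<^sup>2 * (real s)\<^sup>2\<bar> \<le> B * q"
    proof -
      define dl where "dl = mom 2 n - mom 2 (s + n) + lrv * s"
      have dl: "\<bar>dl\<bar> \<le> 2 * C2" using C2[of n] C2[of "s + n"] by (simp add: dl_def algebra_simps)
      have "mom 2 s * (mom 2 n - mom 2 (s + n)) + lrv\<^sup>2 * (real s)\<^sup>2 = mom 2 s * dl - lrv * s * (mom 2 s - lrv * s)"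
        by (simp add: dl_def power2_eq_square algebra_simps)
      also have "\<bar>\<dots>\<bar> \<le> mom 2 s * \<bar>dl\<bar> + lrv * s * \<bar>mom 2 s - lrv * s\<bar>"
        using mom2_bounds[of s] lrv_nonneg by (simp add: abs_mult order_trans[OF abs_triangle_ineq4])
      also have "\<dots> \<le> (K\<^sup>2 * s) * (2 * C2) + lrv * s * C2"
        using mom2_bounds[of s] lrv_nonneg dl C2[of s] by (intro add_mono mult_mono) auto
      also have "\<dots> = B * s" by (simp add: B_def algebra_simps)
      also have "\<dots> \<le> B * q" using sq B by (rule mult_left_mono)
      finally show ?thesis .
    qed
    have "\<bar>?I - mom 2 s * mom 2 (s + n) - 2 * lrv\<^sup>2 * (real s)\<^sup>2\<bar> \<le> 6 * R * q + C4 * q + B * q"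
      using 1 2 3 by (simp add: algebra_simps abs_le_iff)
    then show ?thesis by (simp add: C_def q_def algebra_simps)
  qed
  moreover have "0 \<le> C" using R C4 B by (simp add: C_def)
  ultimately show ?thesis by blast
qed

section \<open>Variance of the sum of squares over one block\<close>

definition blk :: "int \<Rightarrow> nat \<Rightarrow> (int \<Rightarrow> 'b) \<Rightarrow> real" where
  "blk a l x = (\<Sum>i=1..l. (Wsum h (Iv a i) x)\<^sup>2)"

lemma bm_blk: "bm (blk a l)"
  unfolding blk_def[abs_def] by (intro bm_sum bm_power bm_Wsum[OF kern])

lemma dep_blk: "dep (\<Union>t\<in>Iv a l. {t - int m<..t}) (blk a l)"
  unfolding blk_def[abs_def]
  by (intro dep_sum dep_power) (rule dep_mono[OF dep_Wsum[OF kern]], rule UN_mono, auto simp: Iv_def)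

definition blkvar :: "nat \<Rightarrow> real" where
  "blkvar l = PP.P.variance (blk 0 l)"

lemma variance_blk: "PP.P.variance (blk a l) = blkvar l"
proof -
  have sh: "blk a l x = blk 0 l (\<lambda>i. x (i + a))" for x
    by (simp add: blk_def Wsum_shift Iv_shift)
  have [measurable]: "blk 0 l \<in> borel_measurable P" by (rule bmD[OF bm_blk])
  have "PP.P.expectation (blk a l) = PP.P.expectation (blk 0 l)"
    unfolding sh[abs_def] by (rule integral_shift) simp
  then show ?thesis
    unfolding blkvar_def sh[abs_def] by (subst integral_shift[of "\<lambda>x. (blk 0 l x - PP.P.expectation (blk 0 l))\<^sup>2", symmetric]) auto
qed

text \<open>The variance is the double sum of the covariances of squared partial sums. The main
  terms give twice the closed form of \<open>sum_min_squares\<close>, and r^2 errors of order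
  r^(3/2) give r^(7/2), which is negligible against r^4.\<close>

lemma blkvar_bound: "\<exists>C\<ge>0. \<forall>r. \<bar>blkvar r - lrv\<^sup>2 * (real r * (real r + 1) * ((real r)\<^sup>2 + real r + 1) / 3)\<bar> \<le> C * (real r ^ 3 * sqrt r)"
proof -
  obtain C where C: "0 \<le> C" and le: "\<And>s n. \<bar>(\<integral>x. (Wsum h (Iv 0 s) x)\<^sup>2 * (Wsum h (Iv 0 (s + n)) x)\<^sup>2 \<partial>P)
      - mom 2 s * mom 2 (s + n) - 2 * lrv\<^sup>2 * (real s)\<^sup>2\<bar> \<le> C * ((s + n) * sqrt (s + n))"
    using square_cov_asymp by blast
  define c where "c s t = (\<integral>x. (Wsum h (Iv 0 s) x)\<^sup>2 * (Wsum h (Iv 0 t) x)\<^sup>2 \<partial>P) - mom 2 s * mom 2 t" for s t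
  have sym: "c s t = c t s" for s t by (simp add: c_def mult.commute)
  have cle: "\<bar>c s t - 2 * lrv\<^sup>2 * (real (min s t))\<^sup>2\<bar> \<le> C * (r * sqrt r)" if "s \<le> r" "t \<le> r" for s t r
  proof -
    have *: "\<bar>c s t - 2 * lrv\<^sup>2 * (real s)\<^sup>2\<bar> \<le> C * (r * sqrt r)" if "s \<le> t" "t \<le> r" for s t
    proof -
      have "\<bar>c s t - 2 * lrv\<^sup>2 * (real s)\<^sup>2\<bar> \<le> C * (t * sqrt t)" using le[of s "t - s"] that by (simp add: c_def)
      also have "\<dots> \<le> C * (r * sqrt r)" using C that by (intro mult_left_mono mult_mono) auto
      finally show ?thesis .
    qed
    show ?thesis using *[of s t] *[of t s] sym[of s t] that by (cases "s \<le> t") (auto simp: min_def)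
  qed
  have "\<bar>blkvar r - lrv\<^sup>2 * (real r * (real r + 1) * ((real r)\<^sup>2 + real r + 1) / 3)\<bar> \<le> C * (real r ^ 3 * sqrt r)" for r
  proof -
    have "blkvar r = (\<Sum>s=1..r. \<Sum>t=1..r. c s t)"
      unfolding blkvar_def blk_def[abs_def] c_def mom_def
      by (rule variance_sum) (intro bm_power bm_Wsum[OF kern])
    moreover have "lrv\<^sup>2 * (real r * (real r + 1) * ((real r)\<^sup>2 + real r + 1) / 3) = (\<Sum>s=1..r. \<Sum>t=1..r. 2 * lrv\<^sup>2 * (real (min s t))\<^sup>2)"
      using sum_min_squares[of r] by (simp add: sum_distrib_left[symmetric])
    ultimately have "\<bar>blkvar r - lrv\<^sup>2 * (real r * (real r + 1) * ((real r)\<^sup>2 + real r + 1) / 3)\<bar>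
        = \<bar>\<Sum>s=1..r. \<Sum>t=1..r. c s t - 2 * lrv\<^sup>2 * (real (min s t))\<^sup>2\<bar>"
      by (simp only: sum_subtractf)
    also have "\<dots> \<le> (\<Sum>s=1..r. \<Sum>t=1..r. C * (r * sqrt r))"
      by (intro order_trans[OF sum_abs] sum_mono order_trans[OF sum_abs] cle) auto
    also have "\<dots> = C * (real r ^ 3 * sqrt r)" by (simp add: power3_eq_cube)
    finally show ?thesis .
  qed
  then show ?thesis using C by blast
qed

lemma blkvar_nonneg: "0 \<le> blkvar l"
  unfolding blkvar_def by (intro integral_nonneg_AE) auto

lemma blkvar_asymp: "(\<lambda>r. blkvar r / real r ^ 4) \<longlonglongrightarrow> lrv\<^sup>2 / 3"
proof -
  obtain C where C: "0 \<le> C" "\<And>r. \<bar>blkvar r - lrv\<^sup>2 * (real r * (real r + 1) * ((real r)\<^sup>2 + real r + 1) / 3)\<bar> \<le> C * (real r ^ 3 * sqrt r)"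
    using blkvar_bound by blast
  define p where "p r = lrv\<^sup>2 * (real r * (real r + 1) * ((real r)\<^sup>2 + real r + 1) / 3)" for r
  have "(\<lambda>r. (blkvar r - p r) / real r ^ 4) \<longlonglongrightarrow> 0"
  proof (rule Lim_null_comparison)
    show "\<forall>\<^sub>F r in sequentially. norm ((blkvar r - p r) / real r ^ 4) \<le> C * (real r ^ 3 * sqrt r / real r ^ 4)"
      using C(2) by (intro always_eventually) (auto simp: p_def intro!: divide_right_mono)
    have "(\<lambda>r. real r ^ 3 * sqrt r / real r ^ 4) \<longlonglongrightarrow> 0" by real_asymp
    then show "(\<lambda>r. C * (real r ^ 3 * sqrt r / real r ^ 4)) \<longlonglongrightarrow> 0" by (rule tendsto_mult_right_zero)
  qed
  moreover have "(\<lambda>r. p r / real r ^ 4) \<longlonglongrightarrow> lrv\<^sup>2 / 3"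
  proof -
    have "(\<lambda>r. real r * (real r + 1) * ((real r)\<^sup>2 + real r + 1) / real r ^ 4) \<longlonglongrightarrow> 1" by real_asymp
    from tendsto_mult_left[OF this, of "lrv\<^sup>2 / 3"] show ?thesis by (simp add: p_def)
  qed
  ultimately have "(\<lambda>r. (blkvar r - p r) / real r ^ 4 + p r / real r ^ 4) \<longlonglongrightarrow> 0 + lrv\<^sup>2 / 3" by (rule tendsto_add)
  then show ?thesis by (simp add: diff_divide_distrib)
qed

end

subsection \<open>Splitting into blocks\<close>

text \<open>Monotone starts admit empty blocks, which rounding can produce; by \<open>kk_eqI\<close>
  the block number \<open>kk i\<close> is nevertheless determined. Block k ends just before
  \<open>b (Suc k)\<close>.\<close>

locale blocks =
  fixes b :: "nat \<Rightarrow> nat" and kk :: "nat \<Rightarrow> nat"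
  assumes mono_b: "mono b" and b0: "b 0 = 1"
    and kk: "\<And>i. 1 \<le> i \<Longrightarrow> b (kk i) \<le> i" "\<And>i. 1 \<le> i \<Longrightarrow> i < b (Suc (kk i))"
begin

lemma b_pos: "1 \<le> b k"
  using monoD[OF mono_b, of 0 k] b0 by simp

lemma kk_eqI: assumes "b k \<le> i" "i < b (Suc k)" shows "kk i = k"
proof -
  have i: "1 \<le> i" using assms(1) b_pos[of k] by linarith
  have "\<not> Suc k \<le> kk i" using monoD[OF mono_b, of "Suc k" "kk i"] kk(1)[OF i] assms by linarith
  moreover have "\<not> Suc (kk i) \<le> k" using monoD[OF mono_b, of "Suc (kk i)" k] kk(2)[OF i] assms by linarith
  ultimately show ?thesis by simp
qed

lemma kk_mono: assumes "1 \<le> i" "i \<le> j" shows "kk i \<le> kk j"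
proof (rule ccontr)
  assume "\<not> kk i \<le> kk j"
  then have "b (Suc (kk j)) \<le> b (kk i)" by (intro monoD[OF mono_b]) simp
  then show False using kk(1)[of i] kk(2)[of j] assms by linarith
qed

text \<open>The range of summation of W_i. \<open>UU\<close> and \<open>FF\<close> separate the
  first m positions of its block from the others, so that for a kernel of range m the
  \<open>FF\<close> parts of different blocks use disjoint sets of innovations.\<close>

definition AA :: "nat \<Rightarrow> int set" where "AA i = {int (b (kk i))..int i}"
definition UU :: "nat \<Rightarrow> nat \<Rightarrow> int set" where "UU m i = AA i \<inter> {..<int (b (kk i) + m)}"
definition FF :: "nat \<Rightarrow> nat \<Rightarrow> int set" where "FF m i = AA i \<inter> {int (b (kk i) + m)..}"

lemma finite_sets: "finite (AA i)" "finite (UU m i)" "finite (FF m i)"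
  and sub: "UU m i \<subseteq> AA i" "FF m i \<subseteq> AA i"
  by (auto simp: AA_def UU_def FF_def)

lemma UF: "AA i = UU m i \<union> FF m i" "UU m i \<inter> FF m i = {}"
  by (auto simp: AA_def UU_def FF_def)

lemma card_UU: "card (UU m i) \<le> m"
proof -
  have "UU m i \<subseteq> {int (b (kk i))..<int (b (kk i) + m)}" by (auto simp: UU_def AA_def)
  from card_mono[OF _ this] show ?thesis by simp
qed

lemma card_AA:
  assumes "\<And>k. k \<le> kk n \<Longrightarrow> b (Suc k) - b k \<le> L" "i \<in> {1..n}"
  shows "card (AA i) \<le> L"
proof -
  have "AA i \<subseteq> int ` {b (kk i)..<b (Suc (kk i))}"
  proof
    fix t assume "t \<in> AA i"
    then show "t \<in> int ` {b (kk i)..<b (Suc (kk i))}"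
      using kk(2)[of i] assms(2) by (intro image_eqI[of _ _ "nat t"]) (auto simp: AA_def)
  qed
  then have "card (AA i) \<le> card (int ` {b (kk i)..<b (Suc (kk i))})" by (intro card_mono) auto
  also have "\<dots> \<le> L" using assms kk_mono[of i n] by (simp add: card_image)
  finally show ?thesis .
qed

text \<open>If t lies in \<open>AA i\<close>, then t and i belong to the same block, so all such i
  come from one block of length at most L.\<close>

lemma card_overlap:
  assumes "\<And>k. k \<le> kk n \<Longrightarrow> b (Suc k) - b k \<le> L"
  shows "card {i\<in>{1..n}. t \<in> AA i} \<le> L"
proof (cases "\<exists>i\<in>{1..n}. t \<in> AA i")
  case True
  then obtain i0 where i0: "i0 \<in> {1..n}" "t \<in> AA i0" by blast
  have "{i\<in>{1..n}. t \<in> AA i} \<subseteq> {b (kk i0)..<b (Suc (kk i0))}"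
  proof
    fix i assume i: "i \<in> {i\<in>{1..n}. t \<in> AA i}"
    have *: "kk j = kk (nat t)" if "j \<in> {1..n}" "t \<in> AA j" for j
      using that kk(2)[of j] by (intro kk_eqI[symmetric]) (auto simp: AA_def)
    have "kk i = kk i0" using *[of i] *[of i0] i i0 by simp
    then show "i \<in> {b (kk i0)..<b (Suc (kk i0))}" using kk[of i] i by auto
  qed
  then have "card {i\<in>{1..n}. t \<in> AA i} \<le> b (Suc (kk i0)) - b (kk i0)"
    using card_mono[of "{b (kk i0)..<b (Suc (kk i0))}"] by simp
  also have "\<dots> \<le> L" using assms kk_mono[of i0 n] i0 by auto
  finally show ?thesis .
next
  case False
  then have "{i\<in>{1..n}. t \<in> AA i} = {}" by blast
  then show ?thesis by (metis card.empty zero_le)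
qed

lemma card_Union_AA: "card (\<Union>i\<in>{1..n}. AA i) \<le> n"
proof -
  have "(\<Union>i\<in>{1..n}. AA i) \<subseteq> int ` {1..n}"
  proof
    fix t assume "t \<in> (\<Union>i\<in>{1..n}. AA i)"
    then obtain i where i: "i \<in> {1..n}" "t \<in> AA i" by blast
    have "1 \<le> t" using i b_pos[of "kk i"] by (auto simp: AA_def)
    then show "t \<in> int ` {1..n}" using i by (intro image_eqI[of _ _ "nat t"]) (auto simp: AA_def)
  qed
  from card_mono[OF _ this] show ?thesis by (simp add: card_image)
qed

lemma card_Union_UU: "card (\<Union>i\<in>{1..n}. UU m i) \<le> m * (kk n + 1)"
proof -
  have "(\<Union>i\<in>{1..n}. UU m i) \<subseteq> (\<Union>k\<le>kk n. {int (b k)..<int (b k + m)})"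
  proof
    fix t assume "t \<in> (\<Union>i\<in>{1..n}. UU m i)"
    then obtain i where i: "i \<in> {1..n}" "t \<in> UU m i" by blast
    then have "kk i \<le> kk n" by (intro kk_mono) auto
    then show "t \<in> (\<Union>k\<le>kk n. {int (b k)..<int (b k + m)})" using i(2) by (auto simp: UU_def AA_def)
  qed
  then have "card (\<Union>i\<in>{1..n}. UU m i) \<le> card (\<Union>k\<le>kk n. {int (b k)..<int (b k + m)})"
    by (intro card_mono) auto
  also have "\<dots> \<le> (\<Sum>k\<le>kk n. card {int (b k)..<int (b k + m)})" by (rule card_UN_le) simp
  finally show ?thesis by (simp add: algebra_simps)
qed

text \<open>The minimum acts on the last block only, which n may end prematurely; all earlier blocks
  are complete.\<close>

lemma sum_blocks:
  fixes F :: "nat \<Rightarrow> real"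
  assumes "1 \<le> n"
  shows "(\<Sum>i=1..n. F i) = (\<Sum>k\<le>kk n. \<Sum>i\<in>{b k..<min (b (Suc k)) (Suc n)}. F i)"
proof -
  have *: "(\<Sum>k<K. \<Sum>i\<in>{b k..<b (Suc k)}. F i) = (\<Sum>i\<in>{1..<b K}. F i)" for K
  proof (induction K)
    case (Suc K)
    then show ?case using sum.atLeastLessThan_concat[of 1 "b K" "b (Suc K)" F] b_pos[of K] monoD[OF mono_b, of K "Suc K"]
      by simp
  qed (simp add: b0)
  have "(\<Sum>k\<le>kk n. \<Sum>i\<in>{b k..<min (b (Suc k)) (Suc n)}. F i)
      = (\<Sum>k<kk n. \<Sum>i\<in>{b k..<min (b (Suc k)) (Suc n)}. F i) + (\<Sum>i\<in>{b (kk n)..<min (b (Suc (kk n))) (Suc n)}. F i)"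
    by (simp add: lessThan_Suc_atMost[symmetric])
  also have "(\<Sum>k<kk n. \<Sum>i\<in>{b k..<min (b (Suc k)) (Suc n)}. F i) = (\<Sum>k<kk n. \<Sum>i\<in>{b k..<b (Suc k)}. F i)"
  proof (rule sum.cong[OF refl])
    fix k assume "k \<in> {..<kk n}"
    then have "b (Suc k) \<le> b (kk n)" by (intro monoD[OF mono_b]) auto
    then show "(\<Sum>i\<in>{b k..<min (b (Suc k)) (Suc n)}. F i) = (\<Sum>i\<in>{b k..<b (Suc k)}. F i)"
      using kk(1)[OF assms] by (simp add: min_def)
  qed
  also have "min (b (Suc (kk n))) (Suc n) = Suc n" using kk(2)[OF assms] by simp
  also have "(\<Sum>k<kk n. \<Sum>i\<in>{b k..<b (Suc k)}. F i) + (\<Sum>i\<in>{b (kk n)..<Suc n}. F i) = (\<Sum>i\<in>{1..<Suc n}. F i)"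
    unfolding * using b_pos[of "kk n"] kk(1)[OF assms] by (intro sum.atLeastLessThan_concat) auto
  finally show ?thesis by (simp add: atLeastLessThanSuc_atLeastAtMost)
qed

end

locale block_kernel = iid_kernel \<mu> h m d \<Delta> + blocks b kk
  for \<mu> :: "'b measure" and h m d \<Delta> b kk
begin

definition VV :: "nat \<Rightarrow> (int \<Rightarrow> 'b) \<Rightarrow> real" where
  "VV n = Qsum h h {1..n} AA AA"

definition VF :: "nat \<Rightarrow> (int \<Rightarrow> 'b) \<Rightarrow> real" where
  "VF n = Qsum h h {1..n} (FF m) (FF m)"

definition len :: "nat \<Rightarrow> nat \<Rightarrow> nat" where
  "len n k = min (b (Suc k)) (Suc n) - b k"

lemma bm_V: "bm (VV n)" "bm (VF n)"
  unfolding VV_def VF_def by (rule bm_Qsum[OF kern kern])+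

text \<open>Difference of squares for each i: the sum over \<open>AA\<close> minus the sum over
  \<open>FF\<close> is the head sum over \<open>UU\<close>, and it multiplies the sum of the
  two.\<close>

lemma V_diff: "VV n x - VF n x = Qsum h h {1..n} (UU m) AA x + Qsum h h {1..n} (UU m) (FF m) x"
proof -
  have "Wsum h (AA i) x = Wsum h (UU m i) x + Wsum h (FF m i) x" for i
    unfolding UF(1)[of i m] by (intro Wsum_union finite_sets UF)
  then show ?thesis
    by (simp add: VV_def VF_def Qsum_def sum_subtractf[symmetric] sum.distrib[symmetric] algebra_simps)
qed

text \<open>In both forms of \<open>V_diff\<close> the first factor has at most m terms, and the
  heads fill at most \<open>m * (kk n + 1)\<close> positions altogether;
  \<open>Qsum_variance_le\<close> is applied with the lengths m and L.\<close>

lemma V_diff_cnrm: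
  assumes L: "\<And>k. k \<le> kk n \<Longrightarrow> b (Suc k) - b k \<le> L"
  shows "cnrm (\<lambda>x. VV n x - VF n x) \<le> 2 * sqrt (288 * (real L * \<Delta> * \<Delta>)\<^sup>2 * (real L * (m * (kk n + 1)) + real m * n))"
proof -
  have one: "cnrm (Qsum h h {1..n} (UU m) B) \<le> sqrt (288 * (real L * \<Delta> * \<Delta>)\<^sup>2 * (real L * (m * (kk n + 1)) + real m * n))"
    if B: "\<And>i. B i \<subseteq> AA i" for B
  proof -
    have fB: "finite (B i)" for i using finite_subset[OF B finite_sets(1)] .
    have cB: "card (B i) \<le> L" if "i \<in> {1..n}" for i
      using card_mono[OF finite_sets(1) B[of i]] card_AA[OF L that] by linarith
    have cU: "card (\<Union>i\<in>{1..n}. B i) \<le> n"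
    proof -
      have "card (\<Union>i\<in>{1..n}. B i) \<le> card (\<Union>i\<in>{1..n}. AA i)"
        using B by (intro card_mono UN_mono) (auto simp: finite_sets)
      then show ?thesis using card_Union_AA[of n] by simp
    qed
    have ov: "card {i\<in>{1..n}. t \<in> C i} \<le> L" if "\<And>i. C i \<subseteq> AA i" for t :: int and C
    proof -
      have "card {i\<in>{1..n}. t \<in> C i} \<le> card {i\<in>{1..n}. t \<in> AA i}"
        using that by (intro card_mono) auto
      then show ?thesis using card_overlap[of n L t, OF L] by linarith
    qed
    have "(cnrm (Qsum h h {1..n} (UU m) B))\<^sup>2 \<le> 288 * (real L * \<Delta> * \<Delta>)\<^sup>2 *
        (real L * card (\<Union>i\<in>{1..n}. UU m i) + real m * card (\<Union>i\<in>{1..n}. B i))"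
      by (intro Qsum_variance_le[OF kern profile kern profile]) (rule finite_atLeastAtMost finite_sets fB card_UU cB ov sub B, assumption?)+
    also have "\<dots> \<le> 288 * (real L * \<Delta> * \<Delta>)\<^sup>2 * (real L * (m * (kk n + 1)) + real m * n)"
      using card_Union_UU[of m n] cU by (intro mult_left_mono add_mono) (auto simp flip: of_nat_mult of_nat_add)
    finally show ?thesis by (rule real_le_rsqrt)
  qed
  have "cnrm (\<lambda>x. VV n x - VF n x) = nrm 2 P (\<lambda>x. (Qsum h h {1..n} (UU m) AA x - (\<integral>x. Qsum h h {1..n} (UU m) AA x \<partial>P))
     + (Qsum h h {1..n} (UU m) (FF m) x - (\<integral>x. Qsum h h {1..n} (UU m) (FF m) x \<partial>P)))"
    unfolding V_diff using bm_Qsum[OF kern kern] by (simp add: bm_integrable algebra_simps)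
  also have "\<dots> \<le> cnrm (Qsum h h {1..n} (UU m) AA) + cnrm (Qsum h h {1..n} (UU m) (FF m))"
    by (intro Lq_add bm_Lq bm_diff bm_const bm_Qsum[OF kern kern]) auto
  finally show ?thesis using one[of AA, OF order_refl] one[of "FF m", OF sub(2)] by linarith
qed

text \<open>Truncated subtraction does the bookkeeping: for i among the first m indices of a block
  \<open>FF m i\<close> is empty and \<open>i + 1 - (b k + m)\<close> is 0; afterwards the length
  grows by one with i.\<close>

lemma VF_blocks:
  assumes "1 \<le> n"
  shows "VF n x = (\<Sum>k\<le>kk n. blk (int (b k + m) - 1) (len n k - m) x)"
proof -
  have "VF n x = (\<Sum>i=1..n. (Wsum h (FF m i) x)\<^sup>2)" by (simp add: VF_def Qsum_def power2_eq_square)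
  also have "\<dots> = (\<Sum>k\<le>kk n. \<Sum>i\<in>{b k..<min (b (Suc k)) (Suc n)}. (Wsum h (FF m i) x)\<^sup>2)"
    by (rule sum_blocks[OF assms])
  also have "\<dots> = (\<Sum>k\<le>kk n. blk (int (b k + m) - 1) (len n k - m) x)"
  proof (rule sum.cong[OF refl])
    fix k assume k: "k \<in> {..kk n}"
    define G where "G r = (Wsum h (Iv (int (b k + m) - 1) r) x)\<^sup>2" for r
    define e where "e = min (b (Suc k)) (Suc n)"
    have "b k \<le> e" using k kk(1)[OF assms] monoD[OF mono_b, of k "Suc k"] monoD[OF mono_b, of k "kk n"] by (auto simp: e_def)
    have "(\<Sum>i\<in>{b k..<e}. (Wsum h (FF m i) x)\<^sup>2) = (\<Sum>i\<in>{b k..<e}. G (i + 1 - (b k + m)))"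
    proof (rule sum.cong[OF refl])
      fix i assume i: "i \<in> {b k..<e}"
      then have "kk i = k" by (intro kk_eqI) (auto simp: e_def)
      then have "FF m i = Iv (int (b k + m) - 1) (i + 1 - (b k + m))"
        by (auto simp: FF_def AA_def Iv_def)
      then show "(Wsum h (FF m i) x)\<^sup>2 = G (i + 1 - (b k + m))" by (simp add: G_def)
    qed
    also have "\<dots> = (\<Sum>r=1..e - b k - m. G r)"
      using \<open>b k \<le> e\<close>
    proof (induction e rule: dec_induct)
      case (step e)
      have G0: "G 0 = 0" by (simp add: G_def Iv_def Wsum_def)
      show ?case
      proof (cases "b k + m \<le> e")
        case True
        then have "Suc e - b k - m = Suc (e - b k - m)" "e + 1 - (b k + m) = Suc (e - b k - m)" by auto
        then show ?thesis using step by simp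
      next
        case False
        then have "Suc e - b k - m = 0" "e - b k - m = 0" "e + 1 - (b k + m) = 0" by auto
        then show ?thesis using step G0 by simp
      qed
    qed simp
    finally show "(\<Sum>i\<in>{b k..<min (b (Suc k)) (Suc n)}. (Wsum h (FF m i) x)\<^sup>2) = blk (int (b k + m) - 1) (len n k - m) x"
      by (simp add: blk_def G_def e_def len_def)
  qed
  finally show ?thesis .
qed

text \<open>Without the heads, indices from different blocks are at least m apart, so the block sums
  are uncorrelated by \<open>W_indep\<close>; by stationarity each variance depends on the length
  alone.\<close>

lemma VF_variance:
  assumes "1 \<le> n"
  shows "(cnrm (VF n))\<^sup>2 = (\<Sum>k\<le>kk n. blkvar (len n k - m))"
proof -
  define B where "B k = blk (int (b k + m) - 1) (len n k - m)" for k
  have ind: "(\<integral>x. B k x * B l x \<partial>P) = (\<integral>x. B k x \<partial>P) * (\<integral>x. B l x \<partial>P)" if "k < l" for k l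
    unfolding B_def
  proof (rule W_indep[OF bm_blk dep_blk bm_blk dep_blk finite_Iv])
    fix s t assume s: "s \<in> Iv (int (b k + m) - 1) (len n k - m)" and t: "t \<in> Iv (int (b l + m) - 1) (len n l - m)"
    have "b (Suc k) \<le> b l" using that by (intro monoD[OF mono_b]) simp
    moreover have "s < int (b (Suc k))" using s by (auto simp: Iv_def len_def)
    moreover have "int (b l) + int m \<le> t" using t by (auto simp: Iv_def)
    ultimately show "s + int m \<le> t" by linarith
  qed
  have "(cnrm (VF n))\<^sup>2 = PP.P.variance (VF n)" by (simp add: nrm_power)
  also have "\<dots> = PP.P.variance (\<lambda>x. \<Sum>k\<le>kk n. B k x)" unfolding VF_blocks[OF assms, abs_def] B_def ..
  also have "\<dots> = (\<Sum>k\<le>kk n. PP.P.variance (B k))"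
  proof (rule variance_sum_uncorrelated)
    fix k l :: nat assume "k \<noteq> l"
    then show "(\<integral>x. B k x * B l x \<partial>P) = (\<integral>x. B k x \<partial>P) * (\<integral>x. B l x \<partial>P)"
      using ind[of k l] ind[of l k] by (cases "k < l") (auto simp: mult.commute)
  qed (auto simp: B_def bm_blk)
  finally show ?thesis by (simp add: B_def variance_blk)
qed

end

subsection \<open>Blocks of polynomially growing length\<close>

text \<open>Averaging in the manner of Stolz and Cesaro: the diverging sum of weights swamps the
  finitely many early terms. The hypothesis compares x with l y instead of forming a quotient, so
  zero weights do no harm.\<close>

lemma weighted_Cesaro:
  fixes x y :: "nat \<Rightarrow> real"
  assumes y: "\<And>k. 0 \<le> y k" "filterlim (\<lambda>K. \<Sum>k<K. y k) at_top sequentially"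
    and x: "\<And>e. 0 < e \<Longrightarrow> eventually (\<lambda>k. \<bar>x k - l * y k\<bar> \<le> e * y k) sequentially"
  shows "(\<lambda>K. (\<Sum>k<K. x k) / (\<Sum>k<K. y k)) \<longlonglongrightarrow> l"
proof (rule LIMSEQ_I)
  fix e :: real assume e: "0 < e"
  define Y where "Y K = (\<Sum>k<K. y k)" for K
  obtain N where N: "\<And>k. N \<le> k \<Longrightarrow> \<bar>x k - l * y k\<bar> \<le> e / 2 * y k"
    using x[of "e / 2"] e by (auto simp: eventually_sequentially)
  define A where "A = (\<Sum>k<N. \<bar>x k - l * y k\<bar>)"
  have "eventually (\<lambda>K. max 1 (2 * A / e + 1) \<le> Y K) sequentially"
    using y(2) unfolding Y_def filterlim_at_top by blast
  moreover have "eventually (\<lambda>K. N \<le> K) sequentially" by (rule eventually_ge_at_top)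
  ultimately have "eventually (\<lambda>K. norm ((\<Sum>k<K. x k) / Y K - l) < e) sequentially"
  proof eventually_elim
    case (elim K)
    have YK: "0 < Y K" "A < e / 2 * Y K" using elim(1) e by (auto simp: field_simps)
    have "(\<Sum>k<K. x k) - l * Y K = (\<Sum>k<K. x k - l * y k)" by (simp add: Y_def sum_subtractf sum_distrib_left)
    also have "\<bar>\<dots>\<bar> \<le> (\<Sum>k<K. \<bar>x k - l * y k\<bar>)" by (rule sum_abs)
    also have "\<dots> = A + (\<Sum>k\<in>{N..<K}. \<bar>x k - l * y k\<bar>)"
      using elim(2) sum.atLeastLessThan_concat[of 0 N K "\<lambda>k. \<bar>x k - l * y k\<bar>"]
      by (simp add: A_def lessThan_atLeast0)
    also have "\<dots> \<le> A + (\<Sum>k\<in>{N..<K}. e / 2 * y k)" using N by (intro add_left_mono sum_mono) auto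
    also have "\<dots> \<le> A + e / 2 * Y K"
      unfolding Y_def sum_distrib_left[symmetric] using e y(1) by (intro add_left_mono mult_left_mono sum_mono2) auto
    finally have "\<bar>(\<Sum>k<K. x k) - l * Y K\<bar> < e * Y K" using YK by linarith
    moreover have "(\<Sum>k<K. x k) / Y K - l = ((\<Sum>k<K. x k) - l * Y K) / Y K" using YK by (simp add: field_simps)
    ultimately show ?case using YK by (simp add: abs_divide divide_simps)
  qed
  then show "\<exists>no. \<forall>K\<ge>no. norm ((\<Sum>k<K. x k) / (\<Sum>k<K. y k) - l) < e"
    by (simp add: eventually_sequentially Y_def)
qed

locale power_blocks =
  fixes c p :: real
  assumes c: "0 < c" and p: "1 < p"
begin

text \<open>Since \<open>0 powr p = 0\<close>, the block start \<open>a\<^sub>0 = 0\<close> may be added to the sequence; starts below \<open>1\<close> are moved to \<open>1\<close>,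
  which matches \<^const>\<open>tblk\<close> and may produce empty blocks.\<close>

definition ak :: "nat \<Rightarrow> int" where "ak k = \<lfloor>c * real k powr p\<rfloor>"
definition bb :: "nat \<Rightarrow> nat" where "bb k = nat (max 1 (ak k))"
definition kb :: "nat \<Rightarrow> nat" where "kb i = (SOME k. bb k \<le> i \<and> i < bb (Suc k))"

lemma mono_ak: "k \<le> l \<Longrightarrow> ak k \<le> ak l"
  unfolding ak_def using c p by (intro floor_mono mult_left_mono powr_mono2) auto

lemma ak_nonneg: "0 \<le> ak k" and ak_0: "ak 0 = 0"
  using c by (auto simp: ak_def)

lemma int_bb: "int (bb k) = max 1 (ak k)"
  by (simp add: bb_def)

lemma mono_bb: "mono bb"
  by (rule monoI) (auto simp: bb_def intro!: nat_mono max.mono mono_ak)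

lemma bb_bounds: "c * real k powr p - 1 < bb k" "bb k \<le> max 1 (c * real k powr p)"
proof -
  have "real_of_int (int (bb k)) = max 1 (of_int (ak k))" unfolding int_bb by (simp add: max_def)
  then have "real (bb k) = max 1 (of_int (ak k))" by simp
  moreover have "c * real k powr p - 1 < of_int (ak k)" "of_int (ak k) \<le> c * real k powr p"
    unfolding ak_def by linarith+
  ultimately show "c * real k powr p - 1 < bb k" "bb k \<le> max 1 (c * real k powr p)" by auto
qed

lemma bb_unbounded: "\<exists>k. i < bb k"
proof -
  have "filterlim (\<lambda>k. c * real k powr p - 1) at_top sequentially" using c p by real_asymp
  then obtain k where "real i \<le> c * real k powr p - 1"
    unfolding filterlim_at_top eventually_sequentially by blast
  then show ?thesis using bb_bounds(1)[of k] by (intro exI[of _ k]) linarith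
qed

lemma kb: assumes "1 \<le> i" shows "bb (kb i) \<le> i" "i < bb (Suc (kb i))"
proof -
  define k where "k = (LEAST k. i < bb k)"
  have k: "i < bb k" unfolding k_def using bb_unbounded[of i] by (rule LeastI_ex)
  have "bb 0 = 1" using ak_0 by (simp add: bb_def)
  then have "k \<noteq> 0" using k assms by (metis less_one not_one_le_zero)
  then obtain j where j: "k = Suc j" by (cases k) auto
  have "bb j \<le> i" using not_less_Least[of j "\<lambda>k. i < bb k"] j by (simp add: k_def)
  then have "\<exists>k. bb k \<le> i \<and> i < bb (Suc k)" using k j by blast
  from someI_ex[OF this] show "bb (kb i) \<le> i" "i < bb (Suc (kb i))" by (auto simp: kb_def)
qed

sublocale blocks bb kb
  by unfold_locales (use mono_bb kb ak_0 in \<open>auto simp: bb_def\<close>)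

text \<open>Where \<open>ak\<close> exceeds 1 it agrees with \<open>bb\<close>, so monotonicity and
  the inequalities for \<open>kb i\<close> select the largest admissible start; starts of at most 1
  are absorbed by the element 1 of the set.\<close>

lemma tblk_eq:
  assumes "1 \<le> i" shows "tblk (\<lambda>k. \<lfloor>c * real k powr p\<rfloor>) i = int (bb (kb i))"
  unfolding tblk_def ak_def[symmetric]
proof (rule Max_eqI)
  have "{ak k |k. 1 \<le> k \<and> ak k \<le> int i} \<subseteq> {0..int i}" using ak_nonneg by auto
  then show "finite ({1} \<union> {ak k |k. 1 \<le> k \<and> ak k \<le> int i})" using finite_subset by auto
next
  fix y assume y: "y \<in> {1} \<union> {ak k |k. 1 \<le> k \<and> ak k \<le> int i}"
  show "y \<le> int (bb (kb i))"
  proof (cases "y \<le> 1")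
    case True
    then show ?thesis by (simp add: int_bb)
  next
    case False
    then obtain k where k: "y = ak k" "ak k \<le> int i" using y by auto
    then have bk: "int (bb k) = ak k" using False by (simp add: int_bb)
    have "\<not> Suc (kb i) \<le> k"
      using monoD[OF mono_bb, of "Suc (kb i)" k] kb(2)[OF assms] bk k by linarith
    then have "bb k \<le> bb (kb i)" by (intro monoD[OF mono_bb]) simp
    then show ?thesis using bk k by simp
  qed
next
  show "int (bb (kb i)) \<in> {1} \<union> {ak k |k. 1 \<le> k \<and> ak k \<le> int i}"
  proof (cases "ak (kb i) \<le> 1")
    case False
    \<comment> \<open>\<open>tblk\<close> admits k \<ge> 1 only; the auxiliary index 0 is excluded
      here because its start is 0.\<close>
    then have "kb i \<noteq> 0" using ak_0 by (metis zero_le_one)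
    moreover have "int (bb (kb i)) = ak (kb i)" using False by (simp add: int_bb)
    moreover have "ak (kb i) \<le> int i" using kb(1)[OF assms] calculation by linarith
    ultimately show ?thesis by auto
  qed (simp add: int_bb)
qed

definition bl :: "nat \<Rightarrow> nat" where "bl k = bb (Suc k) - bb k"

text \<open>Taking integer parts changes the difference of two starts by at most 1, negligible
  against k^(p-1); the unrounded difference grows like the derivative c p k^(p-1).\<close>

lemma bl_asymp: "(\<lambda>k. real (bl k) / real k powr (p - 1)) \<longlonglongrightarrow> c * p"
proof -
  define f where "f k = c * real (Suc k) powr p - c * real k powr p" for k
  \<comment> \<open>For such k the maximum with 1 in \<open>bb\<close> is inactive.\<close>
  have "eventually (\<lambda>k. 1 \<le> c * real k powr p) sequentially" using c p by real_asymp
  then have close: "eventually (\<lambda>k. \<bar>(real (bl k) - f k) / real k powr (p - 1)\<bar> \<le> 1 / real k powr (p - 1)) sequentially"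
  proof eventually_elim
    case (elim k)
    have "real k powr p \<le> real (Suc k) powr p" using p by (intro powr_mono2) auto
    then have S: "1 \<le> c * real (Suc k) powr p" using elim c by (smt (verit) mult_left_mono)
    have "real (bl k) = real (bb (Suc k)) - real (bb k)"
      using monoD[OF mono_bb, of k "Suc k"] by (simp add: bl_def of_nat_diff)
    then have "\<bar>real (bl k) - f k\<bar> \<le> 1"
      using bb_bounds[of k] bb_bounds[of "Suc k"] elim S unfolding f_def by linarith
    then show ?case by (simp add: divide_right_mono)
  qed
  have "(\<lambda>k. 1 / real k powr (p - 1)) \<longlonglongrightarrow> 0" using p by real_asymp
  then have "(\<lambda>k. (real (bl k) - f k) / real k powr (p - 1)) \<longlonglongrightarrow> 0"
    using Lim_null_comparison[OF close[folded real_norm_def]] by blast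
  moreover have "(\<lambda>k. f k / real k powr (p - 1)) \<longlonglongrightarrow> c * p"
  proof -
    have "(\<lambda>k. ((real k + 1) powr p - real k powr p) / real k powr (p - 1)) \<longlonglongrightarrow> p"
      using p by real_asymp
    from tendsto_mult_left[OF this, of c] show ?thesis
      by (simp add: f_def right_diff_distrib add.commute)
  qed
  ultimately have "(\<lambda>k. (real (bl k) - f k) / real k powr (p - 1) + f k / real k powr (p - 1)) \<longlonglongrightarrow> 0 + c * p"
    by (rule tendsto_add)
  then show ?thesis by (simp add: diff_divide_distrib)
qed

lemma kb_bounds:
  assumes "1 \<le> n"
  shows "(real n / c) powr (1 / p) - 1 \<le> kb n" "kb n \<le> ((real n + 1) / c) powr (1 / p)"
proof -
  have inv: "(x powr p) powr (1 / p) = x" if "0 \<le> x" for x :: real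
    using that p by (simp add: powr_powr)
  have "real n < bb (Suc (kb n))" using kb(2)[OF assms] by simp
  also have "\<dots> \<le> max 1 (c * real (Suc (kb n)) powr p)" by (rule bb_bounds)
  finally have "real n / c \<le> real (Suc (kb n)) powr p" using assms c by (auto simp: max_def field_simps split: if_splits)
  then have "(real n / c) powr (1 / p) \<le> (real (Suc (kb n)) powr p) powr (1 / p)"
    using c p by (intro powr_mono2) auto
  also have "\<dots> = real (Suc (kb n))" by (rule inv) simp
  finally show "(real n / c) powr (1 / p) - 1 \<le> kb n" by simp
  have "c * real (kb n) powr p - 1 < n" using bb_bounds(1)[of "kb n"] kb(1)[OF assms] by linarith
  then have "real (kb n) powr p \<le> (real n + 1) / c" using c by (simp add: field_simps)
  then have "(real (kb n) powr p) powr (1 / p) \<le> ((real n + 1) / c) powr (1 / p)"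
    using p by (intro powr_mono2) auto
  then show "kb n \<le> ((real n + 1) / c) powr (1 / p)" by (simp add: inv)
qed

lemma kb_asymp: "(\<lambda>n. real (kb n) / real n powr (1 / p)) \<longlonglongrightarrow> c powr (- 1 / p)"
proof -
  have eq: "inverse c powr (1 / p) = c powr (- 1 / p)" using c by (simp add: inverse_powr powr_minus)
  show ?thesis
    unfolding eq[symmetric]
  proof (rule tendsto_sandwich)
    show "\<forall>\<^sub>F n in sequentially. ((real n / c) powr (1 / p) - 1) / real n powr (1 / p) \<le> real (kb n) / real n powr (1 / p)"
      using kb_bounds(1) by (intro eventually_sequentiallyI[of 1] divide_right_mono) auto
    show "\<forall>\<^sub>F n in sequentially. real (kb n) / real n powr (1 / p) \<le> ((real n + 1) / c) powr (1 / p) / real n powr (1 / p)"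
      using kb_bounds(2) by (intro eventually_sequentiallyI[of 1] divide_right_mono) auto
    show "(\<lambda>n. ((real n / c) powr (1 / p) - 1) / real n powr (1 / p)) \<longlonglongrightarrow> inverse c powr (1 / p)"
      using c p by real_asymp
    show "(\<lambda>n. ((real n + 1) / c) powr (1 / p) / real n powr (1 / p)) \<longlonglongrightarrow> inverse c powr (1 / p)"
      using c p by real_asymp
  qed
qed

lemma kb_at_top: "filterlim kb at_top sequentially"
proof -
  have "filterlim (\<lambda>n. (real n / c) powr (1 / p) - 1) at_top sequentially" using c p by real_asymp
  then have "filterlim (\<lambda>n. real (kb n)) at_top sequentially"
    by (rule filterlim_at_top_mono) (auto intro!: eventually_sequentiallyI[of 1] kb_bounds(1))
  then show ?thesis by (simp add: filterlim_sequentially_iff_filterlim_real)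
qed

lemma (in -) bounded_quotient:
  fixes x y :: "nat \<Rightarrow> real"
  assumes "(\<lambda>k. x k / y k) \<longlonglongrightarrow> l" "\<And>k. 1 \<le> k \<Longrightarrow> 0 < y k"
  shows "\<exists>C>0. \<forall>k\<ge>1. x k \<le> C * y k"
proof -
  have "Bseq (\<lambda>k. x k / y k)" using assms(1) convergent_imp_Bseq convergent_def by blast
  then obtain C where C: "0 < C" "\<And>k. norm (x k / y k) \<le> C" by (auto elim: BseqE)
  have "x k \<le> C * y k" if "1 \<le> k" for k
  proof -
    have "x k / y k \<le> C" using C(2)[of k] unfolding real_norm_def by linarith
    then show ?thesis using assms(2)[OF that] by (simp add: divide_simps)
  qed
  then show ?thesis using C(1) by blast
qed

lemma bl_bound: "\<exists>C>0. \<forall>n\<ge>1. \<forall>k\<le>kb n. real (bl k) \<le> C * real n powr (1 - 1 / p)"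
proof -
  obtain C1 where C1: "0 < C1" "\<And>k. 1 \<le> k \<Longrightarrow> real (bl k) \<le> C1 * real k powr (p - 1)"
    using bounded_quotient[OF bl_asymp] by auto
  obtain C2 where C2: "0 < C2" "\<And>n. 1 \<le> n \<Longrightarrow> real (kb n) \<le> C2 * real n powr (1 / p)"
    using bounded_quotient[OF kb_asymp] by auto
  \<comment> \<open>\<open>bl 0\<close> is added because \<open>0 powr (p - 1)\<close> is 0 and
    bounds nothing for the first block.\<close>
  define C where "C = C1 * C2 powr (p - 1) + real (bl 0)"
  have pp: "(real n powr (1 / p)) powr (p - 1) = real n powr (1 - 1 / p)" for n
    using p by (simp add: powr_powr field_simps)
  have "real (bl k) \<le> C * real n powr (1 - 1 / p)" if n: "1 \<le> n" and k: "k \<le> kb n" for n k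
  proof (cases "k = 0")
    case True
    have "1 \<le> real n powr (1 - 1 / p)" using n p by (intro ge_one_powr_ge_zero) auto
    then have "real (bl 0) * 1 \<le> real (bl 0) * real n powr (1 - 1 / p)" by (intro mult_left_mono) auto
    also have "\<dots> \<le> C * real n powr (1 - 1 / p)" using C1 C2 by (intro mult_right_mono) (auto simp: C_def)
    finally show ?thesis using True by simp
  next
    case False
    then have "real (bl k) \<le> C1 * real k powr (p - 1)" using C1(2) by simp
    also have "\<dots> \<le> C1 * (C2 * real n powr (1 / p)) powr (p - 1)"
      using C1 C2(2)[OF n] k p by (intro mult_left_mono powr_mono2) auto
    also have "\<dots> = C1 * C2 powr (p - 1) * real n powr (1 - 1 / p)"
      using C2 by (simp add: powr_mult pp)
    also have "\<dots> \<le> C * real n powr (1 - 1 / p)" by (intro mult_right_mono) (auto simp: C_def)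
    finally show ?thesis .
  qed
  moreover have "0 < C" using C1 C2 by (simp add: C_def add_pos_nonneg)
  ultimately show ?thesis by blast
qed

text \<open>The comparison weights are the increments of k^q with q = 4p - 3: their sums telescope
  to K^q, and they behave like q k^(4(p-1)), the order of the fourth power of the block length.
  Averaging gives s (c p)^4 / q times K^q, and K = \<open>kb n\<close>, about (n/c)^(1/p),
  contributes n^(4 - 3/p) and c^(3/p - 4).\<close>

lemma block_sum_asymp:
  fixes v :: "nat \<Rightarrow> real"
  assumes v: "(\<lambda>r. v r / real r ^ 4) \<longlonglongrightarrow> s"
  shows "(\<lambda>n. (\<Sum>k<kb n. v (bl k - m)) / real n powr (4 - 3 / p)) \<longlonglongrightarrow> s * c powr (3 / p) * p ^ 4 / (4 * p - 3)"
proof -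
  define q where "q = 4 * p - 3"
  have q: "1 < q" using p by (simp add: q_def)
  define y where "y k = real (Suc k) powr q - real k powr q" for k
  have sum_y: "(\<Sum>k<K. y k) = real K powr q" for K
    unfolding y_def by (subst sum_lessThan_telescope) simp
  have bl: "(\<lambda>k. real (bl k - m) / real k powr (p - 1)) \<longlonglongrightarrow> c * p"
  proof (rule tendsto_sandwich)
    have "(\<lambda>k. real m / real k powr (p - 1)) \<longlonglongrightarrow> 0" using p by real_asymp
    from tendsto_diff[OF bl_asymp this]
    show "(\<lambda>k. real (bl k) / real k powr (p - 1) - real m / real k powr (p - 1)) \<longlonglongrightarrow> c * p" by simp
    show "(\<lambda>k. real (bl k) / real k powr (p - 1)) \<longlonglongrightarrow> c * p" by (rule bl_asymp)
  qed (auto intro!: always_eventually divide_right_mono simp flip: diff_divide_distrib)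
  have cp: "0 < c * p" using c p by simp
  have bl_top: "filterlim (\<lambda>k. bl k - m) at_top sequentially"
  proof -
    have "filterlim (\<lambda>k. real k powr (p - 1)) at_top sequentially" using p by real_asymp
    from filterlim_tendsto_pos_mult_at_top[OF bl cp this]
    have "filterlim (\<lambda>k. real (bl k - m) / real k powr (p - 1) * real k powr (p - 1)) at_top sequentially" .
    then have "filterlim (\<lambda>k. real (bl k - m)) at_top sequentially"
      by (rule filterlim_mono_eventually[OF _ order_refl order_refl]) (rule eventually_sequentiallyI[of 1], simp)
    then show ?thesis by (simp add: filterlim_sequentially_iff_filterlim_real)
  qed
  define l where "l = s * (c * p) ^ 4 / q"
  have ratio: "(\<lambda>k. v (bl k - m) / y k) \<longlonglongrightarrow> l"
  proof -
    have "(\<lambda>k. v (bl k - m) / real (bl k - m) ^ 4) \<longlonglongrightarrow> s"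
      using filterlim_compose[OF v bl_top] .
    moreover have "(\<lambda>k. (real (bl k - m) / real k powr (p - 1)) ^ 4) \<longlonglongrightarrow> (c * p) ^ 4"
      by (intro tendsto_power bl)
    moreover have "(\<lambda>k. (real k powr (p - 1)) ^ 4 / y k) \<longlonglongrightarrow> 1 / q"
    proof -
      have "(\<lambda>k. (real k powr (p - 1)) ^ 4 / ((real k + 1) powr (4 * p - 3) - real k powr (4 * p - 3)))
          \<longlonglongrightarrow> inverse (4 * p - 3)" using p by real_asymp
      then show ?thesis by (simp add: y_def q_def inverse_eq_divide add.commute)
    qed
    ultimately have "(\<lambda>k. v (bl k - m) / real (bl k - m) ^ 4 * (real (bl k - m) / real k powr (p - 1)) ^ 4 * ((real k powr (p - 1)) ^ 4 / y k)) \<longlonglongrightarrow> s * (c * p) ^ 4 * (1 / q)"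
      by (intro tendsto_mult)
    moreover have "eventually (\<lambda>k. v (bl k - m) / real (bl k - m) ^ 4 * (real (bl k - m) / real k powr (p - 1)) ^ 4 * ((real k powr (p - 1)) ^ 4 / y k) = v (bl k - m) / y k) sequentially"
      using eventually_ge_at_top[of 1] bl_top[unfolded filterlim_at_top, rule_format, of 1]
      by eventually_elim (simp add: power_divide)
    ultimately show ?thesis unfolding l_def by (simp cong: filterlim_cong)
  qed
  have y_pos: "0 < y k" for k using q by (auto simp: y_def intro!: powr_less_mono2)
  have ces: "(\<lambda>K. (\<Sum>k<K. v (bl k - m)) / (\<Sum>k<K. y k)) \<longlonglongrightarrow> l"
  proof (rule weighted_Cesaro)
    show "0 \<le> y k" for k using y_pos[of k] by simp
    show "filterlim (\<lambda>K. \<Sum>k<K. y k) at_top sequentially" unfolding sum_y using q by real_asymp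
    fix e :: real assume "0 < e"
    then have "eventually (\<lambda>k. \<bar>v (bl k - m) / y k - l\<bar> < e) sequentially"
      using ratio by (auto simp: tendsto_iff dist_real_def)
    then show "eventually (\<lambda>k. \<bar>v (bl k - m) - l * y k\<bar> \<le> e * y k) sequentially"
    proof eventually_elim
      case (elim k)
      have "v (bl k - m) - l * y k = (v (bl k - m) / y k - l) * y k" using y_pos[of k] by (simp add: field_simps)
      then show ?case using elim y_pos[of k] by (simp add: abs_mult)
    qed
  qed
  have "(\<lambda>n. (\<Sum>k<kb n. v (bl k - m)) / real (kb n) powr q) \<longlonglongrightarrow> l"
    using filterlim_compose[OF ces kb_at_top] by (simp add: sum_y)
  moreover have "(\<lambda>n. (real (kb n) / real n powr (1 / p)) powr q) \<longlonglongrightarrow> (c powr (- 1 / p)) powr q"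
    using c by (intro tendsto_powr kb_asymp tendsto_const) auto
  ultimately have "(\<lambda>n. (\<Sum>k<kb n. v (bl k - m)) / real (kb n) powr q * (real (kb n) / real n powr (1 / p)) powr q) \<longlonglongrightarrow> l * (c powr (- 1 / p)) powr q"
    by (rule tendsto_mult)
  moreover have "eventually (\<lambda>n. (\<Sum>k<kb n. v (bl k - m)) / real (kb n) powr q * (real (kb n) / real n powr (1 / p)) powr q
      = (\<Sum>k<kb n. v (bl k - m)) / real n powr (4 - 3 / p)) sequentially"
    using eventually_ge_at_top[of 1] kb_at_top[unfolded filterlim_at_top, rule_format, of 1]
  proof eventually_elim
    case (elim n)
    have "(1 / p) * q = 4 - 3 / p" using p by (simp add: q_def field_simps)
    then have "(real (kb n) / real n powr (1 / p)) powr q = real (kb n) powr q / real n powr (4 - 3 / p)"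
      by (simp add: powr_divide powr_powr)
    then show ?case using elim by simp
  qed
  moreover have "l * (c powr (- 1 / p)) powr q = s * c powr (3 / p) * p ^ 4 / (4 * p - 3)"
  proof -
    have "(- 1 / p) * q = 3 / p - 4" using p by (simp add: q_def field_simps)
    then have "(c powr (- 1 / p)) powr q = c powr (3 / p - 4)" by (simp only: powr_powr)
    also have "\<dots> = c powr (3 / p) / c ^ 4" using c by (simp add: powr_diff)
    finally show ?thesis using c by (simp add: l_def q_def power_mult_distrib)
  qed
  ultimately show ?thesis by (simp cong: filterlim_cong)
qed

end

context iid_seq
begin

lemma nrm_centered_triangle:
  assumes "bm f" "bm g"
  shows "\<bar>cnrm f - cnrm g\<bar>
    \<le> nrm 2 P (\<lambda>x. (f x - g x) - (\<integral>x. f x - g x \<partial>P))"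
proof -
  have "\<bar>cnrm f - cnrm g\<bar>
      \<le> nrm 2 P (\<lambda>x. (f x - (\<integral>x. f x \<partial>P)) - (g x - (\<integral>x. g x \<partial>P)))"
    using assms by (intro nrm_triangle_rev bm_Lq bm_diff bm_const) auto
  also have "(\<lambda>x. (f x - (\<integral>x. f x \<partial>P)) - (g x - (\<integral>x. g x \<partial>P))) = (\<lambda>x. (f x - g x) - (\<integral>x. f x - g x \<partial>P))"
    using assms by (auto simp: bm_integrable)
  finally show ?thesis .
qed

subsection \<open>Projections and the long-run variance\<close>

text \<open>Integrates out the innovations 1, ..., i. On functions of the innovations up to time i
  this is the conditional expectation given F_0.\<close>

fun avgs :: "nat \<Rightarrow> ((int \<Rightarrow> 'b) \<Rightarrow> real) \<Rightarrow> (int \<Rightarrow> 'b) \<Rightarrow> real" where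
  "avgs 0 f = f"
| "avgs (Suc i) f = avgs i (avg (int (Suc i)) f)"

lemma bm_avgs: "bm f \<Longrightarrow> bm (avgs i f)"
  by (induction i arbitrary: f) (auto intro: bm_avg)

lemma avgs_cong:
  "(\<And>x. x \<in> space P \<Longrightarrow> f x = g x) \<Longrightarrow> x \<in> space P \<Longrightarrow> avgs i f x = avgs i g x"
proof (induction i arbitrary: f g)
  case (Suc i)
  have "avg (int (Suc i)) f x = avg (int (Suc i)) g x" if "x \<in> space P" for x
    using Suc.prems(1) that by (rule avg_cong)
  then show ?case using Suc.IH[of "avg (int (Suc i)) f" "avg (int (Suc i)) g"] Suc.prems(2) by simp
qed simp

lemma avgs_diff:
  "bm f \<Longrightarrow> bm g \<Longrightarrow> x \<in> space P \<Longrightarrow> avgs i (\<lambda>x. f x - g x) x = avgs i f x - avgs i g x"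
proof (induction i arbitrary: f g)
  case (Suc i)
  have "avgs (Suc i) (\<lambda>x. f x - g x) x = avgs i (\<lambda>x. avg (int (Suc i)) f x - avg (int (Suc i)) g x) x"
    unfolding avgs.simps using Suc.prems by (intro avgs_cong avg_diff)
  then show ?case using Suc.IH[of "avg (int (Suc i)) f" "avg (int (Suc i)) g"] Suc.prems by (simp add: bm_avg)
qed simp

lemma avgs_avg:
  "bm f \<Longrightarrow> x \<in> space P \<Longrightarrow> avgs i (avg j f) x = avg j (avgs i f) x"
proof (induction i arbitrary: f)
  case (Suc i)
  have "avgs (Suc i) (avg j f) x = avgs i (avg j (avg (int (Suc i)) f)) x"
    unfolding avgs.simps using Suc.prems by (intro avgs_cong avg_commute)
  then show ?case using Suc.IH[of "avg (int (Suc i)) f"] Suc.prems by (simp add: bm_avg)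
qed simp

lemma nrm_avgs_le: "bm f \<Longrightarrow> even q \<Longrightarrow> 0 < q \<Longrightarrow> nrm q P (avgs i f) \<le> nrm q P f"
proof (induction i arbitrary: f)
  case (Suc i)
  show ?case
    using Suc.IH[of "avg (int (Suc i)) f"] nrm_avg_le[of f q "int (Suc i)"] Suc.prems by (simp add: bm_avg)
qed simp

lemma integral_mult_avgs:
  "bm f \<Longrightarrow> bm g \<Longrightarrow> (\<And>j. 1 \<le> j \<Longrightarrow> j \<le> int i \<Longrightarrow> free j g) \<Longrightarrow>
    (\<integral>x. g x * avgs i f x \<partial>P) = (\<integral>x. g x * f x \<partial>P)"
proof (induction i arbitrary: f)
  case (Suc i)
  show ?case
    using Suc.IH[of "avg (int (Suc i)) f"] integral_free_avg[of f g "int (Suc i)"] Suc.prems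
    by (simp add: bm_avg)
qed simp

lemma dep_avgs: "dep (J \<union> {1..int i}) f \<Longrightarrow> dep J (avgs i f)"
proof (induction i arbitrary: f)
  case (Suc i)
  have "J \<union> {1..int (Suc i)} = insert (int (Suc i)) (J \<union> {1..int i})" by auto
  then show ?case using Suc.IH[of "avg (int (Suc i)) f"] dep_avg[of "int (Suc i)" "J \<union> {1..int i}" f] Suc.prems by simp
qed simp

lemma avg_shift: "avg j f (\<lambda>i. x (i + s)) = avg (j + s) (\<lambda>x. f (\<lambda>i. x (i + s))) x"
proof -
  have "(\<lambda>i. x (i + s))(j := y) = (\<lambda>i. (x(j + s := y)) (i + s))" for y by auto
  then show ?thesis by (simp add: avg_def)
qed

text \<open>Averaging the coordinates 1, ..., i+1 of the moved path is averaging 0, ..., i of the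
  original one. In this way E(X_i | F_{-1}) becomes a time shift of E(X_{i+1} | F_0).\<close>

lemma avgs_shift: "avgs (Suc i) f (\<lambda>i. x (i - 1)) = avg 0 (avgs i (\<lambda>x. f (\<lambda>i. x (i - 1)))) x"
proof (induction i arbitrary: f x)
  case 0
  then show ?case using avg_shift[of 1 f x "-1"] by simp
next
  case (Suc i)
  have "(\<lambda>x. avg (int (Suc (Suc i))) f (\<lambda>i. x (i - 1))) = avg (int (Suc i)) (\<lambda>x. f (\<lambda>i. x (i - 1)))"
    using avg_shift[of "int (Suc (Suc i))" f _ "-1"] by (simp add: fun_eq_iff)
  then show ?case using Suc.IH[of "avg (int (Suc (Suc i))) f" x] by simp
qed

text \<open>\<open>proj0 h i\<close> is \<open>\<P>\<^sub>0 X\<^sub>i\<close> on the canonical space.\<close>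

definition G0 :: "((nat \<Rightarrow> 'b) \<Rightarrow> real) \<Rightarrow> nat \<Rightarrow> (int \<Rightarrow> 'b) \<Rightarrow> real" where
  "G0 h i = avgs i (Xp h (int i))"

definition proj0 :: "((nat \<Rightarrow> 'b) \<Rightarrow> real) \<Rightarrow> nat \<Rightarrow> (int \<Rightarrow> 'b) \<Rightarrow> real" where
  "proj0 h i x = G0 h i x - avg 0 (G0 h i) x"

text \<open>The partial-sum norms from the definition of \<sigma>, on the canonical space.\<close>

definition sproj :: "((nat \<Rightarrow> 'b) \<Rightarrow> real) \<Rightarrow> nat \<Rightarrow> real" where
  "sproj h n = nrm 2 P (\<lambda>x. \<Sum>i\<le>n. proj0 h i x)"

lemma bm_G0: "kern m h \<Longrightarrow> bm (G0 h i)"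
  unfolding G0_def by (intro bm_avgs bm_Xp)

lemma bm_proj0: "kern m h \<Longrightarrow> bm (proj0 h i)"
  unfolding proj0_def[abs_def] by (intro bm_diff bm_avg bm_G0)

text \<open>Averaging over coordinate 0 commutes with averaging over 1, ..., i. The projection is
  therefore an average of X_i minus its mean over innovation 0, and contraction leaves the influence
  of innovation 0 on X_i.\<close>

lemma nrm_proj0_le:
  assumes "kern m h" "profile h d \<Delta>"
  shows "nrm 2 P (proj0 h i) \<le> d (int i)"
proof -
  have X: "bm (Xp h (int i))" using assms(1) by (rule bm_Xp)
  have "nrm 2 P (proj0 h i) = nrm 2 P (avgs i (\<lambda>x. Xp h (int i) x - avg 0 (Xp h (int i)) x))"
    unfolding proj0_def[abs_def] G0_def by (intro nrm_cong) (simp add: avgs_diff avgs_avg X bm_avg)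
  also have "\<dots> \<le> nrm 2 P (\<lambda>x. Xp h (int i) x - avg 0 (Xp h (int i)) x)"
    by (intro nrm_avgs_le bm_diff bm_avg X) auto
  also have "\<dots> \<le> infl 4 0 (Xp h (int i))"
    unfolding infl_def by (intro PP.P.Lq_4_2 bm_Lq bm_diff bm_avg X)
  also have "\<dots> \<le> d (int i)" using profile_infl[OF assms(2), of 0 "int i"] by simp
  finally show ?thesis .
qed

lemma proj0_diff:
  assumes "kern m u" "kern m v" "x \<in> space P"
  shows "proj0 (\<lambda>x. u x - v x) i x = proj0 u i x - proj0 v i x"
proof -
  have G: "G0 (\<lambda>x. u x - v x) i x = G0 u i x - G0 v i x" if "x \<in> space P" for x
    unfolding G0_def using that bm_Xp[OF assms(1)] bm_Xp[OF assms(2)]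
    by (simp add: avgs_diff[symmetric] Xp_diff[abs_def])
  have "avg 0 (G0 (\<lambda>x. u x - v x) i) x = avg 0 (\<lambda>x. G0 u i x - G0 v i x) x"
    using assms(3) G by (intro avg_cong)
  also have "\<dots> = avg 0 (G0 u i) x - avg 0 (G0 v i) x"
    using assms(3) bm_G0[OF assms(1)] bm_G0[OF assms(2)] by (intro avg_diff)
  finally show ?thesis using G[OF assms(3)] by (simp add: proj0_def)
qed

text \<open>The projections are linear in the kernel, and each is bounded by the coefficient at its
  lag. The bound does not involve n, which later allows the limit in n to be exchanged with the
  approximation of the kernel.\<close>

lemma sproj_diff_le:
  assumes u: "kern m u" and v: "kern m v" and p: "profile (\<lambda>x. u x - v x) d \<Delta>"
  shows "\<bar>sproj u n - sproj v n\<bar> \<le> \<Delta>"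
proof -
  have k: "kern m (\<lambda>x. u x - v x)" by (rule kern_add_diff[OF u v])
  have "\<bar>sproj u n - sproj v n\<bar> \<le> nrm 2 P (\<lambda>x. (\<Sum>i\<le>n. proj0 u i x) - (\<Sum>i\<le>n. proj0 v i x))"
    unfolding sproj_def by (intro nrm_triangle_rev bm_Lq bm_sum bm_proj0[OF u] bm_proj0[OF v]) auto
  also have "\<dots> = nrm 2 P (\<lambda>x. \<Sum>i\<le>n. proj0 (\<lambda>x. u x - v x) i x)"
    by (intro nrm_cong) (simp add: proj0_diff[OF u v] sum_subtractf)
  also have "\<dots> \<le> (\<Sum>i\<le>n. nrm 2 P (proj0 (\<lambda>x. u x - v x) i))"
    by (intro Lq_sum bm_Lq bm_proj0[OF k]) auto
  also have "\<dots> \<le> (\<Sum>i\<le>n. d (int i))" by (intro sum_mono nrm_proj0_le[OF k p])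
  also have "\<dots> = sum d (int ` {..n})" by (simp add: sum.reindex)
  also have "\<dots> \<le> \<Delta>" by (intro profile_sum[OF p]) auto
  finally show ?thesis .
qed

end

context iid_kernel
begin

text \<open>The expectation of E(X_i | F_0) E(X_k | F_0); row 0 consists of the
  autocovariances.\<close>

definition cG :: "nat \<Rightarrow> nat \<Rightarrow> real" where
  "cG i k = (\<integral>x. G0 h i x * G0 h k x \<partial>P)"

lemma bm_G: "bm (G0 h i)"
  by (rule bm_G0[OF kern])

lemma cG_sym: "cG i k = cG k i"
  by (simp add: cG_def mult.commute)

lemma cG_0: "cG 0 k = acov h k"
proof -
  have "dep {0 - int m<..0} (Xp h 0)" by (rule dep_Xp[OF kern])
  then have "\<And>j. 1 \<le> j \<Longrightarrow> free j (Xp h 0)" by (rule dep_free) auto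
  then show ?thesis
    unfolding cG_def G0_def acov_def using integral_mult_avgs[of "Xp h (int k)" "Xp h 0" k] bm_Xp[OF kern] by simp
qed

lemma G0_zero:
  assumes "m \<le> i" "x \<in> space P" shows "G0 h i x = 0"
proof -
  have X: "bm (Xp h (int i))" by (rule bm_Xp[OF kern])
  have "dep {1..int i} (Xp h (int i))" using assms by (intro dep_mono[OF dep_Xp[OF kern]]) auto
  then have "dep {} (G0 h i)" unfolding G0_def by (intro dep_avgs) simp
  then have "G0 h i x = (\<integral>x. G0 h i x \<partial>P)" using assms(2) by (rule dep_empty)
  also have "\<dots> = (\<integral>x. Xp h (int i) x \<partial>P)"
    unfolding G0_def using integral_mult_avgs[OF X bm_const[of 1], of i] by (simp add: free_def)
  finally show ?thesis using integral_Xp[OF kern_measurable[OF kern]] kern_mean[OF kern] by simp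
qed

lemma cG_zero: "m \<le> i \<Longrightarrow> cG i k = 0"
  unfolding cG_def by (subst Bochner_Integration.integral_cong[where g="\<lambda>x. 0"]) (auto simp: G0_zero)

lemma avg_G0: "avg 0 (G0 h i) x = G0 h (Suc i) (\<lambda>j. x (j - 1))"
proof -
  have "(\<lambda>x. Xp h (int (Suc i)) (\<lambda>j. x (j - 1))) = Xp h (int i)"
    using Xp_shift[of h "int (Suc i)" _ "-1"] by (simp add: fun_eq_iff)
  then show ?thesis unfolding G0_def avgs_shift by simp
qed

text \<open>By \<open>avg_G0\<close> the conditional expectations given F_{-1} are shifted ones
  given F_0 with index increased by one. Both cross terms reduce to their product by the projection
  property, so it appears with coefficient -1 - 1 + 1 = -1.\<close>

lemma integral_proj0:
  "(\<integral>x. proj0 h i x * proj0 h k x \<partial>P) = cG i k - cG (Suc i) (Suc k)"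
proof -
  have f: "(\<integral>x. avg 0 (G0 h a) x * avg 0 (G0 h b) x \<partial>P) = cG (Suc a) (Suc b)" for a b
    unfolding cG_def avg_G0
    using integral_shift[of "\<lambda>x. G0 h (Suc a) x * G0 h (Suc b) x" "-1"] bmD[OF bm_mult[OF bm_G bm_G]] by simp
  have s: "(\<integral>x. avg 0 (G0 h a) x * G0 h b x \<partial>P) = cG (Suc a) (Suc b)" for a b
    unfolding f[symmetric] by (intro integral_free_avg[symmetric] bm_avg bm_G free_avg)
  have "(\<integral>x. proj0 h i x * proj0 h k x \<partial>P) = (\<integral>x. G0 h i x * G0 h k x - avg 0 (G0 h k) x * G0 h i x
      - avg 0 (G0 h i) x * G0 h k x + avg 0 (G0 h i) x * avg 0 (G0 h k) x \<partial>P)"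
    by (simp add: proj0_def algebra_simps)
  also have "\<dots> = (\<integral>x. G0 h i x * G0 h k x \<partial>P) - (\<integral>x. avg 0 (G0 h k) x * G0 h i x \<partial>P)
      - (\<integral>x. avg 0 (G0 h i) x * G0 h k x \<partial>P) + (\<integral>x. avg 0 (G0 h i) x * avg 0 (G0 h k) x \<partial>P)"
    by (simp add: bm_integrable bm_mult bm_diff bm_avg bm_G)
  also have "\<dots> = cG i k - cG (Suc i) (Suc k)"
    unfolding s f using cG_sym[of "Suc k" "Suc i"] by (simp add: cG_def)
  finally show ?thesis .
qed

text \<open>Summed over all i, k \<le> n, the differences from \<open>integral_proj0\<close>
  telescope along diagonals. The entries with i = 0 or k = 0 remain and are autocovariances; those
  with an index n + 1 vanish because the range is m.\<close>

lemma sproj_eq: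
  assumes "m \<le> n" shows "sproj h n = sqrt lrv"
proof -
  have "(\<integral>x. (\<Sum>i\<le>n. proj0 h i x)\<^sup>2 \<partial>P) = (\<Sum>i\<le>n. \<Sum>k\<le>n. (\<integral>x. proj0 h i x * proj0 h k x \<partial>P))"
    unfolding power2_eq_square sum_product
    by (simp add: bm_integrable bm_mult bm_sum bm_proj0[OF kern] Bochner_Integration.integral_sum)
  also have "\<dots> = (\<Sum>i\<le>n. \<Sum>k\<le>n. cG i k) - (\<Sum>i\<le>n. \<Sum>k\<le>n. cG (Suc i) (Suc k))"
    by (simp add: integral_proj0 sum_subtractf)
  also have "(\<Sum>i\<le>n. \<Sum>k\<le>n. cG i k) = (\<Sum>k\<le>n. cG 0 k) + (\<Sum>i=1..n. cG i 0 + (\<Sum>k=1..n. cG i k))"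
    by (simp add: atMost_atLeast0 sum.atLeast_Suc_atMost)
  also have "(\<Sum>i\<le>n. \<Sum>k\<le>n. cG (Suc i) (Suc k)) = (\<Sum>i=1..n. \<Sum>k=1..n. cG i k)"
  proof -
    have "(\<Sum>i\<le>n. \<Sum>k\<le>n. cG (Suc i) (Suc k)) = (\<Sum>i=1..Suc n. \<Sum>k=1..Suc n. cG i k)"
      by (simp only: One_nat_def sum.atLeast_Suc_atMost_Suc_shift atMost_atLeast0 o_def)
    also have "\<dots> = (\<Sum>i=1..n. \<Sum>k=1..n. cG i k)"
      using assms cG_zero[of "Suc n"] cG_sym[of _ "Suc n"] by simp
    finally show ?thesis .
  qed
  also have "(\<Sum>k\<le>n. cG 0 k) + (\<Sum>i=1..n. cG i 0 + (\<Sum>k=1..n. cG i k)) - (\<Sum>i=1..n. \<Sum>k=1..n. cG i k)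
      = acov h 0 + 2 * (\<Sum>k=1..n. acov h k)"
    by (simp add: sum.distrib cG_sym[of _ 0] cG_0 atMost_atLeast0 sum.atLeast_Suc_atMost)
  finally show ?thesis using lrv_eq[OF assms] by (simp add: sproj_def nrm_def sqrt_def)
qed

end

subsection \<open>Asymptotics for a finite-range kernel\<close>

locale power_iid = iid_seq \<mu> + power_blocks c p for \<mu> :: "'b measure" and c p
begin

lemma rate_square: "(real n powr (2 - 3 / (2 * p)))\<^sup>2 = real n powr (4 - 3 / p)"
proof (cases "n = 0")
  case False
  have "of_nat 2 * (2 - 3 / (2 * p)) = 4 - 3 / p" by (simp add: right_diff_distrib)
  then show ?thesis using False powr_power[of "real n" "2 - 3 / (2 * p)" 2] by simp
qed simp

text \<open>C depends on the block structure and is chosen before the kernels and their range. Block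
  lengths up to n are at most X of order n^(1 - 1/p), and \<open>Qsum_variance_le\<close> yields a
  multiple of X^3 n, of order n^(4 - 3/p), the square of the normalisation.\<close>

lemma Qsum_bound:
  "\<exists>C\<ge>0. \<forall>n\<ge>1. \<forall>m u v du dv \<Delta>u \<Delta>v. kern m u \<longrightarrow> kern m v \<longrightarrow> profile u du \<Delta>u \<longrightarrow> profile v dv \<Delta>v \<longrightarrow>
    cnrm (Qsum u v {1..n} AA AA)
      \<le> C * \<Delta>u * \<Delta>v * real n powr (2 - 3 / (2 * p))"
proof -
  obtain C where C: "0 < C" "\<And>n k. 1 \<le> n \<Longrightarrow> k \<le> kb n \<Longrightarrow> real (bl k) \<le> C * real n powr (1 - 1 / p)"
    using bl_bound by blast
  have "cnrm (Qsum u v {1..n} AA AA)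
      \<le> sqrt (576 * C ^ 3) * \<Delta>u * \<Delta>v * real n powr (2 - 3 / (2 * p))"
    if n: "1 \<le> n" and u: "kern m u" "profile u du \<Delta>u" and v: "kern m v" "profile v dv \<Delta>v" for n m u v du dv \<Delta>u \<Delta>v
  proof -
    define X where "X = C * real n powr (1 - 1 / p)"
    define L where "L = nat \<lfloor>X\<rfloor>"
    have X: "0 \<le> X" using C by (simp add: X_def)
    have L: "real L \<le> X" using X by (simp add: L_def)
    have lenL: "bb (Suc k) - bb k \<le> L" if "k \<le> kb n" for k
      using C(2)[OF n that] unfolding L_def X_def bl_def by (simp add: le_nat_floor)
    have \<Delta>: "0 \<le> \<Delta>u" "0 \<le> \<Delta>v" using profile_bound_nonneg u v by auto
    have "(cnrm (Qsum u v {1..n} AA AA))\<^sup>2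
        \<le> 288 * (L * \<Delta>u * \<Delta>v)\<^sup>2 * (real L * card (\<Union>i\<in>{1..n}. AA i) + real L * card (\<Union>i\<in>{1..n}. AA i))"
      by (rule Qsum_variance_le[OF u v])
        (simp_all only: finite_atLeastAtMost finite_sets card_AA[OF lenL] card_overlap[OF lenL])
    also have "\<dots> \<le> 288 * (X * \<Delta>u * \<Delta>v)\<^sup>2 * (X * n + X * n)"
      using L \<Delta> X card_Union_AA[of n]
      by (intro mult_mono add_mono power_mono mult_left_mono mult_right_mono) auto
    also have "\<dots> = 576 * (X ^ 3 * n) * (\<Delta>u * \<Delta>v)\<^sup>2" by (simp add: power2_eq_square power3_eq_cube)
    also have "X ^ 3 * n = C ^ 3 * real n powr (4 - 3 / p)"
    proof -
      have "(real n powr (1 - 1 / p)) ^ 3 = real n powr (3 - 3 / p)"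
        using n by (simp add: powr_power right_diff_distrib)
      then have "(real n powr (1 - 1 / p)) ^ 3 * n = real n powr (3 - 3 / p) * real n powr 1" using n by simp
      also have "\<dots> = real n powr (4 - 3 / p)" by (subst powr_add[symmetric]) simp
      finally show ?thesis by (simp add: X_def power_mult_distrib mult.assoc)
    qed
    finally have le: "(cnrm (Qsum u v {1..n} AA AA))\<^sup>2
        \<le> 576 * (C ^ 3 * real n powr (4 - 3 / p)) * (\<Delta>u * \<Delta>v)\<^sup>2" by (simp only: mult.assoc)
    have "(real n powr (2 - 3 / (2 * p)))\<^sup>2 = real n powr (4 - 3 / p)"
      by (rule rate_square)
    then have "576 * (C ^ 3 * real n powr (4 - 3 / p)) * (\<Delta>u * \<Delta>v)\<^sup>2
        = (sqrt (576 * C ^ 3) * \<Delta>u * \<Delta>v * real n powr (2 - 3 / (2 * p)))\<^sup>2"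
      using C by (simp add: power_mult_distrib)
    with le have "(cnrm (Qsum u v {1..n} AA AA))\<^sup>2
        \<le> (sqrt (576 * C ^ 3) * \<Delta>u * \<Delta>v * real n powr (2 - 3 / (2 * p)))\<^sup>2" by (simp only:)
    then show ?thesis by (rule power2_le_imp_le) (use C \<Delta> in simp)
  qed
  note key = this
  have "0 \<le> sqrt (576 * C ^ 3)" using C by simp
  then show ?thesis using key by blast
qed

end

locale power_kernel = iid_kernel \<mu> h m d \<Delta> + power_blocks c p for \<mu> :: "'b measure" and h m d \<Delta> c p
begin

sublocale block_kernel \<mu> h m d \<Delta> bb kb
  by unfold_locales

sublocale power_iid \<mu> c p
  by unfold_locales

lemma len_less: "k < kb n \<Longrightarrow> 1 \<le> n \<Longrightarrow> len n k = bl k"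
  using kb(1)[of n] monoD[OF mono_bb, of "Suc k" "kb n"] by (simp add: len_def bl_def)

lemma len_le: "len n k \<le> bl k"
  by (simp add: len_def bl_def)

lemma blkvar_le: "\<exists>C>0. \<forall>r. blkvar r \<le> C * real r ^ 4"
proof -
  obtain C where C: "0 < C" "\<And>r. 1 \<le> r \<Longrightarrow> blkvar r \<le> C * real r ^ 4"
    using bounded_quotient[OF blkvar_asymp] by auto
  have "blkvar 0 = 0" by (simp add: blkvar_def blk_def[abs_def])
  then have "blkvar r \<le> C * real r ^ 4" for r using C(2)[of r] by (cases "r = 0") auto
  then show ?thesis using C(1) by blast
qed

text \<open>Complete blocks are covered by \<open>block_sum_asymp\<close> with the limit lrv^2 / 3.
  The block containing n may be incomplete; its length is O(n^(1 - 1/p)), so its variance is O(n^(4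
  - 4/p)) and disappears after division by n^(4 - 3/p).\<close>

lemma VF_asymp:
  "(\<lambda>n. cnrm (VF n) / real n powr (2 - 3 / (2 * p))) \<longlonglongrightarrow> lrv * p\<^sup>2 * c powr (3 / (2 * p)) / sqrt (12 * p - 9)"
proof -
  have "(\<lambda>n. blkvar (len n (kb n) - m) / real n powr (4 - 3 / p)) \<longlonglongrightarrow> 0"
  proof -
    obtain C1 where C1: "0 < C1" "\<And>n k. 1 \<le> n \<Longrightarrow> k \<le> kb n \<Longrightarrow> real (bl k) \<le> C1 * real n powr (1 - 1 / p)"
      using bl_bound by blast
    obtain C2 where C2: "0 < C2" "\<And>r. blkvar r \<le> C2 * real r ^ 4" using blkvar_le by blast
    define r where "r = 1 / p"
    have r: "0 < r" "r < 1" using p by (auto simp: r_def)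
    have p3: "3 / p = 3 * r" by (simp add: r_def)
    have le: "norm (blkvar (len n (kb n) - m) / real n powr (4 - 3 / p)) \<le> (C2 * C1 ^ 4) * ((real n powr (1 - r)) ^ 4 / real n powr (4 - 3 * r))"
      if n: "1 \<le> n" for n
    proof -
      have "real (len n (kb n) - m) \<le> C1 * real n powr (1 - 1 / p)"
        using C1(2)[OF n order_refl] len_le[of n "kb n"] by linarith
      then have "real (len n (kb n) - m) ^ 4 \<le> (C1 * real n powr (1 - 1 / p)) ^ 4" by (intro power_mono) auto
      then have "C2 * real (len n (kb n) - m) ^ 4 \<le> C2 * (C1 * real n powr (1 - 1 / p)) ^ 4"
        using C2 by (intro mult_left_mono) auto
      then have "blkvar (len n (kb n) - m) \<le> (C2 * C1 ^ 4) * (real n powr (1 - r)) ^ 4"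
        using C2(2)[of "len n (kb n) - m"] by (simp add: power_mult_distrib r_def)
      then have "blkvar (len n (kb n) - m) / real n powr (4 - 3 * r) \<le> (C2 * C1 ^ 4) * (real n powr (1 - r)) ^ 4 / real n powr (4 - 3 * r)"
        by (rule divide_right_mono) simp
      then show ?thesis using blkvar_nonneg[of "len n (kb n) - m"] by (simp add: p3)
    qed
    have "(\<lambda>n. (real n powr (1 - r)) ^ 4 / real n powr (4 - 3 * r)) \<longlonglongrightarrow> 0" using r by real_asymp
    then have "(\<lambda>n. (C2 * C1 ^ 4) * ((real n powr (1 - r)) ^ 4 / real n powr (4 - 3 * r))) \<longlonglongrightarrow> 0" by (rule tendsto_mult_right_zero)
    moreover have "\<forall>\<^sub>F n in sequentially. norm (blkvar (len n (kb n) - m) / real n powr (4 - 3 / p))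
        \<le> (C2 * C1 ^ 4) * ((real n powr (1 - r)) ^ 4 / real n powr (4 - 3 * r))"
      by (rule eventually_sequentiallyI[of 1]) (rule le)
    ultimately show ?thesis by (rule Lim_null_comparison[rotated])
  qed
  note last = this
  have lim: "(\<lambda>n. (\<Sum>k<kb n. blkvar (bl k - m)) / real n powr (4 - 3 / p) + blkvar (len n (kb n) - m) / real n powr (4 - 3 / p))
     \<longlonglongrightarrow> lrv\<^sup>2 / 3 * c powr (3 / p) * p ^ 4 / (4 * p - 3) + 0"
    by (rule tendsto_add[OF block_sum_asymp[OF blkvar_asymp] last])
  have eq: "(\<Sum>k<kb n. blkvar (bl k - m)) / real n powr (4 - 3 / p) + blkvar (len n (kb n) - m) / real n powr (4 - 3 / p)
     = (cnrm (VF n) / real n powr (2 - 3 / (2 * p)))\<^sup>2" if "1 \<le> n" for n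
  proof -
    have "(cnrm (VF n))\<^sup>2 = (\<Sum>k<kb n. blkvar (len n k - m)) + blkvar (len n (kb n) - m)"
    proof -
      have "{..kb n} = insert (kb n) {..<kb n}" by auto
      then show ?thesis using VF_variance[OF that] by simp
    qed
    also have "(\<Sum>k<kb n. blkvar (len n k - m)) = (\<Sum>k<kb n. blkvar (bl k - m))"
      using len_less that by (intro sum.cong) auto
    finally have "(cnrm (VF n))\<^sup>2 = (\<Sum>k<kb n. blkvar (bl k - m)) + blkvar (len n (kb n) - m)" .
    moreover have "(real n powr (2 - 3 / (2 * p)))\<^sup>2 = real n powr (4 - 3 / p)"
      by (rule rate_square)
    ultimately show ?thesis by (simp add: power_divide add_divide_distrib)
  qed
  have "(\<lambda>n. (cnrm (VF n) / real n powr (2 - 3 / (2 * p)))\<^sup>2) \<longlonglongrightarrow> lrv\<^sup>2 / 3 * c powr (3 / p) * p ^ 4 / (4 * p - 3)"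
    by (rule Lim_transform_eventually[OF lim[unfolded add_0_right]]) (rule eventually_sequentiallyI[of 1], rule eq)
  from tendsto_real_sqrt[OF this]
  have "(\<lambda>n. cnrm (VF n) / real n powr (2 - 3 / (2 * p))) \<longlonglongrightarrow> sqrt (lrv\<^sup>2 / 3 * c powr (3 / p) * p ^ 4 / (4 * p - 3))"
    by (simp add: nrm_nonneg)
  also have "lrv\<^sup>2 / 3 * c powr (3 / p) * p ^ 4 / (4 * p - 3) = (lrv * p\<^sup>2 * c powr (3 / (2 * p)))\<^sup>2 / (12 * p - 9)"
  proof -
    have "(c powr (3 / (2 * p)))\<^sup>2 = c powr (3 / p)" using c by (simp add: powr_power)
    moreover have "(p\<^sup>2)\<^sup>2 = p ^ 4" by simp
    moreover have "12 * p - 9 = 3 * (4 * p - 3)" by simp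
    ultimately show ?thesis by (simp add: power_mult_distrib)
  qed
  finally show ?thesis using lrv_nonneg c by (simp add: real_sqrt_divide)
qed

text \<open>With L of order n^(1 - 1/p) and \<open>kb n\<close> of order n^(1/p), both L m
  (\<open>kb n\<close> + 1) and m n are O(n). Multiplied by L^2 this is O(n^(3 - 2/p)), smaller than
  n^(4 - 3/p) by the factor n^(1/p - 1).\<close>

lemma V_diff_asymp: "(\<lambda>n. cnrm (\<lambda>x. VV n x - VF n x) / real n powr (2 - 3 / (2 * p))) \<longlonglongrightarrow> 0"
proof -
  obtain C1 where C1: "0 < C1" "\<And>n k. 1 \<le> n \<Longrightarrow> k \<le> kb n \<Longrightarrow> real (bl k) \<le> C1 * real n powr (1 - 1 / p)"
    using bl_bound by blast
  obtain C2 where C2: "0 < C2" "\<And>n. 1 \<le> n \<Longrightarrow> real (kb n) \<le> C2 * real n powr (1 / p)"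
    using bounded_quotient[OF kb_asymp] by auto
  define r where "r = 1 / p"
  have r: "0 < r" "r < 1" using p by (auto simp: r_def)
  have p3: "3 / (2 * p) = 3 / 2 * r" by (simp add: r_def)
  define X where "X n = C1 * real n powr (1 - r)" for n :: nat
  define B where "B n = 288 * (X n * \<Delta> * \<Delta>)\<^sup>2 * (X n * (m * (C2 * real n powr r + 1)) + real m * n)" for n :: nat
  have \<Delta>: "0 \<le> \<Delta>" using profile_bound_nonneg profile by auto
  have le: "norm (cnrm (\<lambda>x. VV n x - VF n x) / real n powr (2 - 3 / (2 * p))) \<le> 2 * sqrt (B n / real n powr (4 - 3 * r))"
    if n: "1 \<le> n" for n
  proof -
    define L where "L = nat \<lfloor>X n\<rfloor>"
    have X: "0 \<le> X n" using C1 by (simp add: X_def)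
    have L: "real L \<le> X n" using X by (simp add: L_def)
    have lenL: "bb (Suc k) - bb k \<le> L" if "k \<le> kb n" for k
      using C1(2)[OF n that] unfolding L_def X_def bl_def r_def by (simp add: le_nat_floor)
    have "real (kb n) + 1 \<le> C2 * real n powr r + 1" using C2(2)[OF n] by (simp add: r_def)
    from mult_left_mono[OF this, of "real m"]
    have kb: "real (m * (kb n + 1)) \<le> m * (C2 * real n powr r + 1)" by (simp add: algebra_simps)
    have "cnrm (\<lambda>x. VV n x - VF n x) \<le> 2 * sqrt (288 * (real L * \<Delta> * \<Delta>)\<^sup>2 * (real L * (m * (kb n + 1)) + real m * n))"
      by (rule V_diff_cnrm[OF lenL])
    also have "\<dots> \<le> 2 * sqrt (B n)"
      unfolding B_def using L \<Delta> X kb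
      by (intro mult_left_mono real_sqrt_le_mono mult_mono add_mono power_mono mult_right_mono)
         (auto intro!: mult_left_mono mult_nonneg_nonneg add_nonneg_nonneg)
    finally have "cnrm (\<lambda>x. VV n x - VF n x) / real n powr (2 - 3 / (2 * p)) \<le> 2 * sqrt (B n) / real n powr (2 - 3 / (2 * p))"
      by (rule divide_right_mono) simp
    moreover have "real n powr (2 - 3 / (2 * p)) = sqrt (real n powr (4 - 3 * r))"
      unfolding p3 by (simp add: powr_half_sqrt[symmetric] powr_powr diff_divide_distrib)
    ultimately show ?thesis by (simp add: real_sqrt_divide nrm_nonneg)
  qed
  have "(\<lambda>n. B n / real n powr (4 - 3 * r)) \<longlonglongrightarrow> 0"
  proof -
    have a: "(\<lambda>n. (real n powr (1 - r)) ^ 3 * (C2 * real n powr r + 1) / real n powr (4 - 3 * r)) \<longlonglongrightarrow> 0"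
      using r C2(1) by real_asymp
    have b: "(\<lambda>n. (real n powr (1 - r)) ^ 2 * real n / real n powr (4 - 3 * r)) \<longlonglongrightarrow> 0"
      using r by real_asymp
    have "B n / real n powr (4 - 3 * r) = (288 * \<Delta> ^ 4 * C1 ^ 3 * m) * ((real n powr (1 - r)) ^ 3 * (C2 * real n powr r + 1) / real n powr (4 - 3 * r))
       + (288 * \<Delta> ^ 4 * C1 ^ 2 * m) * ((real n powr (1 - r)) ^ 2 * real n / real n powr (4 - 3 * r))" for n
      unfolding B_def X_def times_divide_eq_right add_divide_distrib[symmetric] by (rule arg_cong2[where f="(/)"]) (algebra, rule refl)
    then show ?thesis using tendsto_add[OF tendsto_mult_right_zero[OF a] tendsto_mult_right_zero[OF b]] by simp
  qed
  from tendsto_real_sqrt[OF this] have "(\<lambda>n. sqrt (B n / real n powr (4 - 3 * r))) \<longlonglongrightarrow> 0"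
    unfolding real_sqrt_zero .
  then have "(\<lambda>n. 2 * sqrt (B n / real n powr (4 - 3 * r))) \<longlonglongrightarrow> 0" by (rule tendsto_mult_right_zero)
  moreover have "\<forall>\<^sub>F n in sequentially. norm (cnrm (\<lambda>x. VV n x - VF n x) / real n powr (2 - 3 / (2 * p)))
      \<le> 2 * sqrt (B n / real n powr (4 - 3 * r))"
    by (rule eventually_sequentiallyI[of 1]) (rule le)
  ultimately show ?thesis by (rule Lim_null_comparison[rotated])
qed

lemma VV_asymp:
  "(\<lambda>n. cnrm (VV n) / real n powr (2 - 3 / (2 * p))) \<longlonglongrightarrow> lrv * p\<^sup>2 * c powr (3 / (2 * p)) / sqrt (12 * p - 9)"
proof -
  have "norm (cnrm (VV n) / real n powr (2 - 3 / (2 * p)) - cnrm (VF n) / real n powr (2 - 3 / (2 * p)))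
      \<le> cnrm (\<lambda>x. VV n x - VF n x) / real n powr (2 - 3 / (2 * p))" for n
    using divide_right_mono[OF nrm_centered_triangle[OF bm_V(1) bm_V(2)], of "real n powr (2 - 3 / (2 * p))" n n]
    by (simp add: diff_divide_distrib[symmetric])
  then have "(\<lambda>n. cnrm (VV n) / real n powr (2 - 3 / (2 * p)) - cnrm (VF n) / real n powr (2 - 3 / (2 * p))) \<longlonglongrightarrow> 0"
    by (intro Lim_null_comparison[OF always_eventually V_diff_asymp]) auto
  from tendsto_add[OF this VF_asymp] show ?thesis by simp
qed

end

context iid_seq
begin

subsection \<open>Approximation by finite-range kernels\<close>

definition bs :: "((nat \<Rightarrow> 'b) \<Rightarrow> real) \<Rightarrow> bool" where
  "bs f \<longleftrightarrow> f \<in> borel_measurable S \<and> (\<exists>C. \<forall>x\<in>space S. \<bar>f x\<bar> \<le> C)"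

text \<open>\<open>cut m f\<close> is the conditional expectation of \<open>f\<close> given the first \<open>m\<close> coordinates.\<close>

definition cut :: "nat \<Rightarrow> ((nat \<Rightarrow> 'b) \<Rightarrow> real) \<Rightarrow> (nat \<Rightarrow> 'b) \<Rightarrow> real" where
  "cut m f x = (\<integral>z. f (comb_seq m x z) \<partial>S)"

lemma bs_bound:
  assumes "bs f" obtains C where "0 \<le> C" "\<And>x. x \<in> space S \<Longrightarrow> \<bar>f x\<bar> \<le> C"
proof -
  obtain C where C: "\<And>x. x \<in> space S \<Longrightarrow> \<bar>f x\<bar> \<le> C" using assms by (auto simp: bs_def)
  show ?thesis by (rule that[of "\<bar>C\<bar>"]) (use C in force)+
qed

lemma bs_measurable: "bs f \<Longrightarrow> f \<in> borel_measurable S"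
  by (simp add: bs_def)

lemma bs_Lq: "bs f \<Longrightarrow> f \<in> Lq q S"
  using SS.P.Lq_bounded by (auto simp: bs_def)

lemma bs_integrable: "bs f \<Longrightarrow> integrable S f"
  using bs_Lq[of f 1] by (simp add: Lq_def)

lemma bs_const: "bs (\<lambda>x. c)"
  by (auto simp: bs_def)

lemma bs_add: assumes "bs f" "bs g" shows "bs (\<lambda>x. f x + g x)"
proof -
  obtain C D where "\<forall>x\<in>space S. \<bar>f x\<bar> \<le> C" "\<forall>x\<in>space S. \<bar>g x\<bar> \<le> D" using assms by (auto simp: bs_def)
  then have "\<forall>x\<in>space S. \<bar>f x + g x\<bar> \<le> C + D" by force
  then show ?thesis using assms by (auto simp: bs_def)
qed

lemma bs_mult: assumes "bs f" "bs g" shows "bs (\<lambda>x. f x * g x)"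
proof -
  obtain C D where C: "0 \<le> C" "\<And>x. x\<in>space S \<Longrightarrow> \<bar>f x\<bar> \<le> C" and D: "\<And>x. x\<in>space S \<Longrightarrow> \<bar>g x\<bar> \<le> D"
    using bs_bound[OF assms(1)] bs_bound[OF assms(2)] by metis
  then have "\<forall>x\<in>space S. \<bar>f x * g x\<bar> \<le> C * D" by (auto simp: abs_mult intro!: mult_mono)
  then show ?thesis using assms by (auto simp: bs_def)
qed

lemma bs_diff: "bs f \<Longrightarrow> bs g \<Longrightarrow> bs (\<lambda>x. f x - g x)"
  using bs_add[of f "\<lambda>x. (-1) * g x"] bs_mult[OF bs_const[of "-1"], of g] by simp

lemma bs_abs: "bs f \<Longrightarrow> bs (\<lambda>x. \<bar>f x\<bar>)"
  by (auto simp: bs_def)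

lemma bs_cong: "bs f \<Longrightarrow> (\<And>x. x \<in> space S \<Longrightarrow> f x = g x) \<Longrightarrow> bs g"
  using measurable_cong[of S g f borel] by (auto simp: bs_def)

lemma comb_in_space: "x \<in> space S \<Longrightarrow> z \<in> space S \<Longrightarrow> comb_seq m x z \<in> space S"
  by (auto simp: space_PiM PiE_iff comb_seq_def)

lemma bs_section:
  assumes "bs f" "x \<in> space S" shows "bs (\<lambda>z. f (comb_seq m x z))"
proof -
  have [measurable]: "f \<in> borel_measurable S" "(\<lambda>z. x) \<in> S \<rightarrow>\<^sub>M S" using assms by (auto simp: bs_def)
  obtain C where "\<And>x. x \<in> space S \<Longrightarrow> \<bar>f x\<bar> \<le> C" using bs_bound[OF assms(1)] by blast
  then have "\<forall>z\<in>space S. \<bar>f (comb_seq m x z)\<bar> \<le> C" using comb_in_space[OF assms(2)] by blast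
  then show ?thesis unfolding bs_def by (intro conjI exI[of _ C]) auto
qed

lemma bs_cut: assumes "bs f" shows "bs (cut m f)"
proof -
  have [measurable]: "f \<in> borel_measurable S" using assms by (auto simp: bs_def)
  obtain C where C: "\<And>x. x \<in> space S \<Longrightarrow> \<bar>f x\<bar> \<le> C" using bs_bound[OF assms(1)] by blast
  have "\<bar>cut m f x\<bar> \<le> C" if "x \<in> space S" for x
  proof -
    have "\<bar>cut m f x\<bar> \<le> (\<integral>z. \<bar>f (comb_seq m x z)\<bar> \<partial>S)" unfolding cut_def by (rule integral_abs_bound)
    also have "\<dots> \<le> (\<integral>z. C \<partial>S)"
      using C that by (intro integral_mono bs_integrable bs_abs bs_const bs_section[OF assms]) (auto simp: comb_in_space)
    finally show ?thesis by (simp add: SS.P.prob_space)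
  qed
  moreover have "cut m f \<in> borel_measurable S" unfolding cut_def by measurable
  ultimately show ?thesis by (auto simp: bs_def)
qed

lemma cut_add: "bs f \<Longrightarrow> bs g \<Longrightarrow> x \<in> space S \<Longrightarrow> cut m (\<lambda>x. f x + g x) x = cut m f x + cut m g x"
  and cut_diff: "bs f \<Longrightarrow> bs g \<Longrightarrow> x \<in> space S \<Longrightarrow> cut m (\<lambda>x. f x - g x) x = cut m f x - cut m g x"
  unfolding cut_def by (simp_all add: bs_integrable bs_section)

lemma cut_cong: "(\<And>x. x \<in> space S \<Longrightarrow> f x = g x) \<Longrightarrow> x \<in> space S \<Longrightarrow> cut m f x = cut m g x"
  unfolding cut_def by (intro Bochner_Integration.integral_cong) (auto simp: comb_in_space)

lemma integral_cut:
  assumes "bs f" shows "(\<integral>x. cut m f x \<partial>S) = (\<integral>x. f x \<partial>S)"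
proof -
  have [measurable]: "f \<in> borel_measurable S" using assms by (auto simp: bs_def)
  interpret pair_prob_space S S by unfold_locales
  obtain C where C: "\<And>x. x \<in> space S \<Longrightarrow> \<bar>f x\<bar> \<le> C" using bs_bound[OF assms] by blast
  have "integrable (S \<Otimes>\<^sub>M S) (\<lambda>xz. f (comb_seq m (fst xz) (snd xz)))"
    using C by (intro integrable_const_bound[of _ C]) (auto simp: space_pair_measure comb_in_space)
  then have "(\<integral>x. cut m f x \<partial>S) = (\<integral>xz. f (comb_seq m (fst xz) (snd xz)) \<partial>(S \<Otimes>\<^sub>M S))"
    unfolding cut_def using integral_fst'[of "\<lambda>xz. f (comb_seq m (fst xz) (snd xz))"] by simp
  also have "\<dots> = (\<integral>x. f x \<partial>distr (S \<Otimes>\<^sub>M S) S (\<lambda>(x, z). comb_seq m x z))"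
    by (subst integral_distr) (auto simp: case_prod_beta')
  finally show ?thesis by (simp add: SS.PiM_comb_seq)
qed

lemma cut_L1:
  assumes "bs f" shows "(\<integral>x. \<bar>cut m f x\<bar> \<partial>S) \<le> (\<integral>x. \<bar>f x\<bar> \<partial>S)"
proof -
  have "(\<integral>x. \<bar>cut m f x\<bar> \<partial>S) \<le> (\<integral>x. cut m (\<lambda>x. \<bar>f x\<bar>) x \<partial>S)"
    by (intro integral_mono bs_integrable bs_abs bs_cut assms) (auto simp: cut_def intro: integral_abs_bound)
  then show ?thesis using integral_cut[OF bs_abs[OF assms]] by simp
qed

text \<open>L1 convergence of the conditional expectations given the first m coordinates, made a
  property of f so that it can be carried from cylinder sets to all bounded measurable functions by
  a monotone class argument.\<close>

definition dens :: "((nat \<Rightarrow> 'b) \<Rightarrow> real) \<Rightarrow> bool" where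
  "dens f \<longleftrightarrow> bs f \<and> (\<lambda>m. \<integral>x. \<bar>f x - cut m f x\<bar> \<partial>S) \<longlonglongrightarrow> 0"

lemma dens_eventually:
  assumes "bs f" "\<And>m x. M \<le> m \<Longrightarrow> x \<in> space S \<Longrightarrow> cut m f x = f x"
  shows "dens f"
proof -
  have "(\<integral>x. \<bar>f x - cut m f x\<bar> \<partial>S) = (\<integral>x. 0 \<partial>S)" if "M \<le> m" for m
    using assms(2)[OF that] by (intro Bochner_Integration.integral_cong) auto
  then have "\<forall>\<^sub>F m in sequentially. (\<integral>x. \<bar>f x - cut m f x\<bar> \<partial>S) = 0"
    by (auto simp: eventually_sequentially)
  then show ?thesis using assms(1) unfolding dens_def by (auto intro: tendsto_eventually)
qed

lemma cut_error_le:
  assumes "bs f" "bs u"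
  shows "(\<integral>x. \<bar>f x - cut m f x\<bar> \<partial>S) \<le> 2 * (\<integral>x. \<bar>f x - u x\<bar> \<partial>S) + (\<integral>x. \<bar>u x - cut m u x\<bar> \<partial>S)"
proof -
  have "(\<integral>x. \<bar>f x - cut m f x\<bar> \<partial>S) \<le> (\<integral>x. \<bar>f x - u x\<bar> + \<bar>cut m (\<lambda>x. f x - u x) x\<bar> + \<bar>u x - cut m u x\<bar> \<partial>S)"
    using assms by (intro integral_mono bs_integrable bs_abs bs_cut bs_add bs_diff) (auto simp: cut_diff)
  also have "\<dots> = (\<integral>x. \<bar>f x - u x\<bar> \<partial>S) + (\<integral>x. \<bar>cut m (\<lambda>x. f x - u x) x\<bar> \<partial>S) + (\<integral>x. \<bar>u x - cut m u x\<bar> \<partial>S)"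
    using assms by (simp add: bs_integrable bs_abs bs_cut bs_diff bs_add)
  also have "\<dots> \<le> (\<integral>x. \<bar>f x - u x\<bar> \<partial>S) + (\<integral>x. \<bar>f x - u x\<bar> \<partial>S) + (\<integral>x. \<bar>u x - cut m u x\<bar> \<partial>S)"
    using assms by (intro add_mono cut_L1 bs_diff) auto
  finally show ?thesis by simp
qed

text \<open>\<open>cut m\<close> contracts the L1 norm, so replacing f by u costs at most twice
  their distance, whatever m is.\<close>

lemma dens_limit:
  assumes f: "bs f" and ex: "\<And>e. 0 < e \<Longrightarrow> \<exists>u. dens u \<and> (\<integral>x. \<bar>f x - u x\<bar> \<partial>S) \<le> e"
  shows "dens f"
  unfolding dens_def
proof (intro conjI f LIMSEQ_I)
  fix e :: real assume e: "0 < e"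
  obtain u where u: "dens u" "(\<integral>x. \<bar>f x - u x\<bar> \<partial>S) \<le> e / 4" using ex[of "e / 4"] e by auto
  have "(\<lambda>m. \<integral>x. \<bar>u x - cut m u x\<bar> \<partial>S) \<longlonglongrightarrow> 0" using u by (simp add: dens_def)
  from LIMSEQ_D[OF this, of "e / 2"] e
  obtain M where M: "\<And>m. M \<le> m \<Longrightarrow> norm ((\<integral>x. \<bar>u x - cut m u x\<bar> \<partial>S) - 0) < e / 2" by auto
  show "\<exists>no. \<forall>m\<ge>no. norm ((\<integral>x. \<bar>f x - cut m f x\<bar> \<partial>S) - 0) < e"
  proof (intro exI[of _ M] allI impI)
    fix m assume "M \<le> m"
    have "(\<integral>x. \<bar>f x - cut m f x\<bar> \<partial>S) \<le> 2 * (\<integral>x. \<bar>f x - u x\<bar> \<partial>S) + (\<integral>x. \<bar>u x - cut m u x\<bar> \<partial>S)"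
      using u f by (intro cut_error_le) (auto simp: dens_def)
    also have "\<dots> < e" using u(2) M[OF \<open>M \<le> m\<close>] by simp
    finally show "norm ((\<integral>x. \<bar>f x - cut m f x\<bar> \<partial>S) - 0) < e"
      by (simp add: integral_nonneg_AE)
  qed
qed

lemma dens_add: assumes "dens f" "dens g" shows "dens (\<lambda>x. f x + g x)"
proof -
  have b: "bs f" "bs g" using assms by (auto simp: dens_def)
  have "(\<lambda>m. (\<integral>x. \<bar>f x - cut m f x\<bar> \<partial>S) + (\<integral>x. \<bar>g x - cut m g x\<bar> \<partial>S)) \<longlonglongrightarrow> 0 + 0"
    using assms by (intro tendsto_add) (auto simp: dens_def)
  then have lim: "(\<lambda>m. (\<integral>x. \<bar>f x - cut m f x\<bar> \<partial>S) + (\<integral>x. \<bar>g x - cut m g x\<bar> \<partial>S)) \<longlonglongrightarrow> 0" by simp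
  have le: "norm (\<integral>x. \<bar>f x + g x - cut m (\<lambda>x. f x + g x) x\<bar> \<partial>S)
      \<le> (\<integral>x. \<bar>f x - cut m f x\<bar> \<partial>S) + (\<integral>x. \<bar>g x - cut m g x\<bar> \<partial>S)" for m
  proof -
    have "(\<integral>x. \<bar>f x + g x - cut m (\<lambda>x. f x + g x) x\<bar> \<partial>S) \<le> (\<integral>x. \<bar>f x - cut m f x\<bar> + \<bar>g x - cut m g x\<bar> \<partial>S)"
      using b by (intro integral_mono bs_integrable bs_abs bs_cut bs_add bs_diff) (auto simp: cut_add)
    then show ?thesis using b by (simp add: bs_integrable bs_abs bs_cut bs_diff)
  qed
  have "(\<lambda>m. \<integral>x. \<bar>f x + g x - cut m (\<lambda>x. f x + g x) x\<bar> \<partial>S) \<longlonglongrightarrow> 0"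
    by (rule Lim_null_comparison[OF always_eventually[OF allI[OF le]] lim])
  then show ?thesis using bs_add[OF b] by (simp add: dens_def)
qed

lemma dens_cmult: assumes "dens f" shows "dens (\<lambda>x. c * f x)"
proof -
  have "(\<integral>x. \<bar>c * f x - cut m (\<lambda>x. c * f x) x\<bar> \<partial>S) = \<bar>c\<bar> * (\<integral>x. \<bar>f x - cut m f x\<bar> \<partial>S)" for m
    by (simp add: cut_def abs_mult right_diff_distrib[symmetric])
  then show ?thesis using assms tendsto_mult_right_zero[of _ sequentially "\<bar>c\<bar>"] unfolding dens_def
    by (auto intro: bs_mult bs_const)
qed

lemma dens_const: "dens (\<lambda>x. c)"
  by (rule dens_eventually[of _ 0]) (auto simp: bs_const cut_def SS.P.prob_space)

lemma dens_sum: "(\<And>i. i \<in> I \<Longrightarrow> dens (f i)) \<Longrightarrow> dens (\<lambda>x. \<Sum>i\<in>I. f i x)"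
  by (induction I rule: infinite_finite_induct) (auto intro: dens_const dens_add)

lemma dens_cong: assumes "dens f" "\<And>x. x \<in> space S \<Longrightarrow> f x = g x" shows "dens g"
proof -
  have "(\<integral>x. \<bar>f x - cut m f x\<bar> \<partial>S) = (\<integral>x. \<bar>g x - cut m g x\<bar> \<partial>S)" for m
    using assms(2) cut_cong[of f g] by (intro Bochner_Integration.integral_cong) auto
  then show ?thesis using assms bs_cong[of f g] by (auto simp: dens_def)
qed

lemma dens_mono_limit:
  assumes U: "\<And>n. dens (U n)" and f: "bs f"
    and le: "\<And>n x. x \<in> space S \<Longrightarrow> 0 \<le> U n x \<and> U n x \<le> f x"
    and lim: "\<And>x. x \<in> space S \<Longrightarrow> (\<lambda>n. U n x) \<longlonglongrightarrow> f x"
  shows "dens f"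
proof (rule dens_limit[OF f])
  fix e :: real assume e: "0 < e"
  have [measurable]: "f \<in> borel_measurable S" "U n \<in> borel_measurable S" for n using f U by (auto simp: dens_def bs_def)
  have "(\<lambda>n. \<integral>x. \<bar>f x - U n x\<bar> \<partial>S) \<longlonglongrightarrow> (\<integral>x. 0 \<partial>S)"
  proof (rule integral_dominated_convergence[where w=f])
    show "integrable S f" by (rule bs_integrable[OF f])
    show "AE x in S. (\<lambda>n. \<bar>f x - U n x\<bar>) \<longlonglongrightarrow> 0"
    proof (rule AE_I2)
      fix x assume "x \<in> space S"
      from tendsto_rabs[OF tendsto_diff[OF tendsto_const[of "f x"] lim[OF this]]]
      show "(\<lambda>n. \<bar>f x - U n x\<bar>) \<longlonglongrightarrow> 0" by simp
    qed
    show "AE x in S. norm \<bar>f x - U n x\<bar> \<le> f x" for n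
      using le[of _ n] by (intro AE_I2) force
  qed auto
  then have "\<forall>\<^sub>F n in sequentially. (\<integral>x. \<bar>f x - U n x\<bar> \<partial>S) < e" using e by (intro order_tendstoD(2)) auto
  then obtain n where "(\<integral>x. \<bar>f x - U n x\<bar> \<partial>S) < e" by (auto simp: eventually_sequentially)
  then show "\<exists>u. dens u \<and> (\<integral>x. \<bar>f x - u x\<bar> \<partial>S) \<le> e" using U[of n] by (intro exI[of _ "U n"]) auto
qed

text \<open>Dynkin's lemma with the cylinder sets as generator: \<open>cut m\<close> leaves a
  cylinder unchanged once m exceeds its finitely many coordinates. Complements follow by linearity,
  disjoint unions by monotone limits.\<close>

lemma dens_indicator:
  assumes "A \<in> sets S" shows "dens (indicator A)"
proof -
  let ?G = "prod_algebra UNIV (\<lambda>_::nat. \<mu>)"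
  have sp: "space S = (\<Pi>\<^sub>E i\<in>UNIV. space \<mu>)" by (simp add: space_PiM)
  have bsi: "bs (indicator A)" if "A \<in> sets S" for A
    using that by (auto simp: bs_def indicator_def)
  have "Int_stable ?G" by (rule Int_stable_prod_algebra)
  moreover have "?G \<subseteq> Pow (space S)" unfolding sp by (rule prod_algebra_sets_into_space)
  moreover from assms have "A \<in> sigma_sets (space S) ?G" by (simp add: sets_PiM sp)
  ultimately show ?thesis
  proof (induction rule: sigma_sets_induct_disjoint)
    case (basic A)
    from prod_algebraE[OF this] obtain J E where A: "A = prod_emb UNIV (\<lambda>_. \<mu>) J (\<Pi>\<^sub>E j\<in>J. E j)" and J: "finite J"
      and E: "\<And>i. i \<in> J \<Longrightarrow> E i \<in> sets \<mu>" by metis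
    obtain M where M: "J \<subseteq> {..<M}" using finite_nat_iff_bounded[of J] J by blast
    have AS: "A \<in> sets S" unfolding A using J E by (intro sets_PiM_I) auto
    show ?case
    proof (rule dens_eventually[OF bsi[OF AS], of M])
      fix m x assume m: "M \<le> m" and x: "x \<in> space S"
      have "indicator A (comb_seq m x z) = (indicator A x :: real)" if z: "z \<in> space S" for z
      proof -
        have "restrict (comb_seq m x z) J = restrict x J"
        proof (rule restrict_ext)
          fix k assume "k \<in> J"
          then have "k < m" using M m by auto
          then show "comb_seq m x z k = x k" by (rule comb_seq_less)
        qed
        moreover have "\<forall>i. comb_seq m x z i \<in> space \<mu>" "\<forall>i. x i \<in> space \<mu>"
          using comb_in_space[OF x z] x by (auto simp: space_PiM PiE_iff)
        ultimately have "comb_seq m x z \<in> A \<longleftrightarrow> x \<in> A" unfolding A by (simp add: prod_emb_iff)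
        then show ?thesis by (simp add: indicator_def)
      qed
      then have "cut m (indicator A) x = (\<integral>z. indicator A x \<partial>S)"
        unfolding cut_def by (intro Bochner_Integration.integral_cong) auto
      then show "cut m (indicator A) x = indicator A x" by (simp add: SS.P.prob_space)
    qed
  next
    case empty
    show ?case using dens_const[of 0] by (simp add: indicator_def[abs_def])
  next
    case (compl A)
    show ?case
      by (rule dens_cong[OF dens_add[OF dens_const[of 1] dens_cmult[OF compl(2), of "-1"]]])
         (auto simp: indicator_def)
  next
    case (union A)
    have A: "A i \<in> sets S" for i using union(2) by (auto simp: sets_PiM sp)
    have sums: "(\<lambda>i. indicator (A i) x :: real) sums indicator (\<Union>i. A i) x" for x
      using union(1) by (intro indicator_sums) (auto simp: disjoint_family_on_def)
    show ?case
    proof (rule dens_mono_limit[where U="\<lambda>n x. \<Sum>i<n. indicator (A i) x"])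
      show "dens (\<lambda>x. \<Sum>i<n. indicator (A i) x)" for n by (intro dens_sum union)
      show "bs (indicator (\<Union>i. A i))" using A by (intro bsi) auto
      show "(\<lambda>n. \<Sum>i<n. indicator (A i) x) \<longlonglongrightarrow> (indicator (\<Union>i. A i) x :: real)" for x
        using sums[of x] by (simp add: sums_def)
      show "0 \<le> (\<Sum>i<n. indicator (A i) x :: real) \<and> (\<Sum>i<n. indicator (A i) x) \<le> (indicator (\<Union>i. A i) x :: real)" for n x
        using sum_le_suminf[OF sums_summable[OF sums[of x]], of "{..<n}"] sums_unique[OF sums[of x]]
        by (auto intro: sum_nonneg)
    qed
  qed
qed

lemma dens_bounded:
  assumes "bs f" shows "dens f"
proof -
  \<comment> \<open>Boundedness is part of the claim as an implication, since the induction has to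
    pass it on to the pieces of the function.\<close>
  have pos: "(\<exists>C. \<forall>x\<in>space S. u x \<le> C) \<longrightarrow> dens u" if "u \<in> borel_measurable S" "\<And>x. 0 \<le> u x" for u
    using that
  proof (induction rule: borel_measurable_induct_real)
    case (set A)
    then show ?case by (simp add: dens_indicator)
  next
    case (mult u c)
    show ?case
    proof (cases "c = 0")
      case True
      then show ?thesis by (simp add: dens_const)
    next
      case False
      show ?thesis
      proof
        assume "\<exists>C. \<forall>x\<in>space S. c * u x \<le> C"
        then obtain C where "\<forall>x\<in>space S. c * u x \<le> C" by blast
        then have "\<forall>x\<in>space S. u x \<le> C / c" using mult(1) False by (auto simp: field_simps)
        then show "dens (\<lambda>x. c * u x)" using mult.IH by (intro dens_cmult) blast
      qed
    qed
  next
    case (add u v)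
    show ?case
    proof
      assume "\<exists>C. \<forall>x\<in>space S. v x + u x \<le> C"
      then obtain C where C: "\<forall>x\<in>space S. v x + u x \<le> C" by blast
      have "\<forall>x\<in>space S. v x \<le> C" "\<forall>x\<in>space S. u x \<le> C"
        using C add.hyps(2) add.hyps(4) by (smt (verit))+
      then show "dens (\<lambda>x. v x + u x)" using add.IH by (intro dens_add) blast+
    qed
  next
    case (seq U)
    show ?case
    proof
      assume "\<exists>C. \<forall>x\<in>space S. u x \<le> C"
      then obtain C where C: "\<forall>x\<in>space S. u x \<le> C" by blast
      have le: "U i x \<le> u x" if "x \<in> space S" for i x
        using seq.hyps(3) seq.hyps(4)[OF that] by (intro incseq_le[of "\<lambda>i. U i x"]) (auto simp: incseq_def le_fun_def)
      have "\<exists>C. \<forall>x\<in>space S. U i x \<le> C" for i using C le by (meson order_trans)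
      then have d: "dens (U i)" for i using seq.IH by blast
      have "bs u" using that C unfolding bs_def by (intro conjI exI[of _ C]) auto
      then show "dens u" using le seq.hyps(2,4) by (intro dens_mono_limit[OF d]) auto
    qed
  qed
  obtain C where C: "0 \<le> C" "\<And>x. x \<in> space S \<Longrightarrow> \<bar>f x\<bar> \<le> C" using bs_bound[OF assms] by blast
  have [measurable]: "f \<in> borel_measurable S" using assms by (simp add: bs_def)
  \<comment> \<open>The shift by C makes f nonnegative on the space; the maximum does so elsewhere,
    where the bound C says nothing.\<close>
  have "dens (\<lambda>x. max 0 (f x + C))"
  proof (rule pos[rule_format])
    show "\<exists>D. \<forall>x\<in>space S. max 0 (f x + C) \<le> D" using C by (intro exI[of _ "2 * C"]) force
  qed auto
  from dens_add[OF this dens_const[of "- C"]] show ?thesis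
    by (rule dens_cong) (use C in \<open>force simp: max_def\<close>)
qed

text \<open>L1 convergence suffices for bounded f, because |y| \<le> 2C gives y^4 \<le> (2C)^3
  |y|.\<close>

lemma cut_L4:
  assumes "bs f" shows "(\<lambda>m. nrm 4 S (\<lambda>x. f x - cut m f x)) \<longlonglongrightarrow> 0"
proof -
  obtain C where C: "0 \<le> C" "\<And>x. x \<in> space S \<Longrightarrow> \<bar>f x\<bar> \<le> C" using bs_bound[OF assms] by blast
  have cutC: "\<bar>cut m f x\<bar> \<le> C" if "x \<in> space S" for m x
  proof -
    have "\<bar>cut m f x\<bar> \<le> (\<integral>z. \<bar>f (comb_seq m x z)\<bar> \<partial>S)" unfolding cut_def by (rule integral_abs_bound)
    also have "\<dots> \<le> (\<integral>z. C \<partial>S)"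
      using C that by (intro integral_mono bs_integrable bs_abs bs_const bs_section[OF assms]) (auto simp: comb_in_space)
    finally show ?thesis by (simp add: SS.P.prob_space)
  qed
  have b: "bs (\<lambda>x. f x - cut m f x)" for m by (intro bs_diff bs_cut assms)
  have "(\<lambda>m. \<integral>x. (f x - cut m f x) ^ 4 \<partial>S) \<longlonglongrightarrow> 0"
  proof (rule Lim_null_comparison)
    show "(\<lambda>m. (2 * C) ^ 3 * (\<integral>x. \<bar>f x - cut m f x\<bar> \<partial>S)) \<longlonglongrightarrow> 0"
      using dens_bounded[OF assms] by (intro tendsto_mult_right_zero) (simp add: dens_def)
    have "(\<integral>x. (f x - cut m f x) ^ 4 \<partial>S) \<le> (\<integral>x. (2 * C) ^ 3 * \<bar>f x - cut m f x\<bar> \<partial>S)" for m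
    proof (rule integral_mono)
      show "integrable S (\<lambda>x. (f x - cut m f x) ^ 4)" using bs_Lq[OF b] by (auto simp: Lq_def)
      show "integrable S (\<lambda>x. (2 * C) ^ 3 * \<bar>f x - cut m f x\<bar>)" by (intro bs_integrable bs_mult bs_const bs_abs b)
      fix x assume x: "x \<in> space S"
      have "\<bar>f x - cut m f x\<bar> \<le> 2 * C" using C(2)[OF x] cutC[OF x, of m] by linarith
      then have "\<bar>f x - cut m f x\<bar> ^ 3 * \<bar>f x - cut m f x\<bar> \<le> (2 * C) ^ 3 * \<bar>f x - cut m f x\<bar>"
        by (intro mult_right_mono power_mono) auto
      moreover have "\<bar>y\<bar> ^ 3 * \<bar>y\<bar> = y ^ 4" for y :: real
        by (simp add: power_even_abs[of 4 y, symmetric] eval_nat_numeral)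
      ultimately show "(f x - cut m f x) ^ 4 \<le> (2 * C) ^ 3 * \<bar>f x - cut m f x\<bar>" by simp
    qed
    then show "\<forall>\<^sub>F m in sequentially. norm (\<integral>x. (f x - cut m f x) ^ 4 \<partial>S) \<le> (2 * C) ^ 3 * (\<integral>x. \<bar>f x - cut m f x\<bar> \<partial>S)"
      by (intro always_eventually) (auto intro: integral_nonneg_AE)
  qed
  from tendsto_real_root[OF this, of 4] show ?thesis by (simp add: nrm_def)
qed

definition clamp :: "real \<Rightarrow> real \<Rightarrow> real" where "clamp R y = max (- R) (min R y)"

lemma clamp_lipschitz: "\<bar>clamp R y - clamp R z\<bar> \<le> \<bar>y - z\<bar>"
  by (auto simp: clamp_def max_def min_def abs_if)

lemma clamp_error: "0 \<le> R \<Longrightarrow> \<bar>y - clamp R y\<bar> \<le> \<bar>y\<bar>"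
  by (auto simp: clamp_def max_def min_def abs_if)

lemma bs_clamp: assumes "g \<in> borel_measurable S" shows "bs (\<lambda>x. clamp R (g x))"
proof -
  have "\<bar>clamp R y\<bar> \<le> \<bar>R\<bar>" for y by (auto simp: clamp_def max_def min_def abs_if)
  moreover have "(\<lambda>x. clamp R (g x)) \<in> borel_measurable S" using assms unfolding clamp_def by measurable
  ultimately show ?thesis by (auto simp: bs_def)
qed

lemma clamp_L4:
  assumes "g \<in> Lq 4 S" shows "(\<lambda>k. nrm 4 S (\<lambda>x. g x - clamp (real k) (g x))) \<longlonglongrightarrow> 0"
proof -
  have [measurable]: "g \<in> borel_measurable S" and i: "integrable S (\<lambda>x. g x ^ 4)" using assms by (auto simp: Lq_def)
  have [measurable]: "(\<lambda>x. clamp (real k) (g x)) \<in> borel_measurable S" for k using bs_clamp[of g k] by (simp add: bs_def)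
  have "(\<lambda>k. \<integral>x. (g x - clamp (real k) (g x)) ^ 4 \<partial>S) \<longlonglongrightarrow> (\<integral>x. 0 \<partial>S)"
  proof (rule integral_dominated_convergence[where w="\<lambda>x. g x ^ 4"])
    show "integrable S (\<lambda>x. g x ^ 4)" by (rule i)
    show "AE x in S. (\<lambda>k. (g x - clamp (real k) (g x)) ^ 4) \<longlonglongrightarrow> 0"
    proof (rule AE_I2)
      fix x
      obtain K :: nat where K: "\<bar>g x\<bar> \<le> real K" using real_arch_simple by blast
      have "(g x - clamp (real k) (g x)) ^ 4 = 0" if "K \<le> k" for k
      proof -
        have "\<bar>g x\<bar> \<le> real k" using K that by linarith
        then show ?thesis by (auto simp: clamp_def max_def min_def)
      qed
      then show "(\<lambda>k. (g x - clamp (real k) (g x)) ^ 4) \<longlonglongrightarrow> 0"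
        by (intro tendsto_eventually eventually_sequentiallyI[of K]) auto
    qed
    show "AE x in S. norm ((g x - clamp (real k) (g x)) ^ 4) \<le> g x ^ 4" for k
    proof (rule AE_I2)
      fix x
      have "\<bar>g x - clamp (real k) (g x)\<bar> ^ 4 \<le> \<bar>g x\<bar> ^ 4" by (intro power_mono clamp_error) auto
      then show "norm ((g x - clamp (real k) (g x)) ^ 4) \<le> g x ^ 4" by (simp add: power_even_abs)
    qed
  qed auto
  from tendsto_real_root[OF this, of 4] show ?thesis by (simp add: nrm_def)
qed

subsection \<open>Physical dependence on the sequence space\<close>

text \<open>\<open>Dn g i\<close> is the coefficient \<open>\<delta>\<^sub>4(i)\<close>.\<close>

definition Dn :: "((nat \<Rightarrow> 'b) \<Rightarrow> real) \<Rightarrow> nat \<Rightarrow> real" where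
  "Dn g i = nrm 4 (S \<Otimes>\<^sub>M \<mu>) (\<lambda>xy. g (fst xy) - g ((fst xy)(i := snd xy)))"

lemma Dn_nonneg: "0 \<le> Dn g i"
  by (simp add: Dn_def nrm_nonneg)

lemma prob_space_Smu: "prob_space (S \<Otimes>\<^sub>M \<mu>)"
proof -
  interpret pair_prob_space S \<mu> by unfold_locales
  show ?thesis by unfold_locales
qed

lemma measurable_updS [measurable]: "(\<lambda>xy. (fst xy)(i := snd xy)) \<in> S \<Otimes>\<^sub>M \<mu> \<rightarrow>\<^sub>M S"
  using measurable_add_dim[of i UNIV "\<lambda>_. \<mu>"] by (simp add: split_beta')

lemma updS_in_space: "x \<in> space S \<Longrightarrow> y \<in> space \<mu> \<Longrightarrow> x(i := y) \<in> space S"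
  by (auto simp: space_PiM PiE_iff)

lemma distr_fstS: "distr (S \<Otimes>\<^sub>M \<mu>) S fst = S"
  by (rule prob_space.distr_pair_fst) (rule prob_space_axioms)

lemma distr_updS: "distr (S \<Otimes>\<^sub>M \<mu>) S (\<lambda>xy. (fst xy)(i := snd xy)) = S"
proof -
  interpret pair_sigma_finite S \<mu> ..
  have "distr (S \<Otimes>\<^sub>M \<mu>) S (\<lambda>xy. (fst xy)(i := snd xy))
      = distr (distr (S \<Otimes>\<^sub>M \<mu>) (\<mu> \<Otimes>\<^sub>M S) (\<lambda>(x, y). (y, x))) S (\<lambda>(y, x). x(i := y))"
    by (subst distr_distr) (auto simp: comp_def split_beta' intro!: measurable_compose[OF measurable_pair_swap' measurable_updS, unfolded split_beta', simplified])
  also have "distr (S \<Otimes>\<^sub>M \<mu>) (\<mu> \<Otimes>\<^sub>M S) (\<lambda>(x, y). (y, x)) = \<mu> \<Otimes>\<^sub>M S"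
    by (rule pair_sigma_finite.distr_pair_swap[symmetric]) unfold_locales
  also have "distr (\<mu> \<Otimes>\<^sub>M S) S (\<lambda>(y, x). x(i := y)) = S"
    using distr_pair_PiM_eq_PiM[of UNIV "\<lambda>_. \<mu>" i] prob_space_axioms by simp
  finally show ?thesis .
qed

lemma Lq_Smu:
  assumes "g \<in> Lq q S"
  shows "(\<lambda>xy. g (fst xy)) \<in> Lq q (S \<Otimes>\<^sub>M \<mu>)" "(\<lambda>xy. g ((fst xy)(i := snd xy))) \<in> Lq q (S \<Otimes>\<^sub>M \<mu>)"
    and "nrm q (S \<Otimes>\<^sub>M \<mu>) (\<lambda>xy. g (fst xy)) = nrm q S g"
    and "nrm q (S \<Otimes>\<^sub>M \<mu>) (\<lambda>xy. g ((fst xy)(i := snd xy))) = nrm q S g"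
proof -
  have m: "fst \<in> S \<Otimes>\<^sub>M \<mu> \<rightarrow>\<^sub>M S" by simp
  show "(\<lambda>xy. g (fst xy)) \<in> Lq q (S \<Otimes>\<^sub>M \<mu>)" "(\<lambda>xy. g ((fst xy)(i := snd xy))) \<in> Lq q (S \<Otimes>\<^sub>M \<mu>)"
    using Lq_distr[OF m LqD(1)[OF assms]] Lq_distr[OF measurable_updS[of i] LqD(1)[OF assms]] assms
    by (simp_all add: distr_fstS distr_updS)
  show "nrm q (S \<Otimes>\<^sub>M \<mu>) (\<lambda>xy. g (fst xy)) = nrm q S g"
    "nrm q (S \<Otimes>\<^sub>M \<mu>) (\<lambda>xy. g ((fst xy)(i := snd xy))) = nrm q S g"
    using nrm_distr[OF m LqD(1)[OF assms]] nrm_distr[OF measurable_updS[of i] LqD(1)[OF assms]]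
    by (simp_all add: distr_fstS distr_updS)
qed

lemma Dn_diff_Lq: "g \<in> Lq 4 S \<Longrightarrow> (\<lambda>xy. g (fst xy) - g ((fst xy)(i := snd xy))) \<in> Lq 4 (S \<Otimes>\<^sub>M \<mu>)"
  by (intro Lq_diff Lq_Smu) auto

lemma Dn_le_nrm: "g \<in> Lq 4 S \<Longrightarrow> Dn g i \<le> 2 * nrm 4 S g"
  unfolding Dn_def using Lq_diff(2)[of 4 "\<lambda>xy. g (fst xy)" "S \<Otimes>\<^sub>M \<mu>" "\<lambda>xy. g ((fst xy)(i := snd xy))"] Lq_Smu[of g 4]
  by simp

lemma Dn_add_diff:
  assumes u: "u \<in> Lq 4 S" and v: "v \<in> Lq 4 S"
  shows "Dn (\<lambda>x. u x + v x) i \<le> Dn u i + Dn v i" "Dn (\<lambda>x. u x - v x) i \<le> Dn u i + Dn v i"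
proof -
  have a: "(u (fst xy) + v (fst xy)) - (u ((fst xy)(i := snd xy)) + v ((fst xy)(i := snd xy)))
      = (u (fst xy) - u ((fst xy)(i := snd xy))) + (v (fst xy) - v ((fst xy)(i := snd xy)))"
    and b: "(u (fst xy) - v (fst xy)) - (u ((fst xy)(i := snd xy)) - v ((fst xy)(i := snd xy)))
      = (u (fst xy) - u ((fst xy)(i := snd xy))) - (v (fst xy) - v ((fst xy)(i := snd xy)))" for xy
    by simp_all
  show "Dn (\<lambda>x. u x + v x) i \<le> Dn u i + Dn v i"
    unfolding Dn_def a by (intro Lq_add Dn_diff_Lq u v) auto
  show "Dn (\<lambda>x. u x - v x) i \<le> Dn u i + Dn v i"
    unfolding Dn_def b by (intro Lq_diff Dn_diff_Lq u v) auto
qed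

text \<open>X_t minus its average over innovation j is the mean of X_t - X_t' over the new value, so
  Jensen and Fubini bound it by the resampling distance at lag t - j. Innovations later than t have
  no influence.\<close>

lemma infl_le_Dn:
  assumes k: "kern m h"
  shows "infl 4 j (Xp h t) \<le> (if 0 \<le> t - j then Dn h (nat (t - j)) else 0)"
proof (cases "j \<le> t")
  case False
  have "free j (Xp h t)" using False by (intro dep_free[OF dep_Xp[OF k]]) auto
  then show ?thesis using False by (simp add: infl_free)
next
  case True
  define i where "i = nat (t - j)"
  have [measurable]: "h \<in> borel_measurable S" by (rule kern_measurable[OF k])
  obtain C where C: "\<And>x. x \<in> space S \<Longrightarrow> \<bar>h x\<bar> \<le> C" using kern_bounded[OF k] by blast
  define H where "H x y = (h x - h (x(i := y))) ^ 4" for x y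
  have Hle: "\<bar>H x y\<bar> \<le> (2 * C) ^ 4" if "x \<in> space S" "y \<in> space \<mu>" for x y
  proof -
    have "\<bar>h x - h (x(i := y))\<bar> \<le> 2 * C" using C[OF that(1)] C[OF updS_in_space[OF that, of i]] by linarith
    then have "\<bar>h x - h (x(i := y))\<bar> ^ 4 \<le> (2 * C) ^ 4" by (intro power_mono) auto
    then show ?thesis by (simp add: H_def power_abs)
  qed
  have Hm [measurable]: "(\<lambda>xy. H (fst xy) (snd xy)) \<in> borel_measurable (S \<Otimes>\<^sub>M \<mu>)" unfolding H_def by measurable
  have m: "(\<lambda>x. \<integral>y. H x y \<partial>\<mu>) \<in> borel_measurable S" by (rule borel_measurable_lebesgue_integral) (use Hm in \<open>simp add: split_beta'\<close>)
  note int_bound = integrable_const_bound and prob_mu = prob_space and jensen_mu = power_expectation_le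
  interpret pair_prob_space S \<mu> by unfold_locales
  have Hi: "integrable (S \<Otimes>\<^sub>M \<mu>) (\<lambda>xy. H (fst xy) (snd xy))"
    using Hle by (intro integrable_const_bound[of _ "(2 * C) ^ 4"]) (auto simp: space_pair_measure)
  have up: "Xp h t (x(j := y)) = h ((\<lambda>k. x (t - int k))(i := y))" for x y
  proof -
    have "(\<lambda>k. (x(j := y)) (t - int k)) = (\<lambda>k. x (t - int k))(i := y)" using True by (auto simp: i_def fun_eq_iff)
    then show ?thesis by (simp add: Xp_def)
  qed
  have bX: "bm (Xp h t)" by (rule bm_Xp[OF k])
  have "(\<integral>x. (Xp h t x - avg j (Xp h t) x) ^ 4 \<partial>P) \<le> (\<integral>x. (\<integral>y. H (\<lambda>k. x (t - int k)) y \<partial>\<mu>) \<partial>P)"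
  proof (rule integral_mono)
    show "integrable P (\<lambda>x. (Xp h t x - avg j (Xp h t) x) ^ 4)" by (intro bm_integrable bm_intros bX)
    have "(\<lambda>x. \<integral>y. H (\<lambda>k. x (t - int k)) y \<partial>\<mu>) \<in> borel_measurable P" using measurable_compose[OF measurable_past m] .
    moreover have "\<bar>\<integral>y. H (\<lambda>k. x (t - int k)) y \<partial>\<mu>\<bar> \<le> (2 * C) ^ 4" if x: "x \<in> space P" for x
    proof -
      have pa: "(\<lambda>k. x (t - int k)) \<in> space S" using past_in_space[OF x] .
      have "H (\<lambda>k. x (t - int k)) \<in> borel_measurable \<mu>"
        using measurable_Pair2[OF Hm pa] by simp
      then have "integrable \<mu> (H (\<lambda>k. x (t - int k)))" using Hle[OF pa] by (intro int_bound[of _ "(2 * C) ^ 4"]) auto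
      then have "(\<integral>y. \<bar>H (\<lambda>k. x (t - int k)) y\<bar> \<partial>\<mu>) \<le> (\<integral>y. (2 * C) ^ 4 \<partial>\<mu>)" using Hle[OF pa] by (intro integral_mono) auto
      then show ?thesis by (intro order_trans[OF integral_abs_bound]) (simp add: prob_mu)
    qed
    ultimately show "integrable P (\<lambda>x. \<integral>y. H (\<lambda>k. x (t - int k)) y \<partial>\<mu>)"
      by (intro bm_integrable) (auto simp: bm_def)
    fix x assume x: "x \<in> space P"
    have b1: "bm (\<lambda>z. Xp h t x - Xp h t z)" by (intro bm_diff bm_const bX)
    have "Xp h t x - avg j (Xp h t) x = (\<integral>y. Xp h t x - Xp h t (x(j := y)) \<partial>\<mu>)"
      unfolding avg_def using bm_section[OF bX x] by (simp add: prob_mu)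
    also have "\<dots> ^ 4 \<le> (\<integral>y. (Xp h t x - Xp h t (x(j := y))) ^ 4 \<partial>\<mu>)"
      using bm_section[OF b1 x] bm_section[OF bm_power[OF b1] x] by (intro jensen_mu) auto
    also have "\<dots> = (\<integral>y. H (\<lambda>k. x (t - int k)) y \<partial>\<mu>)" unfolding up H_def by (simp add: Xp_def)
    finally show "(Xp h t x - avg j (Xp h t) x) ^ 4 \<le> (\<integral>y. H (\<lambda>k. x (t - int k)) y \<partial>\<mu>)" .
  qed
  also have "\<dots> = (\<integral>x. (\<integral>y. H x y \<partial>\<mu>) \<partial>S)"
  proof -
    show ?thesis using integral_distr[OF measurable_past[of t] m] by (simp add: distr_past)
  qed
  also have "\<dots> = (\<integral>xy. H (fst xy) (snd xy) \<partial>(S \<Otimes>\<^sub>M \<mu>))"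
    using integral_fst'[OF Hi] by simp
  also have "\<dots> = Dn h i ^ 4" by (simp add: Dn_def nrm_power H_def)
  finally have "infl 4 j (Xp h t) ^ 4 \<le> Dn h i ^ 4" by (simp add: infl_def nrm_power)
  then have "infl 4 j (Xp h t) \<le> Dn h i" by (rule power_le_imp_le_base[of _ 3, simplified]) (rule Dn_nonneg)
  then show ?thesis using True by (simp add: i_def)
qed

text \<open>Formulated with a summable majorant D because for sums and differences of kernels the
  coefficients are known only through such bounds. Negative lags carry weight 0.\<close>

lemma profile_Dn:
  assumes k: "kern m h" and D: "\<And>i. Dn h i \<le> D i" "summable D"
  shows "profile h (\<lambda>i. if 0 \<le> i then D (nat i) else 0) (suminf D)"
  unfolding profile_def
proof (intro conjI allI impI)
  have D0: "0 \<le> D i" for i using Dn_nonneg[of h i] D(1)[of i] by linarith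
  then show "0 \<le> (if 0 \<le> i then D (nat i) else 0)" for i by simp
  show "infl 4 j (Xp h t) \<le> (if 0 \<le> t - j then D (nat (t - j)) else 0)" for t j
    using infl_le_Dn[OF k, of j t] D(1)[of "nat (t - j)"] by (auto split: if_splits)
  fix F :: "int set" assume F: "finite F"
  have "(\<Sum>i\<in>F. if 0 \<le> i then D (nat i) else 0) = (\<Sum>i\<in>F \<inter> {0..}. D (nat i))"
    using F by (subst sum.inter_restrict) auto
  also have "\<dots> = sum D (nat ` (F \<inter> {0..}))" by (subst sum.reindex) (auto simp: inj_on_def)
  also have "\<dots> \<le> suminf D" using F D0 by (intro sum_le_suminf D(2)) auto
  finally show "(\<Sum>i\<in>F. if 0 \<le> i then D (nat i) else 0) \<le> suminf D" .
qed

lemma Dn_clamp_le: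
  assumes "g \<in> Lq 4 S" shows "Dn (\<lambda>x. clamp R (g x)) i \<le> Dn g i"
proof -
  have [measurable]: "(\<lambda>x. clamp R (g x)) \<in> borel_measurable S" using bs_clamp[OF LqD(1)[OF assms]] by (simp add: bs_def)
  show ?thesis unfolding Dn_def
    by (rule Lq_mono(2)[OF _ Dn_diff_Lq[OF assms]]) (auto intro: clamp_lipschitz)
qed

lemma cut_range: "(\<And>k. k < m \<Longrightarrow> x k = x' k) \<Longrightarrow> cut m f x = cut m f x'"
proof -
  assume "\<And>k. k < m \<Longrightarrow> x k = x' k"
  then have "comb_seq m x z = comb_seq m x' z" for z by (auto simp: comb_seq_def fun_eq_iff)
  then show "cut m f x = cut m f x'" by (simp add: cut_def)
qed

text \<open>For i < m, replacing coordinate i commutes with \<open>cut m\<close>, so the increment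
  of \<open>cut m f\<close> is a conditional mean of the increment of f and Jensen applies; for i
  \<ge> m the increment is zero.\<close>

lemma Dn_cut_le:
  assumes f: "bs f" shows "Dn (cut m f) i \<le> Dn f i"
proof (cases "i < m")
  case False
  then have "cut m f x = cut m f (x(i := y))" for x y by (intro cut_range) auto
  then have "Dn (cut m f) i = nrm 4 (S \<Otimes>\<^sub>M \<mu>) (\<lambda>xy. 0)" unfolding Dn_def by (intro nrm_cong) auto
  then show ?thesis using Dn_nonneg by (simp add: nrm_zero)
next
  case True
  have [measurable]: "f \<in> borel_measurable S" using f by (rule bs_measurable)
  obtain C where C: "\<And>x. x \<in> space S \<Longrightarrow> \<bar>f x\<bar> \<le> C" using bs_bound[OF f] by blast
  define F where "F x y = (f x - f (x(i := y))) ^ 4" for x y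
  have b: "bs (\<lambda>x. F x y)" if y: "y \<in> space \<mu>" for y
  proof -
    have [measurable]: "(\<lambda>x. x(i := y)) \<in> S \<rightarrow>\<^sub>M S"
      using measurable_compose[OF measurable_Pair[OF measurable_ident measurable_const[OF y]] measurable_updS[of i]] by simp
    have "\<bar>F x y\<bar> \<le> (2 * C) ^ 4" if x: "x \<in> space S" for x
    proof -
      have "\<bar>f x - f (x(i := y))\<bar> \<le> 2 * C" using C[OF x] C[OF updS_in_space[OF x y, of i]] by linarith
      then have "\<bar>f x - f (x(i := y))\<bar> ^ 4 \<le> (2 * C) ^ 4" by (intro power_mono) auto
      then show ?thesis by (simp add: F_def power_abs)
    qed
    moreover have "(\<lambda>x. F x y) \<in> borel_measurable S" unfolding F_def by measurable
    ultimately show ?thesis by (auto simp: bs_def)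
  qed
  have comb: "comb_seq m (x(i := y)) z = (comb_seq m x z)(i := y)" for x y z
    using True by (auto simp: comb_seq_def fun_eq_iff)
  interpret pair_prob_space S \<mu> by unfold_locales
  have fub: "(\<integral>xy. (u (fst xy) - u ((fst xy)(i := snd xy))) ^ 4 \<partial>(S \<Otimes>\<^sub>M \<mu>)) = (\<integral>y. \<integral>x. (u x - u (x(i := y))) ^ 4 \<partial>S \<partial>\<mu>)"
    if u: "bs u" for u
    using integral_snd[of "\<lambda>x y. (u x - u (x(i := y))) ^ 4"] LqD(2)[OF Dn_diff_Lq[OF bs_Lq[OF u]], of i]
    by (simp add: split_beta')
  have meas: "(\<lambda>y. \<integral>x. (u x - u (x(i := y))) ^ 4 \<partial>S) \<in> borel_measurable \<mu>"
    "integrable \<mu> (\<lambda>y. \<integral>x. (u x - u (x(i := y))) ^ 4 \<partial>S)" if u: "bs u" for u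
    using integrable_snd[of "\<lambda>x y. (u x - u (x(i := y))) ^ 4"] LqD(2)[OF Dn_diff_Lq[OF bs_Lq[OF u]], of i]
    by (auto simp: split_beta')
  have "Dn (cut m f) i ^ 4 = (\<integral>y. \<integral>x. (cut m f x - cut m f (x(i := y))) ^ 4 \<partial>S \<partial>\<mu>)"
    using fub[OF bs_cut[OF f]] by (simp add: Dn_def nrm_power)
  also have "\<dots> \<le> (\<integral>y. \<integral>x. F x y \<partial>S \<partial>\<mu>)"
  proof (rule integral_mono[OF meas(2)[OF bs_cut[OF f]]])
    show "integrable \<mu> (\<lambda>y. \<integral>x. F x y \<partial>S)" unfolding F_def by (rule meas(2)[OF f])
    fix y assume y: "y \<in> space \<mu>"
    have "(\<integral>x. (cut m f x - cut m f (x(i := y))) ^ 4 \<partial>S) \<le> (\<integral>x. cut m (\<lambda>x. F x y) x \<partial>S)"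
    proof (rule integral_mono)
      have mu: "(\<lambda>x. x(i := y)) \<in> S \<rightarrow>\<^sub>M S"
        using measurable_compose[OF measurable_Pair[OF measurable_ident measurable_const[OF y]] measurable_updS[of i]] by simp
      have "bs (\<lambda>x. cut m f (x(i := y)))"
        using bs_cut[OF f, of m] measurable_compose[OF mu, of "cut m f" borel] updS_in_space[OF _ y] unfolding bs_def by blast
      then have b4: "bs (\<lambda>x. cut m f x - cut m f (x(i := y)))" by (intro bs_diff bs_cut f)
      show "integrable S (\<lambda>x. (cut m f x - cut m f (x(i := y))) ^ 4)" using bs_Lq[OF b4] by (auto simp: Lq_def)
      show "integrable S (cut m (\<lambda>x. F x y))" by (intro bs_integrable bs_cut b y)
      fix x assume x: "x \<in> space S"
      have xy: "x(i := y) \<in> space S" using x y by (rule updS_in_space)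
      define w where "w z = f (comb_seq m x z) - f (comb_seq m (x(i := y)) z)" for z
      have bw: "bs w" unfolding w_def by (intro bs_diff bs_section f x xy)
      have "cut m f x - cut m f (x(i := y)) = (\<integral>z. w z \<partial>S)"
        unfolding cut_def w_def by (simp add: bs_integrable bs_section f x xy)
      also have "\<dots> ^ 4 \<le> (\<integral>z. w z ^ 4 \<partial>S)"
        using bs_integrable[OF bw] LqD(2)[OF bs_Lq[OF bw, of 4]] by (intro SS.P.power_expectation_le) auto
      also have "\<dots> = cut m (\<lambda>x. F x y) x" by (simp add: cut_def w_def F_def comb)
      finally show "(cut m f x - cut m f (x(i := y))) ^ 4 \<le> cut m (\<lambda>x. F x y) x" .
    qed
    then show "(\<integral>x. (cut m f x - cut m f (x(i := y))) ^ 4 \<partial>S) \<le> (\<integral>x. F x y \<partial>S)"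
      by (simp add: integral_cut b y)
  qed
  also have "\<dots> = Dn f i ^ 4" unfolding F_def using fub[OF f] by (simp add: Dn_def nrm_power)
  finally show ?thesis by (rule power_le_imp_le_base[of _ 3, simplified]) (rule Dn_nonneg)
qed

text \<open>Truncation, cutting and recentring, each within e/3. The recentring constant is at most
  the truncation error because g has mean zero, and constants do not affect \<open>Dn\<close>.
  Domination by the coefficients of g is what later permits dominated convergence of their
  sums.\<close>

lemma kern_approx:
  assumes g: "g \<in> Lq 4 S" "(\<integral>x. g x \<partial>S) = 0" and e: "0 < e"
  shows "\<exists>m h. kern m h \<and> (\<forall>i. Dn h i \<le> Dn g i) \<and> nrm 4 S (\<lambda>x. g x - h x) < e"
proof -
  obtain k :: nat where k: "nrm 4 S (\<lambda>x. g x - clamp (real k) (g x)) < e / 3"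
    using order_tendstoD(2)[OF clamp_L4[OF g(1)], of "e / 3"] e by (auto simp: eventually_sequentially)
  define f where "f x = clamp (real k) (g x)" for x
  have f: "bs f" unfolding f_def by (rule bs_clamp[OF LqD(1)[OF g(1)]])
  obtain m where m: "nrm 4 S (\<lambda>x. f x - cut m f x) < e / 3"
    using order_tendstoD(2)[OF cut_L4[OF f], of "e / 3"] e by (auto simp: eventually_sequentially)
  define c where "c = (\<integral>x. f x \<partial>S)"
  have fL: "f \<in> Lq 4 S" "cut m f \<in> Lq 4 S" by (intro bs_Lq bs_cut f)+
  have gf: "(\<lambda>x. g x - f x) \<in> Lq 4 S" by (intro Lq_diff g fL) auto
  have c: "\<bar>c\<bar> < e / 3"
  proof -
    have ig: "integrable S g" by (intro SS.P.Lq_2_integrable SS.P.Lq_4_2 g)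
    have "(\<integral>x. g x - f x \<partial>S) = - c" using ig bs_integrable[OF f] g(2) by (simp add: c_def)
    then have "\<bar>c\<bar> = \<bar>\<integral>x. g x - f x \<partial>S\<bar>" by simp
    also have "\<dots> \<le> nrm 2 S (\<lambda>x. g x - f x)" by (intro SS.P.Lq_2_integrable SS.P.Lq_4_2 gf)
    also have "\<dots> \<le> nrm 4 S (\<lambda>x. g x - f x)" by (intro SS.P.Lq_4_2 gf)
    finally show ?thesis using k by (simp add: f_def)
  qed
  define h where "h x = cut m f x - c" for x
  have bh: "bs h" unfolding h_def by (intro bs_diff bs_cut f bs_const)
  have "kern m h" unfolding kern_def
  proof (intro conjI ballI impI)
    show "h \<in> borel_measurable S" "\<exists>C. \<forall>x\<in>space S. \<bar>h x\<bar> \<le> C" using bh by (auto simp: bs_def)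
    show "(\<integral>x. h x \<partial>S) = 0"
      unfolding h_def using bs_integrable[OF bs_cut[OF f]] integral_cut[OF f] by (simp add: c_def SS.P.prob_space)
    fix x x' :: "nat \<Rightarrow> 'b" assume "\<forall>k<m. x k = x' k"
    then show "h x = h x'" unfolding h_def by (intro arg_cong2[where f="(-)"] cut_range refl) auto
  qed
  moreover have "Dn h i \<le> Dn g i" for i
  proof -
    have "Dn h i = Dn (cut m f) i" by (simp add: Dn_def h_def)
    also have "\<dots> \<le> Dn f i" by (rule Dn_cut_le[OF f])
    also have "\<dots> \<le> Dn g i" unfolding f_def by (rule Dn_clamp_le[OF g(1)])
    finally show ?thesis .
  qed
  moreover have "nrm 4 S (\<lambda>x. g x - h x) < e"
  proof -
    have "nrm 4 S (\<lambda>x. g x - h x) = nrm 4 S (\<lambda>x. (g x - f x) + ((f x - cut m f x) + c))"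
      by (simp add: h_def algebra_simps)
    also have "\<dots> \<le> nrm 4 S (\<lambda>x. g x - f x) + nrm 4 S (\<lambda>x. (f x - cut m f x) + c)"
      by (intro Lq_add gf Lq_diff fL SS.P.Lq_const) auto
    also have "nrm 4 S (\<lambda>x. (f x - cut m f x) + c) \<le> nrm 4 S (\<lambda>x. f x - cut m f x) + nrm 4 S (\<lambda>x. c)"
      by (intro Lq_add gf Lq_diff fL SS.P.Lq_const) auto
    finally show ?thesis using k m c SS.P.nrm_const[of 4 c] by (simp add: f_def)
  qed
  ultimately show ?thesis by blast
qed

end

section \<open>Exchange of limits, and norm inequalities on a probability space\<close>

lemma nrm_cong_AE:
  assumes "AE x in M. f x = g x" "f \<in> borel_measurable M" "g \<in> borel_measurable M"
  shows "nrm q M f = nrm q M g"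
proof -
  have "(\<integral>x. f x ^ q \<partial>M) = (\<integral>x. g x ^ q \<partial>M)"
    using assms by (intro integral_cong_AE) auto
  then show ?thesis by (simp add: nrm_def)
qed

lemma uniform_approx_limit:
  fixes x :: "nat \<Rightarrow> real" and y :: "nat \<Rightarrow> nat \<Rightarrow> real"
  assumes le: "\<And>r n. 1 \<le> n \<Longrightarrow> \<bar>x n - y r n\<bar> \<le> e r" and e: "e \<longlonglongrightarrow> 0"
    and y: "\<And>r. y r \<longlonglongrightarrow> l r" and l: "l \<longlonglongrightarrow> L"
  shows "x \<longlonglongrightarrow> L"
proof (rule LIMSEQ_I)
  fix s :: real assume s: "0 < s"
  have "\<forall>\<^sub>F r in sequentially. e r < s / 3 \<and> \<bar>l r - L\<bar> < s / 3"
    using order_tendstoD(2)[OF e, of "s / 3"] tendstoD[OF l, of "s / 3"] s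
    by (auto simp: dist_real_def eventually_conj_iff)
  then obtain r where r: "e r < s / 3" "\<bar>l r - L\<bar> < s / 3" by (auto simp: eventually_sequentially)
  obtain n0 where n0: "\<And>n. n0 \<le> n \<Longrightarrow> norm (y r n - l r) < s / 3" using LIMSEQ_D[OF y[of r], of "s / 3"] s by auto
  show "\<exists>no. \<forall>n\<ge>no. norm (x n - L) < s"
  proof (intro exI[of _ "max 1 n0"] allI impI)
    fix n assume "max 1 n0 \<le> n"
    then have "\<bar>x n - y r n\<bar> \<le> e r" "\<bar>y r n - l r\<bar> < s / 3" using le n0[of n] by auto
    then show "norm (x n - L) < s" using r unfolding real_norm_def by linarith
  qed
qed

text \<open>Any two of the limits differ by at most e r + e q, so l is a Cauchy sequence, and its
  limit is also that of x. This is made for \<sigma>, which is defined by \<open>lim\<close>, so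
  that convergence has to be proved along with the value.\<close>

lemma uniform_approx_convergent:
  fixes x :: "nat \<Rightarrow> real" and y :: "nat \<Rightarrow> nat \<Rightarrow> real"
  assumes le: "\<And>r n. \<bar>x n - y r n\<bar> \<le> e r" and e: "e \<longlonglongrightarrow> 0"
    and y: "\<And>r. y r \<longlonglongrightarrow> l r"
  shows "\<exists>L. l \<longlonglongrightarrow> L \<and> x \<longlonglongrightarrow> L"
proof -
  have ll: "\<bar>l r - l q\<bar> \<le> e r + e q" for r q
  proof (rule tendsto_upperbound[OF tendsto_rabs[OF tendsto_diff[OF y[of r] y[of q]]]])
    show "\<forall>\<^sub>F n in sequentially. \<bar>y r n - y q n\<bar> \<le> e r + e q"
    proof (rule always_eventually, rule allI)
      fix n show "\<bar>y r n - y q n\<bar> \<le> e r + e q" using le[of n r] le[of n q] by linarith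
    qed
  qed simp
  have "Cauchy l"
  proof (rule CauchyI)
    fix s :: real assume "0 < s"
    then have "\<forall>\<^sub>F r in sequentially. e r < s / 2" using order_tendstoD(2)[OF e, of "s / 2"] by simp
    then obtain R where R: "\<And>r. R \<le> r \<Longrightarrow> e r < s / 2" by (auto simp: eventually_sequentially)
    show "\<exists>M. \<forall>m\<ge>M. \<forall>n\<ge>M. norm (l m - l n) < s"
    proof (intro exI[of _ R] allI impI)
      fix a b assume "R \<le> a" "R \<le> b"
      then show "norm (l a - l b) < s" using R[of a] R[of b] ll[of a b] unfolding real_norm_def by linarith
    qed
  qed
  then obtain L where L: "l \<longlonglongrightarrow> L" using Cauchy_convergent convergentD by blast
  with uniform_approx_limit[OF le e y L] show ?thesis by blast
qed

context prob_space
begin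

lemma nrm_centered_diff_le:
  assumes f: "f \<in> Lq 2 M" and g: "g \<in> Lq 2 M"
  shows "\<bar>nrm 2 M (\<lambda>x. f x - expectation f) - nrm 2 M (\<lambda>x. g x - expectation g)\<bar> \<le> nrm 2 M (\<lambda>x. f x - g x)"
proof -
  have fg: "(\<lambda>x. f x - g x) \<in> Lq 2 M" using f g by (intro Lq_diff) auto
  have "\<bar>nrm 2 M (\<lambda>x. f x - expectation f) - nrm 2 M (\<lambda>x. g x - expectation g)\<bar>
      \<le> nrm 2 M (\<lambda>x. (f x - expectation f) - (g x - expectation g))"
    using f g by (intro nrm_triangle_rev nrm_centered) auto
  also have "(\<lambda>x. (f x - expectation f) - (g x - expectation g)) = (\<lambda>x. (f x - g x) - expectation (\<lambda>x. f x - g x))"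
    using Lq_2_integrable(1)[OF f] Lq_2_integrable(1)[OF g] by auto
  also have "nrm 2 M \<dots> \<le> nrm 2 M (\<lambda>x. f x - g x)" by (rule nrm_centered(2)[OF fg])
  finally show ?thesis .
qed

text \<open>Lyapunov's inequality from Young's inequality with weights 4/\<alpha> and 1 -
  4/\<alpha>, after scaling by b. The scale is the norm of order \<alpha> enlarged by an arbitrary e
  > 0 and hence positive.\<close>

lemma nrm4_le_powr:
  fixes f :: "'a \<Rightarrow> real"
  assumes \<alpha>: "4 < \<alpha>" and [measurable]: "f \<in> borel_measurable M" and i: "integrable M (\<lambda>x. \<bar>f x\<bar> powr \<alpha>)"
  shows "f \<in> Lq 4 M" "nrm 4 M f \<le> (\<integral>x. \<bar>f x\<bar> powr \<alpha> \<partial>M) powr (1 / \<alpha>)"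
proof -
  define I where "I = (\<integral>x. \<bar>f x\<bar> powr \<alpha> \<partial>M)"
  have I: "0 \<le> I" unfolding I_def by (intro integral_nonneg_AE) auto
  have young: "y ^ 4 \<le> b ^ 4 * (4 / \<alpha> * (\<bar>y\<bar> powr \<alpha> / b powr \<alpha>) + (1 - 4 / \<alpha>))" if b: "0 < b" for y b :: real
  proof (cases "y = 0")
    case True
    then show ?thesis using \<alpha> b by (simp add: field_simps)
  next
    case False
    have "((\<bar>y\<bar> / b) powr \<alpha>) powr (4 / \<alpha>) * 1 powr (1 - 4 / \<alpha>) \<le> 4 / \<alpha> * (\<bar>y\<bar> / b) powr \<alpha> + (1 - 4 / \<alpha>) * 1"
      using \<alpha> False b by (intro Youngs_inequality_0) auto
    moreover have "((\<bar>y\<bar> / b) powr \<alpha>) powr (4 / \<alpha>) = (\<bar>y\<bar> / b) ^ 4"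
      using \<alpha> False b by (simp add: powr_powr)
    moreover have "(\<bar>y\<bar> / b) ^ 4 = y ^ 4 / b ^ 4" by (simp add: power_divide power_even_abs)
    moreover have "(\<bar>y\<bar> / b) powr \<alpha> = \<bar>y\<bar> powr \<alpha> / b powr \<alpha>" using b by (simp add: powr_divide)
    ultimately have "y ^ 4 / b ^ 4 \<le> 4 / \<alpha> * (\<bar>y\<bar> powr \<alpha> / b powr \<alpha>) + (1 - 4 / \<alpha>)" by simp
    then show ?thesis using b by (simp add: divide_le_eq mult.commute)
  qed
  have int: "integrable M (\<lambda>x. b ^ 4 * (4 / \<alpha> * (\<bar>f x\<bar> powr \<alpha> / b powr \<alpha>) + (1 - 4 / \<alpha>)))" for b
    using i by simp
  have i4: "integrable M (\<lambda>x. f x ^ 4)"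
  proof (rule Bochner_Integration.integrable_bound[OF int[of 1]])
    show "AE x in M. norm (f x ^ 4) \<le> norm (1 ^ 4 * (4 / \<alpha> * (\<bar>f x\<bar> powr \<alpha> / 1 powr \<alpha>) + (1 - 4 / \<alpha>)))"
    proof (rule AE_I2)
      fix x
      have "norm (f x ^ 4) = f x ^ 4" by simp
      also have "\<dots> \<le> 1 ^ 4 * (4 / \<alpha> * (\<bar>f x\<bar> powr \<alpha> / 1 powr \<alpha>) + (1 - 4 / \<alpha>))" by (rule young) simp
      also have "\<dots> \<le> norm (1 ^ 4 * (4 / \<alpha> * (\<bar>f x\<bar> powr \<alpha> / 1 powr \<alpha>) + (1 - 4 / \<alpha>)))"
        unfolding real_norm_def by (rule abs_ge_self)
      finally show "norm (f x ^ 4) \<le> norm (1 ^ 4 * (4 / \<alpha> * (\<bar>f x\<bar> powr \<alpha> / 1 powr \<alpha>) + (1 - 4 / \<alpha>)))" .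
    qed
  qed simp
  then show "f \<in> Lq 4 M" by (simp add: Lq_def)
  show "nrm 4 M f \<le> (\<integral>x. \<bar>f x\<bar> powr \<alpha> \<partial>M) powr (1 / \<alpha>)"
    unfolding I_def[symmetric]
  proof (rule field_le_epsilon)
    fix e :: real assume e: "0 < e"
    define b where "b = I powr (1 / \<alpha>) + e"
    have b: "0 < b" using e by (simp add: b_def add_nonneg_pos)
    have "I = (I powr (1 / \<alpha>)) powr \<alpha>" using I \<alpha> by (simp add: powr_powr)
    also have "\<dots> \<le> b powr \<alpha>" using e \<alpha> by (intro powr_mono2) (auto simp: b_def)
    finally have Ib: "I / b powr \<alpha> \<le> 1" using b by simp
    have "(\<integral>x. f x ^ 4 \<partial>M) \<le> (\<integral>x. b ^ 4 * (4 / \<alpha> * (\<bar>f x\<bar> powr \<alpha> / b powr \<alpha>) + (1 - 4 / \<alpha>)) \<partial>M)"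
      by (intro integral_mono i4 int young b)
    also have "\<dots> = b ^ 4 * (4 / \<alpha> * (I / b powr \<alpha>) + (1 - 4 / \<alpha>))"
      using i by (simp add: I_def prob_space)
    also have "\<dots> \<le> b ^ 4 * (4 / \<alpha> * 1 + (1 - 4 / \<alpha>))"
      using \<alpha> Ib by (intro mult_left_mono add_right_mono) auto
    finally show "nrm 4 M f \<le> I powr (1 / \<alpha>) + e"
      using nrm_le_iff[of 4 b M f] b by (simp add: b_def)
  qed
qed

lemma cond_exp_L2:
  assumes "subalgebra M F" and f: "f \<in> Lq 2 M"
  shows "real_cond_exp M F f \<in> Lq 2 M" "nrm 2 M (real_cond_exp M F f) \<le> nrm 2 M f"
proof -
  interpret F: finite_measure_subalgebra M F by unfold_locales (rule assms(1))
  have i: "integrable M f" "integrable M (\<lambda>x. (f x)\<^sup>2)" using Lq_2_integrable[OF f] LqD[OF f] by auto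
  have j: "AE x in M. (real_cond_exp M F f x)\<^sup>2 \<le> real_cond_exp M F (\<lambda>x. (f x)\<^sup>2) x"
    using F.real_cond_exp_jensens_inequality(2)[where I=UNIV and q="\<lambda>x. x\<^sup>2", OF i(1) _ _ i(2) convex_power2] by auto
  have c: "integrable M (real_cond_exp M F (\<lambda>x. (f x)\<^sup>2))" by (rule F.real_cond_exp_int[OF i(2)])
  have [measurable]: "real_cond_exp M F f \<in> borel_measurable M" by simp
  have i2: "integrable M (\<lambda>x. (real_cond_exp M F f x)\<^sup>2)"
    by (rule Bochner_Integration.integrable_bound[OF c]) (use j in auto)
  then show "real_cond_exp M F f \<in> Lq 2 M" by (simp add: Lq_def)
  have "(\<integral>x. (real_cond_exp M F f x)\<^sup>2 \<partial>M) \<le> (\<integral>x. real_cond_exp M F (\<lambda>x. (f x)\<^sup>2) x \<partial>M)"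
    by (rule integral_mono_AE[OF i2 c j])
  also have "\<dots> = (\<integral>x. (f x)\<^sup>2 \<partial>M)" by (rule F.real_cond_exp_int[OF i(2)])
  finally show "nrm 2 M (real_cond_exp M F f) \<le> nrm 2 M f" by (simp add: nrm_def)
qed

end

subsection \<open>Transfer to the given probability space\<close>

text \<open>The innovations enter through the joint law of their path, which is the product measure,
  and integrals and norms transfer along \<open>EE\<close>. \<open>N\<close> has the measurable sets
  of \<mu>, the law of one innovation.\<close>

locale realization = iid_seq \<mu> for \<mu> :: "'b measure" +
  fixes M :: "'a measure" and N :: "'b measure" and \<epsilon> :: "int \<Rightarrow> 'a \<Rightarrow> 'b"
  assumes M: "prob_space M" and sets_N: "sets N = sets \<mu>"
    and meas: "(\<lambda>\<omega> i. \<epsilon> i \<omega>) \<in> M \<rightarrow>\<^sub>M P" and distr: "distr M P (\<lambda>\<omega> i. \<epsilon> i \<omega>) = P"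
begin

sublocale MM: prob_space M by (rule M)

abbreviation EE :: "'a \<Rightarrow> int \<Rightarrow> 'b" where "EE \<omega> \<equiv> (\<lambda>i. \<epsilon> i \<omega>)"

lemma Xproc_eq: "Xproc \<epsilon> h i \<omega> = Xp h i (EE \<omega>)"
  by (simp add: Xproc_def Xp_def)

lemma EE_space: "\<omega> \<in> space M \<Longrightarrow> EE \<omega> \<in> space P"
  using measurable_space[OF meas] by simp

lemma integral_EE:
  fixes f :: "(int \<Rightarrow> 'b) \<Rightarrow> real"
  shows "f \<in> borel_measurable P \<Longrightarrow> (\<integral>\<omega>. f (EE \<omega>) \<partial>M) = (\<integral>x. f x \<partial>P)"
  using integral_distr[OF meas, of f] by (simp add: distr)

lemma nrm_EE: "f \<in> borel_measurable P \<Longrightarrow> nrm q M (\<lambda>\<omega>. f (EE \<omega>)) = nrm q P f"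
  using nrm_distr[OF meas, of f q] by (simp add: distr)

lemma Lq_EE: "f \<in> Lq q P \<Longrightarrow> (\<lambda>\<omega>. f (EE \<omega>)) \<in> Lq q M"
  using Lq_distr[OF meas, of f q] LqD(1)[of f q P] by (simp add: distr)

lemma measurable_eps: "\<epsilon> j \<in> M \<rightarrow>\<^sub>M \<mu>"
  using measurable_compose[OF meas measurable_component_singleton[of j UNIV "\<lambda>_. \<mu>"]] by simp

lemma space_filt: "space (filt M N \<epsilon> t) = space M"
  by (simp add: filt_def space_measure_of_conv)

lemma sets_filt: "sets (filt M N \<epsilon> t) = sigma_sets (space M) {\<epsilon> j -` A \<inter> space M | j A. j \<le> t \<and> A \<in> sets \<mu>}"
  unfolding filt_def sets_N by (rule sets_measure_of) auto

lemma subalgebra_filt: "subalgebra M (filt M N \<epsilon> t)"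
  unfolding subalgebra_def space_filt sets_filt
  by (intro conjI refl sets.sigma_sets_subset) (auto intro: measurable_sets[OF measurable_eps])

lemma sigma_finite_filt: "sigma_finite_subalgebra M (filt M N \<epsilon> t)"
  by (intro finite_measure_subalgebra_is_sigma_finite finite_measure_subalgebra.intro MM.finite_measure_axioms
      finite_measure_subalgebra_axioms.intro subalgebra_filt)

lemma measurable_eps_filt: "j \<le> t \<Longrightarrow> \<epsilon> j \<in> filt M N \<epsilon> t \<rightarrow>\<^sub>M \<mu>"
  by (rule measurableI) (auto simp: space_filt sets_filt measurable_space[OF measurable_eps])

text \<open>Induction over the generated sigma-algebra, carrying along a representing set that is
  insensitive to the coordinates after t. Its indicator then is a test function on the path
  space.\<close>

lemma filt_sets_factor:
  assumes "A \<in> sets (filt M N \<epsilon> t)"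
  shows "\<exists>B\<in>sets P. A = EE -` B \<inter> space M \<and> (\<forall>j>t. free j (indicator B))"
proof -
  define T where "T B \<longleftrightarrow> B \<in> sets P \<and> (\<forall>j>t. \<forall>x\<in>space P. \<forall>y\<in>space \<mu>. x(j := y) \<in> B \<longleftrightarrow> x \<in> B)" for B
  have "\<exists>B. T B \<and> A = EE -` B \<inter> space M"
    using assms unfolding sets_filt
  proof (induction rule: sigma_sets.induct)
    case (Basic a)
    then obtain j A where a: "a = \<epsilon> j -` A \<inter> space M" "j \<le> t" "A \<in> sets \<mu>" by blast
    have "T {x \<in> space P. x j \<in> A}" using a by (auto simp: T_def upd_in_space)
    moreover have "a = EE -` {x \<in> space P. x j \<in> A} \<inter> space M" using a EE_space by auto
    ultimately show ?case by blast
  next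
    case Empty
    have "T {}" by (simp add: T_def)
    then show ?case by (intro exI[of _ "{}"]) simp
  next
    case (Compl a)
    then obtain B where B: "T B" "a = EE -` B \<inter> space M" by blast
    have "T (space P - B)" using B by (auto simp: T_def upd_in_space)
    moreover have "space M - a = EE -` (space P - B) \<inter> space M" using B EE_space by auto
    ultimately show ?case by blast
  next
    case (Union a)
    then obtain B where B: "\<And>i. T (B i)" "\<And>i. a i = EE -` B i \<inter> space M" by metis
    have "T (\<Union>i. B i)" using B(1) by (auto simp: T_def)
    moreover have "(\<Union>i. a i) = EE -` (\<Union>i. B i) \<inter> space M" using B(2) by auto
    ultimately show ?case by blast
  qed
  then show ?thesis unfolding T_def free_def indicator_def by auto
qed

lemma filt_measurable:
  assumes f: "bm f" "dep {..t} f"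
  shows "(\<lambda>\<omega>. f (EE \<omega>)) \<in> borel_measurable (filt M N \<epsilon> t)"
proof -
  obtain x0 where x0: "x0 \<in> space P" using PP.P.not_empty by blast
  \<comment> \<open>Innovations after t are frozen at a fixed point, which makes the path measurable
    with respect to the past; f cannot distinguish it from the true path.\<close>
  define T where "T \<omega> = (\<lambda>j. if j \<le> t then \<epsilon> j \<omega> else x0 j)" for \<omega>
  have T: "T \<in> filt M N \<epsilon> t \<rightarrow>\<^sub>M P"
  proof (rule measurable_PiM_single')
    fix j :: int
    show "(\<lambda>\<omega>. T \<omega> j) \<in> filt M N \<epsilon> t \<rightarrow>\<^sub>M \<mu>"
      using x0 measurable_eps_filt[of j t] by (cases "j \<le> t") (auto simp: T_def space_PiM PiE_iff)
  qed (use x0 in \<open>auto simp: T_def space_filt space_PiM PiE_iff measurable_space[OF measurable_eps]\<close>)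
  have "f (EE \<omega>) = f (T \<omega>)" if "\<omega> \<in> space M" for \<omega>
  proof -
    have "EE \<omega> \<in> space P" "T \<omega> \<in> space P" "\<And>i. i \<in> {..t} \<Longrightarrow> EE \<omega> i = T \<omega> i"
      using EE_space[OF that] measurable_space[OF T] that by (auto simp: space_filt T_def)
    then show ?thesis by (rule depD[OF f(2)])
  qed
  then have "(\<lambda>\<omega>. f (EE \<omega>)) \<in> borel_measurable (filt M N \<epsilon> t) \<longleftrightarrow> (\<lambda>\<omega>. f (T \<omega>)) \<in> borel_measurable (filt M N \<epsilon> t)"
    by (intro measurable_cong) (simp add: space_filt)
  then show ?thesis using measurable_compose[OF T bmD[OF f(1)]] by simp
qed

text \<open>Events of the past are preimages of sets free of later coordinates, so testing against
  free functions on the path space characterises the conditional expectation and identifies it with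
  an explicit function.\<close>

lemma cond_exp_eq:
  assumes f: "bm f" and f': "bm f'" "dep {..t} f'"
    and eq: "\<And>g. bm g \<Longrightarrow> (\<And>j. t < j \<Longrightarrow> free j g) \<Longrightarrow> (\<integral>x. g x * f' x \<partial>P) = (\<integral>x. g x * f x \<partial>P)"
  shows "AE \<omega> in M. real_cond_exp M (filt M N \<epsilon> t) (\<lambda>\<omega>. f (EE \<omega>)) \<omega> = f' (EE \<omega>)"
proof -
  interpret F: sigma_finite_subalgebra M "filt M N \<epsilon> t" by (rule sigma_finite_filt)
  have int: "integrable M (\<lambda>\<omega>. u (EE \<omega>))" if "bm u" for u
    using Lq_EE[OF bm_Lq[OF that, of 1]] by (simp add: Lq_def)
  show ?thesis
  proof (rule F.real_cond_exp_charact)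
    fix A assume "A \<in> sets (filt M N \<epsilon> t)"
    then obtain B where B: "B \<in> sets P" "A = EE -` B \<inter> space M" "\<And>j. t < j \<Longrightarrow> free j (indicator B)"
      using filt_sets_factor by blast
    have A: "(\<integral>\<omega>\<in>A. u (EE \<omega>) \<partial>M) = (\<integral>x. indicator B x * u x \<partial>P)" if "bm u" for u
    proof -
      have "(\<integral>\<omega>\<in>A. u (EE \<omega>) \<partial>M) = (\<integral>\<omega>. indicator B (EE \<omega>) * u (EE \<omega>) \<partial>M)"
        unfolding set_lebesgue_integral_def using B(2)
        by (intro Bochner_Integration.integral_cong) (auto simp: indicator_def)
      also have "\<dots> = (\<integral>x. indicator B x * u x \<partial>P)"
        by (rule integral_EE[OF bmD[OF bm_mult[OF bm_indicator[OF B(1)] that]]])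
      finally show ?thesis .
    qed
    show "(\<integral>\<omega>\<in>A. f (EE \<omega>) \<partial>M) = (\<integral>\<omega>\<in>A. f' (EE \<omega>) \<partial>M)"
      unfolding A[OF f] A[OF f'(1)] using eq[OF bm_indicator[OF B(1)] B(3)] by simp
  qed (auto intro: int f f' filt_measurable)
qed

text \<open>E(X_i | F_0) integrates out the innovations 1, ..., i and E(X_i | F_{-1}) innovation 0
  as well; both are checked by \<open>cond_exp_eq\<close>.\<close>

lemma proj_kernel:
  assumes k: "kern m h"
  shows "AE \<omega> in M. proj M N \<epsilon> 0 (Xproc \<epsilon> h (int i)) \<omega> = proj0 h i (EE \<omega>)"
proof -
  have X: "bm (Xp h (int i))" by (rule bm_Xp[OF k])
  have dG: "dep {..0} (G0 h i)"
    unfolding G0_def by (intro dep_avgs dep_mono[OF dep_Xp[OF k]]) auto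
  have Gint: "(\<integral>x. g x * G0 h i x \<partial>P) = (\<integral>x. g x * Xp h (int i) x \<partial>P)"
    if "bm g" "\<And>j. 0 < j \<Longrightarrow> free j g" for g
    unfolding G0_def using that by (intro integral_mult_avgs X) auto
  have "{..0::int} = insert 0 {..-1}" by auto
  then have dA: "dep {..-1} (avg 0 (G0 h i))" using dep_avg[of 0 "{..-1}"] dG by simp
  have "AE \<omega> in M. real_cond_exp M (filt M N \<epsilon> 0) (\<lambda>\<omega>. Xp h (int i) (EE \<omega>)) \<omega> = G0 h i (EE \<omega>)"
    by (rule cond_exp_eq[OF X bm_G0[OF k] dG Gint])
  moreover have "AE \<omega> in M. real_cond_exp M (filt M N \<epsilon> (-1)) (\<lambda>\<omega>. Xp h (int i) (EE \<omega>)) \<omega> = avg 0 (G0 h i) (EE \<omega>)"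
  proof (rule cond_exp_eq[OF X bm_avg[OF bm_G0[OF k]] dA])
    fix g assume g: "bm g" "\<And>j. -1 < j \<Longrightarrow> free j g"
    then show "(\<integral>x. g x * avg 0 (G0 h i) x \<partial>P) = (\<integral>x. g x * Xp h (int i) x \<partial>P)"
      using integral_free_avg[OF bm_G0[OF k, of i] g(1), of 0] Gint[OF g(1)] by simp
  qed
  ultimately show ?thesis
    by eventually_elim (simp add: proj_def proj0_def Xproc_eq[abs_def])
qed

text \<open>The possibly unbounded g is handled by comparison: conditional expectations contract the
  L2 norm, and a projection contains two of them, whence the factor 2.\<close>

lemma proj_diff_le:
  assumes g: "g \<in> Lq 4 S" and k: "kern m h"
  shows "proj M N \<epsilon> 0 (Xproc \<epsilon> g i) \<in> Lq 2 M" "proj M N \<epsilon> 0 (Xproc \<epsilon> h i) \<in> Lq 2 M"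
    and "nrm 2 M (\<lambda>\<omega>. proj M N \<epsilon> 0 (Xproc \<epsilon> g i) \<omega> - proj M N \<epsilon> 0 (Xproc \<epsilon> h i) \<omega>) \<le> 2 * nrm 4 S (\<lambda>x. g x - h x)"
proof -
  have h: "h \<in> Lq 4 S" by (rule kern_Lq[OF k])
  have X: "Xproc \<epsilon> u i \<in> Lq 2 M" if "u \<in> Lq 4 S" for u
    unfolding Xproc_eq[abs_def] using that by (intro Lq_EE Lq_Xp SS.P.Lq_4_2)
  have pL: "proj M N \<epsilon> 0 (Xproc \<epsilon> u i) \<in> Lq 2 M" if "u \<in> Lq 4 S" for u
    unfolding proj_def using that by (intro Lq_diff MM.cond_exp_L2 subalgebra_filt X) auto
  show "proj M N \<epsilon> 0 (Xproc \<epsilon> g i) \<in> Lq 2 M" "proj M N \<epsilon> 0 (Xproc \<epsilon> h i) \<in> Lq 2 M" by (intro pL g h)+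
  define D where "D \<omega> = Xproc \<epsilon> g i \<omega> - Xproc \<epsilon> h i \<omega>" for \<omega>
  have D: "D \<in> Lq 2 M" unfolding D_def by (intro Lq_diff X g h) auto
  have nD: "nrm 2 M D \<le> nrm 4 S (\<lambda>x. g x - h x)"
  proof -
    have gh: "(\<lambda>x. g x - h x) \<in> Lq 4 S" by (intro Lq_diff g h) auto
    have "nrm 2 M D = nrm 2 M (\<lambda>\<omega>. Xp (\<lambda>x. g x - h x) i (EE \<omega>))" by (simp add: D_def[abs_def] Xproc_eq Xp_diff)
    also have "\<dots> = nrm 2 S (\<lambda>x. g x - h x)"
      using LqD(1)[OF gh] by (simp add: nrm_EE measurable_Xp nrm_Xp)
    also have "\<dots> \<le> nrm 4 S (\<lambda>x. g x - h x)" by (rule SS.P.Lq_4_2(2)[OF gh])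
    finally show ?thesis .
  qed
  have c: "AE \<omega> in M. real_cond_exp M (filt M N \<epsilon> t) D \<omega>
      = real_cond_exp M (filt M N \<epsilon> t) (Xproc \<epsilon> g i) \<omega> - real_cond_exp M (filt M N \<epsilon> t) (Xproc \<epsilon> h i) \<omega>" for t
    unfolding D_def[abs_def]
    by (intro sigma_finite_subalgebra.real_cond_exp_diff sigma_finite_filt MM.Lq_2_integrable X g h)
  have "nrm 2 M (\<lambda>\<omega>. proj M N \<epsilon> 0 (Xproc \<epsilon> g i) \<omega> - proj M N \<epsilon> 0 (Xproc \<epsilon> h i) \<omega>)
      = nrm 2 M (\<lambda>\<omega>. real_cond_exp M (filt M N \<epsilon> 0) D \<omega> - real_cond_exp M (filt M N \<epsilon> (-1)) D \<omega>)"
  proof (rule nrm_cong_AE)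
    show "AE \<omega> in M. proj M N \<epsilon> 0 (Xproc \<epsilon> g i) \<omega> - proj M N \<epsilon> 0 (Xproc \<epsilon> h i) \<omega>
        = real_cond_exp M (filt M N \<epsilon> 0) D \<omega> - real_cond_exp M (filt M N \<epsilon> (-1)) D \<omega>"
      using c[of 0] c[of "-1"] by eventually_elim (simp add: proj_def)
  qed (intro borel_measurable_diff LqD(1)[OF pL] g h, simp)
  also have "\<dots> \<le> nrm 2 M (real_cond_exp M (filt M N \<epsilon> 0) D) + nrm 2 M (real_cond_exp M (filt M N \<epsilon> (-1)) D)"
    by (intro Lq_diff MM.cond_exp_L2 subalgebra_filt D) auto
  also have "\<dots> \<le> nrm 2 M D + nrm 2 M D" by (intro add_mono MM.cond_exp_L2 subalgebra_filt D)
  finally show "nrm 2 M (\<lambda>\<omega>. proj M N \<epsilon> 0 (Xproc \<epsilon> g i) \<omega> - proj M N \<epsilon> 0 (Xproc \<epsilon> h i) \<omega>) \<le> 2 * nrm 4 S (\<lambda>x. g x - h x)"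
    using nD by simp
qed

text \<open>Growth of the bound with n does no harm, since the estimate is used with n fixed while
  the kernel tends to g.\<close>

lemma sum_proj_diff_le:
  assumes g: "g \<in> Lq 4 S" and k: "kern m h"
  shows "\<bar>nrm 2 M (\<lambda>\<omega>. \<Sum>i\<le>n. proj M N \<epsilon> 0 (Xproc \<epsilon> g (int i)) \<omega>) - sproj h n\<bar>
    \<le> real (Suc n) * (2 * nrm 4 S (\<lambda>x. g x - h x))"
proof -
  note pd = proj_diff_le[OF g k]
  have "sproj h n = nrm 2 M (\<lambda>\<omega>. \<Sum>i\<le>n. proj0 h i (EE \<omega>))"
    unfolding sproj_def using nrm_EE[OF bmD[OF bm_sum[of "{..n}" "proj0 h", OF bm_proj0[OF k]]], of 2] by simp
  also have "\<dots> = nrm 2 M (\<lambda>\<omega>. \<Sum>i\<le>n. proj M N \<epsilon> 0 (Xproc \<epsilon> h (int i)) \<omega>)"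
  proof (rule nrm_cong_AE)
    have "AE \<omega> in M. \<forall>i\<in>{..n}. proj M N \<epsilon> 0 (Xproc \<epsilon> h (int i)) \<omega> = proj0 h i (EE \<omega>)"
      by (intro AE_finite_allI proj_kernel[OF k]) simp
    then show "AE \<omega> in M. (\<Sum>i\<le>n. proj0 h i (EE \<omega>)) = (\<Sum>i\<le>n. proj M N \<epsilon> 0 (Xproc \<epsilon> h (int i)) \<omega>)"
      by eventually_elim (auto intro!: sum.cong)
    show "(\<lambda>\<omega>. \<Sum>i\<le>n. proj0 h i (EE \<omega>)) \<in> borel_measurable M"
      using measurable_compose[OF meas bmD[OF bm_proj0[OF k]]] by (intro borel_measurable_sum) auto
    show "(\<lambda>\<omega>. \<Sum>i\<le>n. proj M N \<epsilon> 0 (Xproc \<epsilon> h (int i)) \<omega>) \<in> borel_measurable M"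
      using LqD(1)[OF pd(2)] by (intro borel_measurable_sum) auto
  qed
  finally have s: "sproj h n = nrm 2 M (\<lambda>\<omega>. \<Sum>i\<le>n. proj M N \<epsilon> 0 (Xproc \<epsilon> h (int i)) \<omega>)" .
  have "\<bar>nrm 2 M (\<lambda>\<omega>. \<Sum>i\<le>n. proj M N \<epsilon> 0 (Xproc \<epsilon> g (int i)) \<omega>) - sproj h n\<bar>
      \<le> nrm 2 M (\<lambda>\<omega>. (\<Sum>i\<le>n. proj M N \<epsilon> 0 (Xproc \<epsilon> g (int i)) \<omega>) - (\<Sum>i\<le>n. proj M N \<epsilon> 0 (Xproc \<epsilon> h (int i)) \<omega>))"
    unfolding s by (intro nrm_triangle_rev Lq_sum pd) auto
  also have "\<dots> = nrm 2 M (\<lambda>\<omega>. \<Sum>i\<le>n. proj M N \<epsilon> 0 (Xproc \<epsilon> g (int i)) \<omega> - proj M N \<epsilon> 0 (Xproc \<epsilon> h (int i)) \<omega>)"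
    by (simp add: sum_subtractf)
  also have "\<dots> \<le> (\<Sum>i\<le>n. nrm 2 M (\<lambda>\<omega>. proj M N \<epsilon> 0 (Xproc \<epsilon> g (int i)) \<omega> - proj M N \<epsilon> 0 (Xproc \<epsilon> h (int i)) \<omega>))"
    by (intro Lq_sum Lq_diff pd) auto
  also have "\<dots> \<le> (\<Sum>i\<le>n. 2 * nrm 4 S (\<lambda>x. g x - h x))" by (intro sum_mono pd)
  finally show ?thesis by simp
qed

end

section \<open>Continuity of the quadratic forms in the kernel\<close>

context iid_seq
begin

lemma Wsum_Lq:
  assumes "u \<in> Lq 4 S"
  shows "Wsum u A \<in> Lq 4 P" "nrm 4 P (Wsum u A) \<le> card A * nrm 4 S u"
proof -
  show "Wsum u A \<in> Lq 4 P" unfolding Wsum_def[abs_def] using assms by (intro Lq_sum Lq_Xp) auto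
  have "nrm 4 P (Wsum u A) \<le> (\<Sum>t\<in>A. nrm 4 P (Xp u t))"
    unfolding Wsum_def[abs_def] using assms by (intro Lq_sum Lq_Xp) auto
  then show "nrm 4 P (Wsum u A) \<le> card A * nrm 4 S u" using nrm_Xp[OF LqD(1)[OF assms]] by simp
qed

lemma Qsum_Lq:
  assumes u: "u \<in> Lq 4 S" and v: "v \<in> Lq 4 S"
  shows "Qsum u v I A B \<in> Lq 2 P"
    and "nrm 2 P (Qsum u v I A B) \<le> (\<Sum>i\<in>I. real (card (A i) * card (B i))) * (nrm 4 S u * nrm 4 S v)"
proof -
  show "Qsum u v I A B \<in> Lq 2 P"
    unfolding Qsum_def[abs_def] by (intro Lq_sum Lq_mult Wsum_Lq u v) auto
  have "nrm 2 P (Qsum u v I A B) \<le> (\<Sum>i\<in>I. nrm 2 P (\<lambda>x. Wsum u (A i) x * Wsum v (B i) x))"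
    unfolding Qsum_def[abs_def] by (intro Lq_sum Lq_mult Wsum_Lq u v) auto
  also have "\<dots> \<le> (\<Sum>i\<in>I. (card (A i) * nrm 4 S u) * (card (B i) * nrm 4 S v))"
    by (intro sum_mono order_trans[OF Lq_mult(2)] mult_mono Wsum_Lq u v) (auto simp: nrm_nonneg)
  also have "\<dots> = (\<Sum>i\<in>I. real (card (A i) * card (B i))) * (nrm 4 S u * nrm 4 S v)"
    unfolding sum_distrib_right by (intro sum.cong) (simp_all add: algebra_simps)
  finally show "nrm 2 P (Qsum u v I A B) \<le> (\<Sum>i\<in>I. real (card (A i) * card (B i))) * (nrm 4 S u * nrm 4 S v)" .
qed

lemma Qsum_square_diff:
  "Qsum u u I A A x - Qsum v v I A A x = Qsum (\<lambda>x. u x - v x) (\<lambda>x. u x + v x) I A A x"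
  by (simp add: Qsum_def sum_subtractf[symmetric] Wsum_add Wsum_diff algebra_simps)

text \<open>For fixed index sets a crude bound by cardinalities suffices. The difference is a form
  in \<open>g - h r\<close>, which tends to 0 in L4, and \<open>g + h r\<close>, which stays bounded
  there.\<close>

lemma centered_Qsum_approx:
  assumes g: "g \<in> Lq 4 S" and h: "\<And>r. h r \<in> Lq 4 S" and lim: "(\<lambda>r. nrm 4 S (\<lambda>x. g x - h r x)) \<longlonglongrightarrow> 0"
  shows "(\<lambda>r. cnrm (Qsum (h r) (h r) I A A))
    \<longlonglongrightarrow> cnrm (Qsum g g I A A)"
proof -
  define e where "e r = nrm 4 S (\<lambda>x. g x - h r x)" for r
  define B where "B = (\<Sum>i\<in>I. real (card (A i) * card (A i)))"
  have B: "0 \<le> B" unfolding B_def by (intro sum_nonneg) auto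
  have le: "norm (cnrm (Qsum (h r) (h r) I A A)
      - cnrm (Qsum g g I A A)) \<le> B * (e r * (2 * nrm 4 S g + e r))" for r
  proof -
    have d: "(\<lambda>x. g x - h r x) \<in> Lq 4 S" and s: "(\<lambda>x. g x + h r x) \<in> Lq 4 S" by (intro Lq_diff Lq_add g h; simp)+
    have "nrm 4 S (h r) \<le> nrm 4 S g + e r"
      using nrm_triangle_rev[OF _ _ g h[of r]] by (simp add: e_def)
    then have s2: "nrm 4 S (\<lambda>x. g x + h r x) \<le> 2 * nrm 4 S g + e r"
      using Lq_add(2)[OF _ _ g h[of r]] by simp
    have "norm (cnrm (Qsum (h r) (h r) I A A)
      - cnrm (Qsum g g I A A))
      \<le> nrm 2 P (\<lambda>x. Qsum g g I A A x - Qsum (h r) (h r) I A A x)"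
      using PP.P.nrm_centered_diff_le[OF Qsum_Lq(1)[OF g g] Qsum_Lq(1)[OF h[of r] h[of r]]] by (simp add: abs_minus_commute)
    also have "\<dots> \<le> B * (e r * nrm 4 S (\<lambda>x. g x + h r x))"
      unfolding Qsum_square_diff using Qsum_Lq(2)[OF d s] by (simp add: B_def e_def)
    also have "\<dots> \<le> B * (e r * (2 * nrm 4 S g + e r))"
      using s2 B by (intro mult_left_mono) (auto simp: e_def nrm_nonneg)
    finally show ?thesis .
  qed
  have "e \<longlonglongrightarrow> 0" using lim by (simp add: e_def[abs_def])
  then have "(\<lambda>r. B * (e r * (2 * nrm 4 S g + e r))) \<longlonglongrightarrow> B * (0 * (2 * nrm 4 S g + 0))"
    by (intro tendsto_intros)
  then have "(\<lambda>r. B * (e r * (2 * nrm 4 S g + e r))) \<longlonglongrightarrow> 0" by simp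
  from Lim_null_comparison[OF always_eventually[OF allI[OF le]] this] show ?thesis
    by (rule LIM_zero_cancel)
qed

end

context power_iid
begin

text \<open>The long-run variance is rewritten as the square of \<open>sproj h m\<close>, and
  \<open>sproj h n\<close> is constant for n \<ge> m. In this form the limit can be followed along
  kernels of varying range.\<close>

lemma kernel_asymp:
  assumes "kern m h" "profile h d \<Delta>"
  shows "(\<lambda>n. cnrm (Qsum h h {1..n} AA AA) / real n powr (2 - 3 / (2 * p)))
      \<longlonglongrightarrow> (sproj h m)\<^sup>2 * (p\<^sup>2 * c powr (3 / (2 * p)) / sqrt (12 * p - 9))"
    and "(\<lambda>n. sproj h n) \<longlonglongrightarrow> sproj h m"
proof -
  interpret K: power_kernel \<mu> h m d \<Delta> c p by unfold_locales (rule assms)+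
  have s: "sproj h n = sqrt K.lrv" if "m \<le> n" for n using K.sproj_eq[OF that] .
  then show "(\<lambda>n. sproj h n) \<longlonglongrightarrow> sproj h m"
    by (intro tendsto_eventually eventually_sequentiallyI[of m]) simp
  have "K.lrv = (sproj h m)\<^sup>2" using s[of m] K.lrv_nonneg by simp
  then show "(\<lambda>n. cnrm (Qsum h h {1..n} AA AA) / real n powr (2 - 3 / (2 * p)))
      \<longlonglongrightarrow> (sproj h m)\<^sup>2 * (p\<^sup>2 * c powr (3 / (2 * p)) / sqrt (12 * p - 9))"
    using K.VV_asymp unfolding K.VV_def by (simp add: mult.assoc)
qed

end

subsection \<open>The main limit theorem\<close>

lemma realizationI:
  fixes M :: "'a measure" and N :: "'b measure" and \<epsilon> :: "int \<Rightarrow> 'a \<Rightarrow> 'b"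
  assumes M: "prob_space M" and \<epsilon>: "\<And>i. \<epsilon> i \<in> measurable M N"
    and indep: "prob_space.indep_vars M (\<lambda>_. N) \<epsilon> UNIV"
    and ident: "\<And>i. distr M N (\<epsilon> i) = distr M N (\<epsilon> 0)"
  shows "realization (distr M N (\<epsilon> 0)) M N \<epsilon>"
proof -
  interpret M: prob_space M by (rule M)
  let ?\<mu> = "distr M N (\<epsilon> 0)"
  have \<mu>: "prob_space ?\<mu>" by (rule M.prob_space_distr[OF \<epsilon>])
  have sets: "sets (PiM UNIV (\<lambda>_::int. ?\<mu>)) = sets (PiM UNIV (\<lambda>_::int. N))" by (intro sets_PiM_cong) auto
  have mN: "(\<lambda>\<omega> i. \<epsilon> i \<omega>) \<in> M \<rightarrow>\<^sub>M PiM UNIV (\<lambda>_. N)"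
    using \<epsilon> by (intro measurable_PiM_single') (auto simp: PiE_iff dest: measurable_space)
  have m: "(\<lambda>\<omega> i. \<epsilon> i \<omega>) \<in> M \<rightarrow>\<^sub>M PiM UNIV (\<lambda>_. ?\<mu>)"
    using mN measurable_cong_sets[OF refl sets] by blast
  have "distr M (PiM UNIV (\<lambda>_. N)) (\<lambda>x. \<lambda>i\<in>UNIV. \<epsilon> i x) = PiM UNIV (\<lambda>i. distr M N (\<epsilon> i))"
    using M.indep_vars_iff_distr_eq_PiM[where I=UNIV and M'="\<lambda>_. N" and X=\<epsilon>] \<epsilon> indep by simp
  also have "\<dots> = PiM UNIV (\<lambda>_. ?\<mu>)" by (rule PiM_cong[OF refl ident])
  finally have "distr M (PiM UNIV (\<lambda>_. N)) (\<lambda>\<omega> i. \<epsilon> i \<omega>) = PiM UNIV (\<lambda>_. ?\<mu>)" by (simp add: restrict_def)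
  moreover have "distr M (PiM UNIV (\<lambda>_. ?\<mu>)) (\<lambda>\<omega> i. \<epsilon> i \<omega>) = distr M (PiM UNIV (\<lambda>_. N)) (\<lambda>\<omega> i. \<epsilon> i \<omega>)"
    by (intro distr_cong refl sets) 
  ultimately have d: "distr M (PiM UNIV (\<lambda>_. ?\<mu>)) (\<lambda>\<omega> i. \<epsilon> i \<omega>) = PiM UNIV (\<lambda>_. ?\<mu>)" by simp
  interpret \<mu>: prob_space ?\<mu> by (rule \<mu>)
  show ?thesis
    by unfold_locales (use m d in simp_all)
qed

context iid_seq
begin

text \<open>Lyapunov's inequality on the space of path and new value. Its integrability premise
  holds since the updated path has the law of the path and |a - b|^\<alpha> \<le> 2^\<alpha>
  (|a|^\<alpha> + |b|^\<alpha>).\<close>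

lemma Dn_le_powr:
  assumes \<alpha>: "4 < \<alpha>" and [measurable]: "g \<in> borel_measurable S" and i: "integrable S (\<lambda>x. \<bar>g x\<bar> powr \<alpha>)"
  shows "Dn g k \<le> (\<integral>xy. \<bar>g (fst xy) - g ((fst xy)(k := snd xy))\<bar> powr \<alpha> \<partial>(S \<Otimes>\<^sub>M \<mu>)) powr (1 / \<alpha>)"
proof -
  have m1: "fst \<in> S \<Otimes>\<^sub>M \<mu> \<rightarrow>\<^sub>M S" by simp
  have mg: "(\<lambda>x. \<bar>g x\<bar> powr \<alpha>) \<in> borel_measurable S" by measurable
  have i1: "integrable (S \<Otimes>\<^sub>M \<mu>) (\<lambda>xy. \<bar>g (fst xy)\<bar> powr \<alpha>)"
    using integrable_distr_eq[OF m1 mg] i by (simp add: distr_fstS)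
  have i2: "integrable (S \<Otimes>\<^sub>M \<mu>) (\<lambda>xy. \<bar>g ((fst xy)(k := snd xy))\<bar> powr \<alpha>)"
    using integrable_distr_eq[OF measurable_updS[of k] mg] i by (simp add: distr_updS)
  have le: "\<bar>a - b\<bar> powr \<alpha> \<le> 2 powr \<alpha> * (\<bar>a\<bar> powr \<alpha> + \<bar>b\<bar> powr \<alpha>)" for a b :: real
  proof -
    have "\<bar>a - b\<bar> powr \<alpha> \<le> (2 * max \<bar>a\<bar> \<bar>b\<bar>) powr \<alpha>" using \<alpha> by (intro powr_mono2) auto
    also have "\<dots> = 2 powr \<alpha> * max \<bar>a\<bar> \<bar>b\<bar> powr \<alpha>" by (simp add: powr_mult)
    also have "\<dots> \<le> 2 powr \<alpha> * (\<bar>a\<bar> powr \<alpha> + \<bar>b\<bar> powr \<alpha>)" by (intro mult_left_mono) (auto simp: max_def)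
    finally show ?thesis .
  qed
  have "integrable (S \<Otimes>\<^sub>M \<mu>) (\<lambda>xy. 2 powr \<alpha> * (\<bar>g (fst xy)\<bar> powr \<alpha> + \<bar>g ((fst xy)(k := snd xy))\<bar> powr \<alpha>))"
    using i1 i2 by simp
  then have "integrable (S \<Otimes>\<^sub>M \<mu>) (\<lambda>xy. \<bar>g (fst xy) - g ((fst xy)(k := snd xy))\<bar> powr \<alpha>)"
    by (rule Bochner_Integration.integrable_bound) (auto intro!: AE_I2 le)
  then show ?thesis unfolding Dn_def
    by (intro prob_space.nrm4_le_powr[OF prob_space_Smu \<alpha>]) auto
qed

end

theorem theorem2:
  fixes M :: "'a measure" and N :: "'b measure" and \<epsilon> :: "int \<Rightarrow> 'a \<Rightarrow> 'b"
    and g :: "(nat \<Rightarrow> 'b) \<Rightarrow> real" and c p \<alpha> :: real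
  assumes "prob_space M"
    and "\<And>i. \<epsilon> i \<in> measurable M N"
    and "prob_space.indep_vars M (\<lambda>_. N) \<epsilon> UNIV"
    and "\<And>i. distr M N (\<epsilon> i) = distr M N (\<epsilon> 0)"
    and "g \<in> borel_measurable (PiM (UNIV :: nat set) (\<lambda>_. N))"
    and "c > 0" and "p > 1" and "\<alpha> > 4"
    and "\<And>i. integrable M (Xproc \<epsilon> g i)"
    and "\<And>i. (\<integral>\<omega>. Xproc \<epsilon> g i \<omega> \<partial>M) = 0"
    and "\<And>i. integrable M (\<lambda>\<omega>. \<bar>Xproc \<epsilon> g i \<omega>\<bar> powr \<alpha>)"
    and "summable (phys_dep M N \<epsilon> g \<alpha>)"
  shows "(\<lambda>n. sqrt (\<integral>\<omega>. (Vn (Xproc \<epsilon> g) (\<lambda>k. \<lfloor>c * real k powr p\<rfloor>) n \<omega>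
                 - (\<integral>\<omega>'. Vn (Xproc \<epsilon> g) (\<lambda>k. \<lfloor>c * real k powr p\<rfloor>) n \<omega>' \<partial>M))\<^sup>2 \<partial>M)
             / real n powr (2 - 3 / (2 * p)))
         \<longlonglongrightarrow> (sigma_lr M N \<epsilon> g)\<^sup>2 * p\<^sup>2 * c powr (3 / (2 * p)) / sqrt (12 * p - 9)"
proof -
  define \<mu> where "\<mu> = distr M N (\<epsilon> 0)"
  interpret realization \<mu> M N \<epsilon>
    unfolding \<mu>_def by (rule realizationI) (rule assms(1-4))+
  interpret power_iid \<mu> c p by unfold_locales (rule assms)+
  have sets_S: "sets S = sets (PiM UNIV (\<lambda>_. N))" by (intro sets_PiM_cong) (auto simp: \<mu>_def)
  have gm [measurable]: "g \<in> borel_measurable S"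
    using assms(5) measurable_cong_sets[OF sets_S refl] by blast
  have pastm: "(\<lambda>\<omega> k. \<epsilon> (0 - int k) \<omega>) \<in> M \<rightarrow>\<^sub>M S" using measurable_compose[OF meas measurable_past[of 0]] .
  have dpast: "distr M S (\<lambda>\<omega> k. \<epsilon> (0 - int k) \<omega>) = S"
    using distr_distr[OF measurable_past[of 0] meas] distr_past[of 0] by (simp add: distr comp_def)
  have gi: "integrable S (\<lambda>x. \<bar>g x\<bar> powr \<alpha>)"
    using integrable_distr_eq[OF pastm, of "\<lambda>x. \<bar>g x\<bar> powr \<alpha>"] assms(11)[of 0] dpast by (simp add: Xproc_def)
  have g0: "(\<integral>x. g x \<partial>S) = 0"
    using integral_distr[OF pastm gm] assms(10)[of 0] dpast by (simp add: Xproc_def)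
  have gL: "g \<in> Lq 4 S" by (rule SS.P.nrm4_le_powr(1)[OF assms(8) gm gi])
  have Dle: "Dn g i \<le> phys_dep M N \<epsilon> g \<alpha> i" for i
    using Dn_le_powr[OF assms(8) gm gi] by (simp add: phys_dep_def \<mu>_def Let_def)
  have sD: "summable (Dn g)"
    using Dle Dn_nonneg by (intro summable_comparison_test'[OF assms(12), of 0]) auto
  have "\<forall>r. \<exists>m h. kern m h \<and> (\<forall>i. Dn h i \<le> Dn g i) \<and> nrm 4 S (\<lambda>x. g x - h x) < 1 / real (Suc r)"
    using kern_approx[OF gL g0] by simp
  then obtain mm hh where k: "\<And>r. kern (mm r) (hh r)" and Dh: "\<And>r i. Dn (hh r) i \<le> Dn g i"
    and app: "\<And>r. nrm 4 S (\<lambda>x. g x - hh r x) < 1 / real (Suc r)" by metis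
  have hL: "hh r \<in> Lq 4 S" for r by (rule kern_Lq[OF k])
  define e where "e r = nrm 4 S (\<lambda>x. g x - hh r x)" for r
  have e0: "e \<longlonglongrightarrow> 0"
  proof (rule Lim_null_comparison)
    show "\<forall>\<^sub>F r in sequentially. norm (e r) \<le> 1 / real (Suc r)"
      using app by (intro always_eventually) (auto simp: e_def nrm_nonneg less_imp_le)
    show "(\<lambda>r. 1 / real (Suc r)) \<longlonglongrightarrow> 0" using LIMSEQ_inverse_real_of_nat by (simp add: inverse_eq_divide)
  qed
  \<comment> \<open>The total dependence of g minus its approximation; it controls all errors below
    uniformly in n.\<close>
  define Er where "Er r = (\<Sum>i. Dn (\<lambda>x. g x - hh r x) i)" for r
  have Dgh2: "Dn (\<lambda>x. g x - hh r x) i \<le> 2 * Dn g i" for r i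
    using Dn_add_diff(2)[OF gL hL[of r], of i] Dh[of r i] by linarith
  have sE: "summable (Dn (\<lambda>x. g x - hh r x))" for r
    using Dgh2 Dn_nonneg by (intro summable_comparison_test'[OF summable_mult[OF sD, of 2], of 0]) auto
  \<comment> \<open>Tannery's theorem: each coefficient is at most twice the L4 distance and tends
    to 0, with the summable \<open>2 * Dn g\<close> as majorant.\<close>
  have Er0: "Er \<longlonglongrightarrow> 0"
  proof -
    have "(\<lambda>r. Dn (\<lambda>x. g x - hh r x) i) \<longlonglongrightarrow> 0" for i
    proof (rule Lim_null_comparison)
      show "\<forall>\<^sub>F r in sequentially. norm (Dn (\<lambda>x. g x - hh r x) i) \<le> 2 * e r"
        using Dn_le_nrm[OF Lq_diff(1)[OF _ _ gL hL]] by (intro always_eventually) (auto simp: e_def Dn_nonneg)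
      show "(\<lambda>r. 2 * e r) \<longlonglongrightarrow> 0" using e0 by (rule tendsto_mult_right_zero)
    qed
    from tannerys_theorem[OF this _ summable_mult[OF sD, of 2] sequentially_bot]
    show ?thesis using Dgh2 Dn_nonneg unfolding Er_def[abs_def] by (auto simp: always_eventually)
  qed
  \<comment> \<open>A difference of two approximations is a difference of their errors to g, which
    gives the bound \<open>Er r + Er q\<close>; the larger of the two ranges serves for both
    kernels.\<close>
  have pd: "\<exists>d. profile (\<lambda>x. hh r x - hh q x) d (Er r + Er q)" and pa: "\<exists>d. profile (\<lambda>x. hh r x + hh q x) d (2 * suminf (Dn g))"
    and kd: "kern (max (mm r) (mm q)) (\<lambda>x. hh r x - hh q x)" and ka: "kern (max (mm r) (mm q)) (\<lambda>x. hh r x + hh q x)" for r q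
  proof -
    have km: "kern (max (mm r) (mm q)) (hh r)" "kern (max (mm r) (mm q)) (hh q)"
      by (rule kern_mono[OF k]; simp)+
    show kd: "kern (max (mm r) (mm q)) (\<lambda>x. hh r x - hh q x)" and ka: "kern (max (mm r) (mm q)) (\<lambda>x. hh r x + hh q x)"
      by (rule kern_add_diff[OF km])+
    have "Dn (\<lambda>x. hh r x - hh q x) i \<le> Dn (\<lambda>x. g x - hh r x) i + Dn (\<lambda>x. g x - hh q x) i" for i
      using Dn_add_diff(2)[OF Lq_diff(1)[OF _ _ gL hL[of q]] Lq_diff(1)[OF _ _ gL hL[of r]], of i] by simp
    from profile_Dn[OF kd this summable_add[OF sE sE]]
    show "\<exists>d. profile (\<lambda>x. hh r x - hh q x) d (Er r + Er q)"
      unfolding Er_def suminf_add[OF sE sE, symmetric] by blast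
    have "Dn (\<lambda>x. hh r x + hh q x) i \<le> 2 * Dn g i" for i
      using Dn_add_diff(1)[OF hL[of r] hL[of q], of i] Dh[of r i] Dh[of q i] by linarith
    from profile_Dn[OF ka this summable_mult[OF sD]]
    show "\<exists>d. profile (\<lambda>x. hh r x + hh q x) d (2 * suminf (Dn g))"
      unfolding suminf_mult[OF sD] by blast
  qed

  define sM where "sM n = sqrt (\<integral>\<omega>. (\<Sum>i\<le>n. proj M N \<epsilon> 0 (Xproc \<epsilon> g (int i)) \<omega>)\<^sup>2 \<partial>M)" for n
  \<comment> \<open>\<open>sproj_diff_le\<close> concerns bounded kernels, so g is reached as the
    limit of \<open>hh q\<close> with n and r fixed. The remaining bound is free of n.\<close>
  have sM_approx: "\<bar>sM n - sproj (hh r) n\<bar> \<le> Er r" for r n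
  proof -
    have sM: "(\<lambda>q. sproj (hh q) n) \<longlonglongrightarrow> sM n"
    proof (rule LIM_zero_cancel, rule Lim_null_comparison)
      show "\<forall>\<^sub>F q in sequentially. norm (sproj (hh q) n - sM n) \<le> real (Suc n) * (2 * e q)"
        using sum_proj_diff_le[OF gL k, of n]
        by (intro always_eventually) (auto simp: sM_def e_def nrm_def sqrt_def abs_minus_commute)
      show "(\<lambda>q. real (Suc n) * (2 * e q)) \<longlonglongrightarrow> 0" by (intro tendsto_mult_right_zero e0)
    qed
    have le: "\<bar>sproj (hh q) n - sproj (hh r) n\<bar> \<le> Er q + Er r" for q
    proof -
      obtain d where "profile (\<lambda>x. hh q x - hh r x) d (Er q + Er r)" using pd by blast
      then show ?thesis
        by (intro sproj_diff_le[of "max (mm q) (mm r)"]) (rule kern_mono[OF k], simp)+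
    qed
    have "(\<lambda>q. \<bar>sproj (hh q) n - sproj (hh r) n\<bar>) \<longlonglongrightarrow> \<bar>sM n - sproj (hh r) n\<bar>"
      by (intro tendsto_intros sM)
    moreover have "(\<lambda>q. Er q + Er r) \<longlonglongrightarrow> 0 + Er r" by (intro tendsto_intros Er0)
    ultimately have "\<bar>sM n - sproj (hh r) n\<bar> \<le> 0 + Er r" by (rule LIMSEQ_le) (use le in blast)
    then show ?thesis by simp
  qed
  have ph: "\<exists>d. profile (hh r) d (suminf (Dn g))" for r
    using profile_Dn[OF k Dh sD] by blast
  have "(\<lambda>n. sproj (hh r) n) \<longlonglongrightarrow> sproj (hh r) (mm r)" for r
    using ph[of r] kernel_asymp(2)[OF k] by blast
  from uniform_approx_convergent[OF sM_approx Er0 this]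
  obtain L where L: "(\<lambda>r. sproj (hh r) (mm r)) \<longlonglongrightarrow> L" "sM \<longlonglongrightarrow> L" by blast
  \<comment> \<open>\<open>sM\<close> has been shown to converge, so the \<open>lim\<close> in the
    definition of \<sigma> denotes the actual limit.\<close>
  have sigma: "sigma_lr M N \<epsilon> g = L" unfolding sigma_lr_def using limI[OF L(2)] by (simp add: sM_def[abs_def])

  define cn where "cn h n = cnrm (Qsum h h {1..n} AA AA)" for h n
  define R where "R n = real n powr (2 - 3 / (2 * p))" for n :: nat
  define \<kappa> where "\<kappa> = p\<^sup>2 * c powr (3 / (2 * p)) / sqrt (12 * p - 9)"
  obtain C where C: "0 \<le> C" and Cle: "\<And>n m u v du dv \<Delta>u \<Delta>v. 1 \<le> n \<Longrightarrow> kern m u \<Longrightarrow> kern m v \<Longrightarrow> profile u du \<Delta>u \<Longrightarrow> profile v dv \<Delta>v \<Longrightarrow>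
      cnrm (Qsum u v {1..n} AA AA) \<le> C * \<Delta>u * \<Delta>v * R n"
    using Qsum_bound unfolding R_def by blast
  define D where "D = 2 * suminf (Dn g)"
  have cn_diff: "\<bar>cn (hh q) n - cn (hh r) n\<bar> \<le> C * (Er q + Er r) * D * R n" if n: "1 \<le> n" for q r n
  proof -
    obtain d1 d2 where d: "profile (\<lambda>x. hh q x - hh r x) d1 (Er q + Er r)" "profile (\<lambda>x. hh q x + hh r x) d2 D"
      using pd pa unfolding D_def by blast
    have "\<bar>cn (hh q) n - cn (hh r) n\<bar> \<le> nrm 2 P (\<lambda>x. (Qsum (hh q) (hh q) {1..n} AA AA x - Qsum (hh r) (hh r) {1..n} AA AA x)
        - (\<integral>x. Qsum (hh q) (hh q) {1..n} AA AA x - Qsum (hh r) (hh r) {1..n} AA AA x \<partial>P))"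
      unfolding cn_def by (rule nrm_centered_triangle[OF bm_Qsum[OF k k] bm_Qsum[OF k k]])
    also have "\<dots> \<le> C * (Er q + Er r) * D * R n"
      unfolding Qsum_square_diff by (rule Cle[OF n kd ka d])
    finally show ?thesis .
  qed
  \<comment> \<open>The same passage to g at fixed n, now for the quadratic forms; after division by
    \<open>R n\<close> the error is free of n.\<close>
  have cn_g: "\<bar>cn g n - cn (hh r) n\<bar> \<le> C * Er r * D * R n" if n: "1 \<le> n" for r n
  proof -
    have lim: "(\<lambda>q. cn (hh q) n) \<longlonglongrightarrow> cn g n"
      unfolding cn_def using e0 by (intro centered_Qsum_approx gL hL) (simp add: e_def[abs_def])
    have "(\<lambda>q. \<bar>cn (hh q) n - cn (hh r) n\<bar>) \<longlonglongrightarrow> \<bar>cn g n - cn (hh r) n\<bar>" by (intro tendsto_intros lim)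
    moreover have "(\<lambda>q. C * (Er q + Er r) * D * R n) \<longlonglongrightarrow> C * (0 + Er r) * D * R n" by (intro tendsto_intros Er0)
    ultimately have "\<bar>cn g n - cn (hh r) n\<bar> \<le> C * (0 + Er r) * D * R n" by (rule LIMSEQ_le) (use cn_diff[OF n] in blast)
    then show ?thesis by simp
  qed
  have main: "(\<lambda>n. cn g n / R n) \<longlonglongrightarrow> L\<^sup>2 * \<kappa>"
  proof (rule uniform_approx_limit[where y="\<lambda>r n. cn (hh r) n / R n" and e="\<lambda>r. C * Er r * D"])
    fix r n :: nat assume n: "1 \<le> n"
    then have R: "0 < R n" by (simp add: R_def)
    have "cn g n / R n - cn (hh r) n / R n = (cn g n - cn (hh r) n) / R n" by (simp add: diff_divide_distrib)
    then show "\<bar>cn g n / R n - cn (hh r) n / R n\<bar> \<le> C * Er r * D" using cn_g[OF n, of r] R by (simp add: abs_divide divide_le_eq)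
  next
    show "(\<lambda>r. C * Er r * D) \<longlonglongrightarrow> 0" by (intro tendsto_mult_left_zero tendsto_mult_right_zero Er0)
    show "(\<lambda>n. cn (hh r) n / R n) \<longlonglongrightarrow> (sproj (hh r) (mm r))\<^sup>2 * \<kappa>" for r
      using ph[of r] kernel_asymp(1)[OF k[of r]] unfolding cn_def R_def \<kappa>_def by blast
    show "(\<lambda>r. (sproj (hh r) (mm r))\<^sup>2 * \<kappa>) \<longlonglongrightarrow> L\<^sup>2 * \<kappa>" by (intro tendsto_intros L)
  qed
  have V: "sqrt (\<integral>\<omega>. (Vn (Xproc \<epsilon> g) (\<lambda>k. \<lfloor>c * real k powr p\<rfloor>) n \<omega>
       - (\<integral>\<omega>'. Vn (Xproc \<epsilon> g) (\<lambda>k. \<lfloor>c * real k powr p\<rfloor>) n \<omega>' \<partial>M))\<^sup>2 \<partial>M) = cn g n" for n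
  proof -
    let ?Q = "Qsum g g {1..n} AA AA"
    have Q [measurable]: "?Q \<in> borel_measurable P" by (rule LqD(1)[OF Qsum_Lq(1)[OF gL gL]])
    have "Vn (Xproc \<epsilon> g) (\<lambda>k. \<lfloor>c * real k powr p\<rfloor>) n \<omega> = ?Q (EE \<omega>)" for \<omega>
      unfolding Vn_def Wblk_def Qsum_def Wsum_def power2_eq_square Xproc_eq AA_def
      by (intro sum.cong refl) (simp add: tblk_eq)
    then have "sqrt (\<integral>\<omega>. (Vn (Xproc \<epsilon> g) (\<lambda>k. \<lfloor>c * real k powr p\<rfloor>) n \<omega>
       - (\<integral>\<omega>'. Vn (Xproc \<epsilon> g) (\<lambda>k. \<lfloor>c * real k powr p\<rfloor>) n \<omega>' \<partial>M))\<^sup>2 \<partial>M)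
       = nrm 2 M (\<lambda>\<omega>. ?Q (EE \<omega>) - (\<integral>x. ?Q x \<partial>P))"
      using integral_EE[OF Q] by (simp add: nrm_def sqrt_def)
    also have "\<dots> = cn g n" unfolding cn_def by (rule nrm_EE) measurable
    finally show ?thesis .
  qed
  show ?thesis using main unfolding V sigma \<kappa>_def R_def by (simp add: mult.assoc)
qed

end
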